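(* Let $n\geq 3$. For every $x\in \mathbb{B}^n\setminus\{0\}$ we have \[ C(x)=C(x,\boldsymbol{n}_x), \] where $\boldsymbol{n}_x:=x/|x|$ is the unit outward normal vector to the sphere $|x|\mathbb{S}^{n-1}$ at $x$.
   Context: $\mathbb{B}^n$ is the open unit ball of $\mathbb{R}^n$, $\mathbb{S}^{n-1}=\partial\mathbb{B}^n$, and $h^\infty$ is the space of bounded harmonic functions on $\mathbb{B}^n$. For $x\in\mathbb{B}^n$, $C(x)$ denotes the smallest number such that $|\nabla u(x)|\leq C(x)\sup_{y\in\mathbb{B}^n}|u(y)|$ for all $u\in h^\infty$. For $x\in\mathbb{B}^n$ and $\boldsymbol{\ell}\in\mathbb{S}^{n-1}$, $C(x,\boldsymbol{\ell})$ denotes the smallest number such that $|\langle\nabla u(x),\boldsymbol{\ell}\rangle|\leq C(x,\boldsymbol{\ell})\sup_{y\in\mathbb{B}^n}|u(y)|$ for all $u\in h^\infty$. (Both are finite.) *)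

theory Defs
  imports "HOL-Analysis.Analysis"
begin

definition harmonic_on :: "('a::euclidean_space \<Rightarrow> real) \<Rightarrow> 'a set \<Rightarrow> bool" where
  "harmonic_on u S \<longleftrightarrow>
     (\<exists>g :: 'a \<Rightarrow> 'a. \<exists>H :: 'a \<Rightarrow> 'a \<Rightarrow> 'a.
        (\<forall>x\<in>S. (u has_derivative (\<lambda>h. g x \<bullet> h)) (at x)) \<and>
        (\<forall>x\<in>S. (g has_derivative H x) (at x)) \<and>
        (\<forall>i\<in>Basis. continuous_on S (\<lambda>x. H x i)) \<and>
        (\<forall>x\<in>S. (\<Sum>i\<in>Basis. H x i \<bullet> i) = 0))"

definition grad :: "('a::euclidean_space \<Rightarrow> real) \<Rightarrow> 'a \<Rightarrow> 'a" where
  "grad u x = (\<Sum>i\<in>Basis. frechet_derivative u (at x) i *\<^sub>R i)"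

definition hinf :: "('a::euclidean_space \<Rightarrow> real) set" where
  "hinf = {u. harmonic_on u (ball 0 1) \<and> bounded (u ` ball 0 1)}"

definition supnorm :: "('a::euclidean_space \<Rightarrow> real) \<Rightarrow> real" where
  "supnorm u = (SUP y\<in>ball (0::'a) 1. \<bar>u y\<bar>)"

definition Cgrad :: "'a::euclidean_space \<Rightarrow> real" where
  "Cgrad x = Inf {c. \<forall>u\<in>(hinf :: ('a \<Rightarrow> real) set). norm (grad u x) \<le> c * supnorm u}"

definition Cdir :: "'a::euclidean_space \<Rightarrow> 'a \<Rightarrow> real" where
  "Cdir x l = Inf {c. \<forall>u\<in>(hinf :: ('a \<Rightarrow> real) set). \<bar>grad u x \<bullet> l\<bar> \<le> c * supnorm u}"

end

theory Submission
  imports Defs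
begin

text \<open>
  Let \<open>u\<close> be harmonic near the closed ball. An inversion \<open>\<phi>\<close> that preserves the ball and exchanges \<open>0\<close> and \<open>x\<close>
  makes the Kelvin transform \<open>v(y) = \<bar>y - c\<bar>^(2 - n) u(\<phi>(y))\<close> harmonic, and the mean value formulas for \<open>v(0)\<close> and
  \<open>\<nabla>v(0)\<close> express \<open>\<nabla>u(x) \<bullet> l\<close> as a constant times the integral of \<open>v(\<eta>) ((\<eta> - z) \<bullet> l')\<close> over the unit sphere,
  where \<open>z = ((n - 2) / n) x\<close> and \<open>l'\<close> is the mirror image of \<open>l\<close> in the hyperplane orthogonal to \<open>x\<close>.
  Hence \<open>C(x, l)\<close> is a constant times the integral of \<open>\<bar>\<eta> - c\<bar>^(2 - n) \<bar>(\<eta> - z) \<bullet> l'\<bar>\<close>; that the sign of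
  \<open>(\<eta> - z) \<bullet> l'\<close> is nearly attained by a harmonic function is only needed for \<open>l\<close> parallel to \<open>x\<close>, where it is
  a zonal function.

  In polar coordinates \<open>\<eta> = z + \<rho> w\<close> this integral becomes the integral of \<open>N(w) \<bar>w \<bullet> l'\<bar>\<close> over directions \<open>w\<close>,
  where only \<open>E(w) = N(w) + N(- w)\<close> matters. Writing the two distances from \<open>z\<close> to the sphere along the line in
  direction \<open>w\<close> as \<open>A exp(\<mp> s)\<close>, one finds with \<open>p = (n - 2) / 2\<close>, up to a constant factor,
  \<open>E = (exp(- 2 s) (1 - b exp(2 s))^(- p) + exp(2 s) (1 - b exp(- 2 s))^(- p)) / cosh s\<close>,
  and the binomial series shows that this increases with \<open>\<bar>s\<bar>\<close>, that is, with \<open>\<bar>w \<bullet> x\<bar>\<close>. Reflecting in the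
  hyperplane that swaps \<open>l'\<close> and \<open>x / \<bar>x\<bar>\<close> then proves that the integral is largest for \<open>l'\<close> parallel to \<open>x\<close>.
\<close>

section \<open>Lebesgue measure: lines, hyperplane reflections, polar coordinates\<close>

text \<open>A bounded harmonic function on the open ball comes without boundary values, so every
  formula is proved for functions harmonic near the closed ball and carried over by the dilations
  \<open>u (s *\<^sub>R y)\<close> with s -> 1. The Kelvin transform stands in for Poisson's
  formula: once x sits at the centre, only mean values at 0 are required. These follow from
  integration by parts against the cutoff 1 - |y|^2, which vanishes on the sphere and so leaves no
  boundary term. The surface integral then appears as the derivative at R = 1 of integrals over
  balls of radius R; it can be computed in polar coordinates about any interior point, which is what
  permits the move from 0 to z. That move is forced: the factor |y - c|^(2 - n) puts a multiple of
  u(x) into the gradient of v at 0, and subtracting z removes it.\<close>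

lemma nn_integral_lborel_affine:
  fixes f :: "'a::euclidean_space \<Rightarrow> ennreal"
  assumes [measurable]: "f \<in> borel_measurable borel" and c: "c \<noteq> 0"
  shows "(\<integral>\<^sup>+y. f y \<partial>lborel) = ennreal (\<bar>c\<bar> ^ DIM('a)) * (\<integral>\<^sup>+y. f (t + c *\<^sub>R y) \<partial>lborel)"
  by (subst lborel_affine[OF c, of t])
     (simp add: nn_integral_density nn_integral_distr nn_integral_cmult)

lemma nn_integral_lborel_translate:
  fixes f :: "'a::euclidean_space \<Rightarrow> ennreal"
  assumes [measurable]: "f \<in> borel_measurable borel"
  shows "(\<integral>\<^sup>+y. f (t + y) \<partial>lborel) = (\<integral>\<^sup>+y. f y \<partial>lborel)"
  using nn_integral_lborel_affine[of f 1 t] by simp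

lemma integral_lborel_affine:
  fixes f :: "'a::euclidean_space \<Rightarrow> real"
  assumes [measurable]: "f \<in> borel_measurable borel" and c: "c \<noteq> 0"
  shows "(\<integral>y. f y \<partial>lborel) = \<bar>c\<bar> ^ DIM('a) * (\<integral>y. f (t + c *\<^sub>R y) \<partial>lborel)"
  by (subst lborel_affine[OF c, of t])
     (simp add: integral_density integral_distr)

definition mirror :: "'a::euclidean_space \<Rightarrow> 'a \<Rightarrow> 'a" where
  "mirror v h = h - (2 * (h \<bullet> v)) *\<^sub>R v"

lemma mirror_measurable [measurable]: "mirror v \<in> borel_measurable borel"
  unfolding mirror_def by measurable

text \<open>Each line in direction \<open>v\<close> meets the slab
  \<open>0 \<le> h \<bullet> v \<le> 1\<close> in a segment of length one, so integrating the line
  integrals over the slab counts every line once. This is Fubini in an arbitrary direction, without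
  rotating a basis.\<close>

lemma nn_integral_via_lines:
  fixes f :: "'a::euclidean_space \<Rightarrow> ennreal"
  assumes [measurable]: "f \<in> borel_measurable borel" and v: "norm v = 1"
  shows "(\<integral>\<^sup>+h. f h \<partial>lborel)
       = (\<integral>\<^sup>+h. indicator {0..1} (h \<bullet> v) * (\<integral>\<^sup>+t. f (h + t *\<^sub>R v) \<partial>lborel) \<partial>lborel)"
proof -
  have vv: "v \<bullet> v = 1" using v by (simp add: norm_eq_1)
  have one: "(\<integral>\<^sup>+t. indicator {0..1} (a + t) \<partial>lborel) = (1 :: ennreal)" for a :: real
    using nn_integral_lborel_translate[of "indicator {0..1}" a] by simp
  have "(\<integral>\<^sup>+h. f h \<partial>lborel) = (\<integral>\<^sup>+h. f h * (\<integral>\<^sup>+t. indicator {0..1} (h \<bullet> v + t) \<partial>lborel) \<partial>lborel)"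
    by (simp add: one)
  also have "\<dots> = (\<integral>\<^sup>+h. (\<integral>\<^sup>+t. f h * indicator {0..1} (h \<bullet> v + t) \<partial>lborel) \<partial>lborel)"
    by (intro nn_integral_cong) (simp add: nn_integral_cmult)
  also have "\<dots> = (\<integral>\<^sup>+t. (\<integral>\<^sup>+h. f h * indicator {0..1} (h \<bullet> v + t) \<partial>lborel) \<partial>lborel)"
    by (intro lborel_pair.Fubini') measurable
  also have "\<dots> = (\<integral>\<^sup>+t. (\<integral>\<^sup>+h. f (h - t *\<^sub>R v) * indicator {0..1} (h \<bullet> v) \<partial>lborel) \<partial>lborel)"
  proof (rule nn_integral_cong)
    fix t :: real
    have "(\<integral>\<^sup>+h. f h * indicator {0..1} (h \<bullet> v + t) \<partial>lborel)
       = (\<integral>\<^sup>+h. f (- t *\<^sub>R v + h) * indicator {0..1} ((- t *\<^sub>R v + h) \<bullet> v + t) \<partial>lborel)"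
      by (rule nn_integral_lborel_translate[symmetric]) measurable
    then show "(\<integral>\<^sup>+h. f h * indicator {0..1} (h \<bullet> v + t) \<partial>lborel)
       = (\<integral>\<^sup>+h. f (h - t *\<^sub>R v) * indicator {0..1} (h \<bullet> v) \<partial>lborel)"
      by (simp add: algebra_simps vv)
  qed
  also have "\<dots> = (\<integral>\<^sup>+t. (\<integral>\<^sup>+h. f (h + t *\<^sub>R v) * indicator {0..1} (h \<bullet> v) \<partial>lborel) \<partial>lborel)"
    using nn_integral_lborel_affine[of "\<lambda>t. (\<integral>\<^sup>+h. f (h - t *\<^sub>R v) * indicator {0..1} (h \<bullet> v) \<partial>lborel)" "-1" 0]
    by simp
  also have "\<dots> = (\<integral>\<^sup>+h. (\<integral>\<^sup>+t. f (h + t *\<^sub>R v) * indicator {0..1} (h \<bullet> v) \<partial>lborel) \<partial>lborel)"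
    by (intro lborel_pair.Fubini') measurable
  also have "\<dots> = (\<integral>\<^sup>+h. indicator {0..1} (h \<bullet> v) * (\<integral>\<^sup>+t. f (h + t *\<^sub>R v) \<partial>lborel) \<partial>lborel)"
    by (intro nn_integral_cong) (simp add: nn_integral_multc, simp add: mult.commute)
  finally show ?thesis .
qed

text \<open>On the line through \<open>h\<close> the reflection is
  \<open>t \<mapsto> - 2 * (h \<bullet> v) - t\<close>, which preserves one-dimensional Lebesgue
  measure. The slab of \<open>nn_integral_via_lines\<close> concerns the outer variable only and is
  not reflected.\<close>

lemma nn_integral_mirror:
  fixes f :: "'a::euclidean_space \<Rightarrow> ennreal"
  assumes [measurable]: "f \<in> borel_measurable borel" and v: "norm v = 1"
  shows "(\<integral>\<^sup>+h. f (mirror v h) \<partial>lborel) = (\<integral>\<^sup>+h. f h \<partial>lborel)"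
proof -
  have vv: "v \<bullet> v = 1" using v by (simp add: norm_eq_1)
  have "(\<integral>\<^sup>+t. f (mirror v (h + t *\<^sub>R v)) \<partial>lborel) = (\<integral>\<^sup>+t. f (h + t *\<^sub>R v) \<partial>lborel)" for h
  proof -
    have "mirror v (h + t *\<^sub>R v) = h + (- 2 * (h \<bullet> v) + (- 1) *\<^sub>R t) *\<^sub>R v" for t
      by (simp add: mirror_def inner_add_left vv algebra_simps flip: scaleR_add_left)
    then show ?thesis
      using nn_integral_lborel_affine[of "\<lambda>t. f (h + t *\<^sub>R v)" "-1" "- 2 * (h \<bullet> v)"] by simp
  qed
  then show ?thesis
    by (simp add: nn_integral_via_lines[OF _ v, of "\<lambda>h. f (mirror v h)"] nn_integral_via_lines[OF _ v, of f])
qed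

lemma integral_mirror:
  fixes f :: "'a::euclidean_space \<Rightarrow> real"
  assumes [measurable]: "f \<in> borel_measurable borel" and v: "norm v = 1"
  shows "(\<integral>h. f (mirror v h) \<partial>lborel) = (\<integral>h. f h \<partial>lborel)"
proof -
  have "distr lborel borel (mirror v) = (lborel :: 'a measure)"
  proof (rule measure_eqI)
    fix A :: "'a set" assume "A \<in> sets (distr lborel borel (mirror v))"
    then have [measurable]: "A \<in> sets borel" by simp
    have "emeasure (distr lborel borel (mirror v)) A = (\<integral>\<^sup>+h. indicator A h \<partial>distr lborel borel (mirror v))"
      by simp
    also have "\<dots> = (\<integral>\<^sup>+h. indicator A (mirror v h) \<partial>lborel)"
      by (rule nn_integral_distr) measurable
    also have "\<dots> = (\<integral>\<^sup>+h. indicator A h \<partial>lborel)"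
      by (rule nn_integral_mirror[OF _ v]) measurable
    finally show "emeasure (distr lborel borel (mirror v)) A = emeasure lborel A" by simp
  qed simp
  then show ?thesis
    using integral_distr[of "mirror v" lborel borel f] by simp
qed

abbreviation (input) dir :: "'a::euclidean_space \<Rightarrow> 'a" where
  "dir h \<equiv> h /\<^sub>R norm h"

text \<open>Directions are represented by \<open>dir h\<close> with \<open>h\<close> ranging over
  the solid unit ball. This gives 1/n of the surface measure, hence the factor
  \<open>DIM('a)\<close>. After rescaling \<open>t\<close> by \<open>norm h\<close>, the
  substitution \<open>y = t *\<^sub>R h\<close> leaves an integral over \<open>t > norm y\<close>,
  which \<open>radial\<close> evaluates.\<close>

lemma nn_integral_polar:
  fixes f :: "'a::euclidean_space \<Rightarrow> ennreal"
  assumes [measurable]: "f \<in> borel_measurable borel"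
  shows "(\<integral>\<^sup>+y. f y \<partial>lborel)
     = (\<integral>\<^sup>+h. indicator (ball 0 1) h *
          (\<integral>\<^sup>+t. ennreal (DIM('a) * t ^ (DIM('a) - 1)) * indicator {0<..} t * f (t *\<^sub>R dir h) \<partial>lborel) \<partial>lborel)"
proof -
  let ?n = "DIM('a)"
  let ?m = "\<lambda>t::real. ennreal (?n * t ^ (?n - 1)) * indicator {0<..} t"
  let ?k = "\<lambda>(h::'a) t. ?m t * ennreal (norm h ^ ?n) * f (t *\<^sub>R h)"
  let ?l = "\<lambda>(y::'a) t. indicator (ball 0 1) (0 + (1 / t) *\<^sub>R y) * (?m t * ennreal (norm (0 + (1 / t) *\<^sub>R y) ^ ?n) * f (t *\<^sub>R (0 + (1 / t) *\<^sub>R y)))"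
  let ?j = "\<lambda>(y::'a) t. ?m t * ennreal ((1 / t) ^ (2 * ?n)) * indicator {norm y<..} t * (ennreal (norm y ^ ?n) * f y)"
  have n: "?n \<ge> 1" by (simp add: Suc_leI)
  have [measurable]: "ball (0::'a) 1 \<in> sets borel" by simp
  have inner: "(\<integral>\<^sup>+t. ?m t * f (t *\<^sub>R dir h) \<partial>lborel)
     = (\<integral>\<^sup>+t. ?k h t \<partial>lborel)"
    if "h \<noteq> 0" for h :: 'a
  proof -
    have nh: "norm h > 0" using that by simp
    have "(\<integral>\<^sup>+t. ?m t * f (t *\<^sub>R dir h) \<partial>lborel)
      = ennreal (norm h) * (\<integral>\<^sup>+t. ?m (norm h * t) * f ((norm h * t) *\<^sub>R dir h) \<partial>lborel)"
      using that by (subst nn_integral_lborel_affine[where c="norm h" and t=0]) (simp_all add: mult_ac)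
    also have "\<dots> = (\<integral>\<^sup>+t. ennreal (norm h) * (?m (norm h * t) * f ((norm h * t) *\<^sub>R dir h)) \<partial>lborel)"
      by (rule nn_integral_cmult[symmetric]) measurable
    also have "\<dots> = (\<integral>\<^sup>+t. ?k h t \<partial>lborel)"
    proof (rule nn_integral_cong)
      fix t :: real
      have "norm h ^ ?n = norm h * norm h ^ (?n - 1)" using n by (simp add: power_eq_if)
      then have "ennreal (norm h) * ennreal (?n * (norm h * t) ^ (?n - 1)) = ennreal (?n * t ^ (?n - 1)) * ennreal (norm h ^ ?n)"
        if "t > 0" using that nh
        by (simp add: ennreal_mult[symmetric] power_mult_distrib mult_ac)
      moreover have "indicator {0<..} (norm h * t) = (indicator {0<..} t :: ennreal)"
        using nh by (auto simp: indicator_def zero_less_mult_iff)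
      moreover have "(norm h * t) *\<^sub>R dir h = t *\<^sub>R h" using nh by (simp add: field_simps)
      ultimately show "ennreal (norm h) * (?m (norm h * t) * f ((norm h * t) *\<^sub>R dir h))
         = ?k h t"
        by (cases "t > 0") (simp_all only: mult.assoc[symmetric], simp_all only: mult_ac, simp)
    qed
    finally show ?thesis .
  qed
  have radial: "(\<integral>\<^sup>+t. ?m t * ennreal ((1 / t) ^ (2 * ?n)) * indicator {c<..} t \<partial>lborel)
      = ennreal (1 / c ^ ?n)" if c: "c > 0" for c :: real
  proof -
    have "(\<integral>\<^sup>+t. ?m t * ennreal ((1 / t) ^ (2 * ?n)) * indicator {c<..} t \<partial>lborel)
       = (\<integral>\<^sup>+t. ennreal (?n * (1 / t) ^ (?n + 1)) * indicator {c..} t \<partial>lborel)"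
    proof (rule nn_integral_cong_AE)
      have "AE t in lborel. t \<noteq> c" by (rule AE_lborel_singleton)
      then show "AE t in lborel. ?m t * ennreal ((1 / t) ^ (2 * ?n)) * indicator {c<..} t
         = ennreal (?n * (1 / t) ^ (?n + 1)) * indicator {c..} t"
      proof eventually_elim
        case (elim t)
        have "t ^ (?n - 1) * (1 / t) ^ (2 * ?n) = (1 / t) ^ (?n + 1)" if "t > 0"
        proof -
          have "2 * ?n = (?n - 1) + (?n + 1)" using n by simp
          then have "(1 / t) ^ (2 * ?n) = (1 / t) ^ (?n - 1) * (1 / t) ^ (?n + 1)"
            by (metis power_add)
          then show ?thesis using that by (simp add: power_one_over)
        qed
        then show ?case using elim c
          by (cases "t > c") (auto simp: ennreal_mult[symmetric] mult.assoc)
      qed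
    qed
    also have "\<dots> = 0 - (- (1 / c ^ ?n))"
    proof (rule nn_integral_FTC_atLeast)
      fix x assume "c \<le> x"
      then have x: "x > 0" using c by simp
      show "((\<lambda>t. - (1 / t ^ ?n)) has_real_derivative ?n * (1 / x) ^ (?n + 1)) (at x)"
      proof -
        have "x ^ ?n = x * x ^ (?n - 1)" using n by (simp add: power_eq_if)
        then show ?thesis using x
          by (auto intro!: derivative_eq_intros simp: power_one_over field_simps)
      qed
      show "0 \<le> ?n * (1 / x) ^ (?n + 1)" using x by simp
    next
      have "((\<lambda>t::real. (inverse t) ^ ?n) \<longlongrightarrow> 0 ^ ?n) at_top"
        by (intro tendsto_power tendsto_inverse_0_at_top filterlim_ident)
      then have "((\<lambda>t::real. - ((inverse t) ^ ?n)) \<longlongrightarrow> - (0 ^ ?n)) at_top" by (rule tendsto_minus)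
      then show "((\<lambda>t::real. - (1 / t ^ ?n)) \<longlongrightarrow> 0) at_top"
        using n by (simp add: power_one_over inverse_eq_divide zero_power)
    qed measurable
    finally show ?thesis by simp
  qed
  have "(\<integral>\<^sup>+h. indicator (ball 0 1) h *
          (\<integral>\<^sup>+t. ?m t * f (t *\<^sub>R dir h) \<partial>lborel) \<partial>lborel)
     = (\<integral>\<^sup>+(h::'a). (\<integral>\<^sup>+t. indicator (ball 0 1) h * (?k h t) \<partial>lborel) \<partial>lborel)"
  proof (rule nn_integral_cong_AE)
    have "AE h in lborel. h \<noteq> (0::'a)" by (rule AE_lborel_singleton)
    then show "AE h in lborel. indicator (ball 0 1) h *
          (\<integral>\<^sup>+t. ?m t * f (t *\<^sub>R dir h) \<partial>lborel)
       = (\<integral>\<^sup>+t. indicator (ball 0 1) h * (?k h t) \<partial>lborel)"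
    proof eventually_elim
      case (elim h)
      show ?case unfolding inner[OF elim] by (rule nn_integral_cmult[symmetric]) measurable
    qed
  qed
  also have "\<dots> = (\<integral>\<^sup>+t. (\<integral>\<^sup>+(h::'a). indicator (ball 0 1) h * (?k h t) \<partial>lborel) \<partial>lborel)"
    by (intro lborel_pair.Fubini') measurable
  also have "\<dots> = (\<integral>\<^sup>+t. (\<integral>\<^sup>+(y::'a). ?j y t \<partial>lborel) \<partial>lborel)"
  proof (rule nn_integral_cong)
    fix t :: real
    show "(\<integral>\<^sup>+(h::'a). indicator (ball 0 1) h * (?k h t) \<partial>lborel)
      = (\<integral>\<^sup>+(y::'a). ?j y t \<partial>lborel)"
    proof (cases "t > 0")
      case True
      have "(\<integral>\<^sup>+(h::'a). indicator (ball 0 1) h * (?k h t) \<partial>lborel)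
        = ennreal (\<bar>1 / t\<bar> ^ ?n) * (\<integral>\<^sup>+(y::'a). ?l y t \<partial>lborel)"
        using True by (intro nn_integral_lborel_affine) auto
      also have "\<dots> = (\<integral>\<^sup>+(y::'a). ennreal (\<bar>1 / t\<bar> ^ ?n) * (?l y t) \<partial>lborel)"
        by (rule nn_integral_cmult[symmetric]) measurable
      also have "\<dots> = (\<integral>\<^sup>+(y::'a). ?j y t \<partial>lborel)"
      proof (rule nn_integral_cong)
        fix y :: 'a
        have 1: "indicator (ball 0 1) (0 + (1 / t) *\<^sub>R y) = (indicator {norm y<..} t :: ennreal)"
          using True by (auto simp: indicator_def field_simps)
        have 2: "ennreal (norm (0 + (1 / t) *\<^sub>R y) ^ ?n) = ennreal ((1 / t) ^ ?n) * ennreal (norm y ^ ?n)"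
          using True by (simp add: ennreal_mult[symmetric] power_mult_distrib[symmetric])
        have 3: "ennreal ((1 / t) ^ (2 * ?n)) = ennreal (\<bar>1 / t\<bar> ^ ?n) * ennreal ((1 / t) ^ ?n)"
          using True by (simp add: ennreal_mult[symmetric] power_add[symmetric] mult_2)
        show "ennreal (\<bar>1 / t\<bar> ^ ?n) * (?l y t)
          = ?j y t"
          unfolding 1 2 3 using True by (simp add: mult_ac)
      qed
      finally show ?thesis .
    qed simp
  qed
  also have "\<dots> = (\<integral>\<^sup>+(y::'a). (\<integral>\<^sup>+t. ?j y t \<partial>lborel) \<partial>lborel)"
    by (intro lborel_pair.Fubini') (simp add: indicator_def greaterThan_def, measurable)
  also have "\<dots> = (\<integral>\<^sup>+(y::'a). f y \<partial>lborel)"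
  proof (rule nn_integral_cong_AE)
    have "AE h in lborel. h \<noteq> (0::'a)" by (rule AE_lborel_singleton)
    then show "AE y in lborel. (\<integral>\<^sup>+t. ?j y t \<partial>lborel) = f y"
    proof eventually_elim
      case (elim y)
      then have "(\<integral>\<^sup>+t. ?j y t \<partial>lborel)
        = ennreal (1 / norm y ^ ?n) * (ennreal (norm y ^ ?n) * f y)"
        by (subst nn_integral_multc) (measurable, subst radial, auto)
      also have "\<dots> = f y"
        using elim by (simp add: mult.assoc[symmetric] ennreal_mult[symmetric])
      finally show ?case .
    qed
  qed
  finally show ?thesis by simp
qed

section \<open>The one-variable inequality\<close>

text \<open>With denominators cleared, product-to-sum formulas reduce the claim to two comparisons
  of arguments of cosh: \<open>m * t + s\<close> with \<open>m * s + t\<close>, and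
  \<open>m * t - s\<close> with \<open>m * s - t\<close> in absolute value.\<close>

lemma cosh_quotient_mono:
  fixes m s t :: real
  assumes "m \<ge> 1" "0 \<le> t" "t \<le> s"
  shows "cosh (m * t) / cosh t \<le> cosh (m * s) / cosh s"
proof -
  have le: "m * t + s \<le> m * s + t"
    using mult_nonneg_nonneg[of "m - 1" "s - t"] assms by (simp add: algebra_simps)
  have a: "\<bar>m * t - s\<bar> \<le> \<bar>m * s - t\<bar>"
  proof -
    have "m * s \<ge> s" "m * t \<ge> t" using assms by (auto intro: mult_left_le mult_right_mono simp: mult_le_cancel_right1)
    moreover have "m * t \<le> m * s" using assms by (simp add: mult_left_mono)
    ultimately show ?thesis using assms by linarith
  qed
  have nn: "0 \<le> m * t" using assms by simp
  have c1: "cosh (m * t + s) \<le> cosh (m * s + t)"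
    using le nn assms by (subst cosh_real_nonneg_le_iff) auto
  have c2: "cosh (m * t - s) \<le> cosh (m * s - t)"
    using a by (metis abs_ge_zero cosh_real_abs cosh_real_nonneg_le_iff)
  have "cosh (m * t) * cosh s \<le> cosh (m * s) * cosh t"
    using c1 c2 by (simp add: cosh_add cosh_diff)
  then show ?thesis by (simp add: divide_simps mult.commute)
qed

text \<open>Rising factorials show that all coefficients are nonnegative for
  \<open>p \<ge> 0\<close>, which a termwise comparison needs.\<close>

lemma powr_neg_sums:
  fixes p x :: real
  assumes "\<bar>x\<bar> < 1"
  shows "(\<lambda>k. pochhammer p k / fact k * x ^ k) sums ((1 - x) powr - p)"
proof -
  have "(\<lambda>k. (- p gchoose k) * (- x) ^ k) sums (1 + - x) powr - p"
    using assms by (intro gen_binomial_real) simp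
  moreover have "(- p gchoose k) * (- x) ^ k = pochhammer p k / fact k * x ^ k" for k
  proof -
    have "(- p gchoose k) * (- x) ^ k = pochhammer p k / fact k * ((-1) ^ k * (- x) ^ k)"
      by (simp add: gbinomial_pochhammer)
    also have "(-1) ^ k * (- x) ^ k = x ^ k"
      by (metis mult_minus1 minus_minus power_mult_distrib)
    finally show ?thesis .
  qed
  ultimately show ?thesis by simp
qed

text \<open>The two summands come from the two ends of a chord of the sphere through \<open>z\<close>; in the binomial
  expansion only the term \<open>k = 1\<close> decreases with \<open>\<bar>s\<bar>\<close>, and it is dominated by the terms
  \<open>k = 0\<close> and \<open>k = 2\<close>.\<close>

definition antipodal :: "real \<Rightarrow> real \<Rightarrow> real \<Rightarrow> real" where
  "antipodal p b s = (exp (- 2 * s) * (1 - b * exp (2 * s)) powr - p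
                + exp (2 * s) * (1 - b * exp (- 2 * s)) powr - p) / cosh s"

lemma antipodal_minus: "antipodal p b (- s) = antipodal p b s"
  by (simp add: antipodal_def add.commute)

text \<open>The k-th powers pair up to \<open>exp ((2 * k - 2) * s)\<close> plus its reciprocal.
  Thus \<open>k = 1\<close> leaves 1 / cosh s, while \<open>k = 0\<close> and \<open>k = 2\<close>
  both give cosh (2 s) / cosh s.\<close>

lemma antipodal_sums:
  assumes b: "b \<ge> 0" and s: "b * exp (2 * s) < 1" "b * exp (- 2 * s) < 1"
  shows "(\<lambda>k. pochhammer p k / fact k * b ^ k * (2 * (cosh ((2 * real k - 2) * s) / cosh s)))
           sums antipodal p b s"
proof -
  have 1: "(\<lambda>k. pochhammer p k / fact k * (b * exp (2 * s)) ^ k) sums ((1 - b * exp (2 * s)) powr - p)"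
    using b s by (intro powr_neg_sums) auto
  have 2: "(\<lambda>k. pochhammer p k / fact k * (b * exp (-2 * s)) ^ k) sums ((1 - b * exp (- 2 * s)) powr - p)"
    using b s by (intro powr_neg_sums) auto
  have *: "(exp (- 2 * s) * (pochhammer p k / fact k * (b * exp (2 * s)) ^ k)
      + exp (2 * s) * (pochhammer p k / fact k * (b * exp (-2 * s)) ^ k)) / cosh s
      = pochhammer p k / fact k * b ^ k * (2 * (cosh ((2 * real k - 2) * s) / cosh s))" for k
  proof -
    have "exp (- 2 * s) * exp (2 * s) ^ k = exp ((2 * real k - 2) * s)"
      by (simp add: exp_of_nat_mult[symmetric] exp_add[symmetric] algebra_simps)
    moreover have "exp (2 * s) * exp (-2 * s) ^ k = exp (- ((2 * real k - 2) * s))"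
      by (simp add: exp_of_nat_mult[symmetric] exp_add[symmetric] algebra_simps)
    ultimately have e: "exp (- 2 * s) * exp (2 * s) ^ k + exp (2 * s) * exp (-2 * s) ^ k
       = 2 * cosh ((2 * real k - 2) * s)"
      by (simp add: cosh_def)
    have "exp (- 2 * s) * (pochhammer p k / fact k * (b * exp (2 * s)) ^ k)
      + exp (2 * s) * (pochhammer p k / fact k * (b * exp (-2 * s)) ^ k)
      = pochhammer p k / fact k * b ^ k * (exp (- 2 * s) * exp (2 * s) ^ k + exp (2 * s) * exp (-2 * s) ^ k)"
      by (simp add: power_mult_distrib algebra_simps)
    then show ?thesis using e by simp
  qed
  show ?thesis
    unfolding antipodal_def *[symmetric]
    by (intro sums_divide sums_add sums_mult 1 2)
qed

lemma antipodal_mono_nonneg: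
  assumes p: "p \<ge> 0" and b: "b \<ge> 0" and st: "0 \<le> t" "t \<le> s" and s: "b * exp (2 * s) < 1"
  shows "antipodal p b t \<le> antipodal p b s"
proof -
  have lt: "b * exp (2 * t) < 1" "b * exp (- 2 * t) < 1" "b * exp (- 2 * s) < 1"
    using st b s by (smt (verit) exp_le_cancel_iff mult_left_mono)+
  define d where "d k = pochhammer p k / fact k * b ^ k" for k
  define e where "e k = d k * (2 * (cosh ((2 * real k - 2) * s) / cosh s))
      - d k * (2 * (cosh ((2 * real k - 2) * t) / cosh t))" for k
  have d0: "d k \<ge> 0" for k unfolding d_def
  proof -
    have "pochhammer p k \<ge> 0" using p by (auto simp: pochhammer_prod intro!: prod_nonneg)
    then show "0 \<le> pochhammer p k / fact k * b ^ k" using b by simp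
  qed
  have sums: "e sums (antipodal p b s - antipodal p b t)"
    unfolding e_def d_def using antipodal_sums[OF b] s lt st by (intro sums_diff) auto
  have y: "1 \<le> cosh t" "cosh t \<le> cosh s"
    using st cosh_real_nonneg_le_iff[of t s] by (auto simp: cosh_real_ge_1)
  define X where "X = cosh s" define Y where "Y = cosh t"
  \<comment> \<open>\<open>D\<close> is the loss of 1 / cosh and \<open>X - Y\<close> the gain of
    cosh between \<open>t\<close> and \<open>s\<close>; since \<open>X * Y \<ge> 1\<close>, the gain
    is at least the loss.\<close>
  define D where "D = 1 / Y - 1 / X"
  have XY: "1 \<le> Y" "Y \<le> X" using y by (auto simp: X_def Y_def)
  have D0: "0 \<le> D" using XY by (auto simp: D_def divide_simps)
  have DXY: "D \<le> X - Y"
  proof -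
    have "D = (X - Y) / (X * Y)" using XY by (simp add: D_def field_simps)
    also have "\<dots> \<le> (X - Y) / 1" using XY
      by (intro divide_left_mono) (auto intro: order_trans[OF _ mult_mono[of 1 X 1 Y]])
    finally show ?thesis by simp
  qed
  have two: "cosh (2 * u) / cosh u = 2 * cosh u - 1 / cosh u" for u :: real
    using cosh_double_cosh[of u] by (simp add: power2_eq_square field_simps)
  have e0: "e 0 = 2 * (2 * (X - Y) + D)"
    using two[of s] two[of t] by (simp add: e_def d_def X_def Y_def D_def)
  have e1: "e 1 = - (2 * (p * b * D))"
    by (simp add: e_def d_def X_def Y_def D_def algebra_simps)
  have d2: "d 2 = p * (p + 1) * b^2 / 2"
    by (simp add: d_def numeral_2_eq_2 pochhammer_Suc)
  have "e 2 = 2 * d 2 * (cosh (2 * s) / cosh s - cosh (2 * t) / cosh t)"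
    by (simp add: e_def algebra_simps)
  also have "cosh (2 * s) / cosh s - cosh (2 * t) / cosh t = 2 * (X - Y) + D"
    unfolding two by (simp add: X_def Y_def D_def)
  finally have e2: "e 2 = p * (p + 1) * b^2 * (2 * (X - Y) + D)"
    by (simp add: d2)
  \<comment> \<open>Writing \<open>2 * (X - Y) + D\<close> as \<open>2 * (X - Y - D) + 3 * D\<close>
    splits off a nonnegative part. What remains is a multiple of \<open>D\<close>, whose coefficient
    is nonnegative because \<open>2 * (p * b) \<le> 1 + (p * b)^2\<close>.\<close>
  have "0 \<le> (\<Sum>k<3. e k)"
  proof -
    have "p * b \<le> 3 + 3 / 2 * (p * b)^2"
    proof -
      have "2 * (p * b) \<le> 1 + (p * b)^2" "0 \<le> (p * b)^2"
        using sum_squares_bound[of 1 "p * b"] by auto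
      then show ?thesis by linarith
    qed
    also have "\<dots> \<le> 3 + 3 / 2 * (p * (p + 1) * b^2)"
      using p b by (simp add: power2_eq_square algebra_simps)
    finally have "p * b * D \<le> (3 + 3 / 2 * (p * (p + 1) * b^2)) * D"
      using D0 by (rule mult_right_mono)
    moreover have "0 \<le> (1 + p * (p + 1) * b^2 / 2) * (X - Y - D)"
      using DXY p by simp
    moreover have "e 0 + e 1 + e 2 = 4 * ((1 + p * (p + 1) * b^2 / 2) * (X - Y - D))
        + 2 * ((3 + 3 / 2 * (p * (p + 1) * b^2)) * D - p * b * D)"
      unfolding e0 e1 e2 by (simp add: field_simps)
    ultimately have "0 \<le> e 0 + e 1 + e 2" by simp
    then show ?thesis by (simp add: eval_nat_numeral)
  qed
  also have "(\<Sum>k<3. e k) \<le> suminf e"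
  proof (rule sum_le_suminf)
    show "summable e" using sums by (rule sums_summable)
    fix k :: nat assume "k \<in> - {..<3}"
    then have "2 * real k - 2 \<ge> 1" by auto
    then have "cosh ((2 * real k - 2) * t) / cosh t \<le> cosh ((2 * real k - 2) * s) / cosh s"
      using st by (intro cosh_quotient_mono)
    then have "d k * (2 * (cosh ((2 * real k - 2) * t) / cosh t)) \<le> d k * (2 * (cosh ((2 * real k - 2) * s) / cosh s))"
      using d0[of k] by (intro mult_left_mono) simp_all
    then show "0 \<le> e k" unfolding e_def by simp
  qed simp
  also have "suminf e = antipodal p b s - antipodal p b t" using sums by (simp add: sums_iff)
  finally show ?thesis by simp
qed

section \<open>Harmonic functions with explicit gradient and Hessian\<close>

text \<open>The witnesses of \<open>harmonic_on\<close> become parameters, because integration by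
  parts, dilation and Kelvin transform all speak about a specific gradient and Hessian.\<close>

definition harmonic_with ::
  "('a::euclidean_space \<Rightarrow> real) \<Rightarrow> ('a \<Rightarrow> 'a) \<Rightarrow> ('a \<Rightarrow> 'a \<Rightarrow> 'a) \<Rightarrow> 'a set \<Rightarrow> bool" where
  "harmonic_with u g H S \<longleftrightarrow>
     (\<forall>x\<in>S. (u has_derivative (\<lambda>h. g x \<bullet> h)) (at x)) \<and>
     (\<forall>x\<in>S. (g has_derivative H x) (at x)) \<and>
     (\<forall>i\<in>Basis. continuous_on S (\<lambda>x. H x i)) \<and>
     (\<forall>x\<in>S. (\<Sum>i\<in>Basis. H x i \<bullet> i) = 0)"

lemma harmonic_withD:
  assumes "harmonic_with u g H S"
  shows "x \<in> S \<Longrightarrow> (u has_derivative (\<lambda>h. g x \<bullet> h)) (at x)"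
    and "x \<in> S \<Longrightarrow> (g has_derivative H x) (at x)"
    and "i \<in> Basis \<Longrightarrow> continuous_on S (\<lambda>x. H x i)"
    and "x \<in> S \<Longrightarrow> (\<Sum>i\<in>Basis. H x i \<bullet> i) = 0"
  using assms unfolding harmonic_with_def by auto

lemma harmonic_with_continuous:
  assumes "harmonic_with u g H S"
  shows "continuous_on S u" "continuous_on S g"
  using harmonic_withD(1,2)[OF assms]
  by (meson has_derivative_continuous continuous_at_imp_continuous_on)+

lemma harmonic_with_subset:
  "harmonic_with u g H S \<Longrightarrow> T \<subseteq> S \<Longrightarrow> harmonic_with u g H T"
  unfolding harmonic_with_def by (meson continuous_on_subset subsetD)

lemma harmonic_with_continuous_cball:
  assumes "harmonic_with u g H U" "cball 0 1 \<subseteq> U"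
  shows "continuous_on (cball 0 1) u" "continuous_on (cball 0 1) g"
    and "i \<in> Basis \<Longrightarrow> continuous_on (cball 0 1) (\<lambda>y. H y i)"
  using harmonic_with_continuous[OF assms(1)] harmonic_withD(3)[OF assms(1)] assms(2) continuous_on_subset
  by blast+

lemma scaleR_cball: "y \<in> cball 0 1 \<Longrightarrow> s \<in> {0..1} \<Longrightarrow> s *\<^sub>R y \<in> cball (0::'a::real_normed_vector) 1"
  by (auto intro: mult_le_one)

lemma harmonic_with_const: "harmonic_with (\<lambda>_. M) (\<lambda>_. 0) (\<lambda>_ _. 0) S"
  by (simp add: harmonic_with_def)

lemma harmonic_with_scale:
  assumes h: "harmonic_with u g H U"
  shows "harmonic_with (\<lambda>y. u (s *\<^sub>R y)) (\<lambda>y. s *\<^sub>R g (s *\<^sub>R y)) (\<lambda>y k. s\<^sup>2 *\<^sub>R H (s *\<^sub>R y) k) {y. s *\<^sub>R y \<in> U}"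
  unfolding harmonic_with_def
proof (intro conjI ballI)
  fix x assume x: "x \<in> {y. s *\<^sub>R y \<in> U}"
  then have xU: "s *\<^sub>R x \<in> U" by simp
  have s: "((\<lambda>y. s *\<^sub>R y) has_derivative (\<lambda>y. s *\<^sub>R y)) (at x)" by (auto intro!: derivative_eq_intros)
  show "((\<lambda>y. u (s *\<^sub>R y)) has_derivative (\<lambda>k. s *\<^sub>R g (s *\<^sub>R x) \<bullet> k)) (at x)"
    using has_derivative_compose[OF s harmonic_withD(1)[OF h xU]] by simp
  have lin: "linear (H (s *\<^sub>R x))" using harmonic_withD(2)[OF h xU] by (rule has_derivative_linear)
  show "((\<lambda>y. s *\<^sub>R g (s *\<^sub>R y)) has_derivative (\<lambda>k. s\<^sup>2 *\<^sub>R H (s *\<^sub>R x) k)) (at x)"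
    using has_derivative_scaleR_right[OF has_derivative_compose[OF s harmonic_withD(2)[OF h xU]], of s]
    by (simp add: linear_scale[OF lin] power2_eq_square)
  have "(\<Sum>i\<in>Basis. s\<^sup>2 *\<^sub>R H (s *\<^sub>R x) i \<bullet> i) = s\<^sup>2 * (\<Sum>i\<in>Basis. H (s *\<^sub>R x) i \<bullet> i)"
    by (simp add: sum_distrib_left)
  then show "(\<Sum>i\<in>Basis. s\<^sup>2 *\<^sub>R H (s *\<^sub>R x) i \<bullet> i) = 0" using harmonic_withD(4)[OF h xU] by simp
next
  fix i :: 'a assume i: "i \<in> Basis"
  have "continuous_on {y. s *\<^sub>R y \<in> U} (\<lambda>x. H (s *\<^sub>R x) i)"
    by (rule continuous_on_compose2[OF harmonic_withD(3)[OF h i]]) (auto intro!: continuous_intros)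
  then show "continuous_on {y. s *\<^sub>R y \<in> U} (\<lambda>x. s\<^sup>2 *\<^sub>R H (s *\<^sub>R x) i)" by (intro continuous_intros)
qed

lemma harmonic_scale_ball:
  assumes h: "harmonic_with u g H U" and U: "open U" "cball 0 1 \<subseteq> (U :: 'a::euclidean_space set)"
    and s: "0 < s" "s \<le> 1"
  shows "harmonic_with (\<lambda>y. u (s *\<^sub>R y)) (\<lambda>y. s *\<^sub>R g (s *\<^sub>R y)) (\<lambda>y k. s\<^sup>2 *\<^sub>R H (s *\<^sub>R y) k) {y. s *\<^sub>R y \<in> U}"
    and "open {y. s *\<^sub>R y \<in> U}" and "cball 0 1 \<subseteq> {y. s *\<^sub>R y \<in> U}"
proof -
  have "s *\<^sub>R y \<in> cball 0 1" if "y \<in> cball 0 1" for y :: 'a using that s by (auto intro: mult_le_one)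
  then show "cball 0 1 \<subseteq> {y. s *\<^sub>R y \<in> U}" using U(2) by force
  show "open {y. s *\<^sub>R y \<in> U}"
    by (intro open_vimage[OF U(1), unfolded vimage_def]) (auto intro!: continuous_intros)
qed (rule harmonic_with_scale[OF h])

section \<open>Integration by parts on the unit ball\<close>

lemma ball_set_integrable:
  fixes f :: "'a::euclidean_space \<Rightarrow> real"
  assumes "continuous_on (cball 0 1) f"
  shows "set_integrable lborel (ball 0 1) f"
proof -
  have "set_integrable lborel (cball 0 1) f"
    unfolding set_integrable_def by (rule borel_integrable_compact[OF compact_cball assms])
  then show ?thesis by (rule set_integrable_subset) auto
qed

text \<open>The integral is translation invariant, so averaging over the translates by
  \<open>t *\<^sub>R e\<close> does not change it. Fubini then produces integrals along segments, to
  which the fundamental theorem of calculus applies.\<close>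

lemma integral_eq_segments:
  fixes k :: "'a::euclidean_space \<Rightarrow> real"
  assumes [measurable]: "k \<in> borel_measurable borel"
    and B: "\<And>y. \<bar>k y\<bar> \<le> B" and 0: "\<And>y. y \<notin> cball 0 1 \<Longrightarrow> k y = 0"
  shows "(\<integral>y. k y \<partial>lborel) = (\<integral>y. (\<integral>t. indicator {0..1} t *\<^sub>R k (y + t *\<^sub>R e) \<partial>lborel) \<partial>lborel)"
proof -
  have far: "k (y + t *\<^sub>R e) = 0" if "t \<ge> 0" "t \<le> 1" "norm y > 1 + norm e" for y t
  proof -
    have "norm (t *\<^sub>R e) \<le> norm e" using that by (simp add: mult_left_le_one_le)
    moreover have "norm y \<le> norm (y + t *\<^sub>R e) + norm (t *\<^sub>R e)"
      by (metis add_diff_cancel norm_triangle_ineq4)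
    ultimately have "norm (y + t *\<^sub>R e) > 1" using that by linarith
    then show ?thesis using 0[of "y + t *\<^sub>R e"] by simp
  qed
  have "integrable (lborel :: ('a \<times> real) measure) (\<lambda>(y,t). indicator {0..1} t *\<^sub>R k (y + t *\<^sub>R e))"
  proof (rule integrableI_bounded_set)
    show "cball 0 (1 + norm e) \<times> {0..1} \<in> sets (lborel :: ('a \<times> real) measure)"
      by (simp add: borel_closed closed_Times)
    show "emeasure lborel (cball (0::'a) (1 + norm e) \<times> {0..1::real}) < \<infinity>"
      by (intro emeasure_bounded_finite bounded_Times) auto
    show "AE x in lborel. x \<in> cball (0::'a) (1 + norm e) \<times> {0..1::real} \<longrightarrow>
        norm (case x of (y, t) \<Rightarrow> indicator {0..1} t *\<^sub>R k (y + t *\<^sub>R e)) \<le> B"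
      using B by (auto simp: indicator_def)
    show "AE x in lborel. x \<notin> cball (0::'a) (1 + norm e) \<times> {0..1::real} \<longrightarrow>
        (case x of (y, t) \<Rightarrow> indicator {0..1} t *\<^sub>R k (y + t *\<^sub>R e)) = 0"
      using far by (intro AE_I2) (auto simp: indicator_def not_le, meson far not_le)
  next
    have "(\<lambda>(y::'a, t::real). indicator {0..1} t *\<^sub>R k (y + t *\<^sub>R e)) \<in> borel_measurable (lborel \<Otimes>\<^sub>M lborel)"
      by measurable
    then show "(\<lambda>(y, t). indicator {0..1} t *\<^sub>R k (y + t *\<^sub>R e)) \<in> borel_measurable (lborel :: ('a \<times> real) measure)"
      unfolding lborel_prod .
  qed
  then have int: "integrable (lborel \<Otimes>\<^sub>M lborel) (\<lambda>(y::'a,t::real). indicator {0..1} t *\<^sub>R k (y + t *\<^sub>R e))"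
    by (simp add: lborel_prod)
  have tr: "(\<integral>y. k (y + t *\<^sub>R e) \<partial>lborel) = (\<integral>y. k y \<partial>lborel)" for t
    using integral_lborel_affine[of k 1 "t *\<^sub>R e"] by (simp add: add.commute)
  have "(\<integral>y. (\<integral>t. indicator {0..1} t *\<^sub>R k (y + t *\<^sub>R e) \<partial>lborel) \<partial>lborel)
     = (\<integral>t. (\<integral>y. indicator {0..1} t *\<^sub>R k (y + t *\<^sub>R e) \<partial>lborel) \<partial>lborel)"
    using lborel_pair.Fubini_integral[OF int] by simp
  also have "\<dots> = (\<integral>(t::real). indicator {0..1} t *\<^sub>R (\<integral>y. k y \<partial>lborel) \<partial>lborel)"
    by (simp add: tr)
  also have "\<dots> = (\<integral>y. k y \<partial>lborel)"
    by simp
  finally show ?thesis by simp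
qed

text \<open>The integrand is the derivative in direction \<open>e\<close> of
  \<open>(1 - y \<bullet> y) * f y\<close>. This product vanishes on the sphere, so its extension
  \<open>P\<close> by zero is continuous with compact support. Segment integrals of the derivative
  are \<open>P (y + e) - P y\<close>, and these integrate to 0.\<close>

lemma ball_integration_by_parts:
  fixes f :: "'a::euclidean_space \<Rightarrow> real"
  assumes U: "open U" "cball 0 1 \<subseteq> U" and e: "e \<noteq> 0"
    and der: "\<And>y. y \<in> U \<Longrightarrow> (f has_derivative f' y) (at y)"
    and cont: "continuous_on U (\<lambda>y. f' y e)"
  shows "(LINT y:ball 0 1|lborel. (1 - y \<bullet> y) * f' y e - 2 * (y \<bullet> e) * f y) = 0"
proof -
  let ?K = "\<lambda>y. (1 - y \<bullet> y) * f' y e - 2 * (y \<bullet> e) * f y"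
  let ?D = "\<lambda>z h. indicator (ball 0 1) z *\<^sub>R ((1 - z \<bullet> z) * f' z h - 2 * (z \<bullet> h) * f z)"
  define k where "k y = indicator (ball 0 1) y *\<^sub>R (?K y)" for y
  define P where "P y = (if y \<in> cball 0 1 then (1 - y \<bullet> y) * f y else 0)" for y
  have contf: "continuous_on U f"
    using der by (meson has_derivative_continuous continuous_at_imp_continuous_on)
  have contk: "continuous_on (cball 0 1) (\<lambda>y. ?K y)"
    using continuous_on_subset[OF cont U(2)] continuous_on_subset[OF contf U(2)]
    by (intro continuous_intros)
  have [measurable]: "k \<in> borel_measurable borel"
    unfolding k_def using continuous_on_subset[OF contk ball_subset_cball]
    by (intro borel_measurable_continuous_on_indicator) auto
  obtain B where B: "B > 0" "\<And>y. y \<in> cball 0 1 \<Longrightarrow> norm (?K y) \<le> B"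
    using compact_imp_bounded[OF compact_continuous_image[OF contk compact_cball]]
    unfolding bounded_pos by auto
  have kB: "\<bar>k y\<bar> \<le> B" for y
    using B by (auto simp: k_def indicator_def)
  have contP: "continuous_on UNIV P"
  proof -
    have "continuous_on (cball 0 1 \<union> - ball 0 1) (\<lambda>y. if y \<in> cball 0 1 then (1 - y \<bullet> y) * f y else 0)"
    proof (rule continuous_on_cases)
      show "continuous_on (cball 0 1) (\<lambda>y. (1 - y \<bullet> y) * f y)"
        using continuous_on_subset[OF contf U(2)] by (intro continuous_intros)
      show "\<forall>x. x \<in> cball 0 1 \<and> x \<notin> cball 0 1 \<or> x \<in> - ball 0 1 \<and> x \<in> cball 0 1 \<longrightarrow> (1 - x \<bullet> x) * f x = 0"
        by (auto simp: dot_square_norm)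
    qed (auto intro: closed_Compl)
    moreover have "cball 0 1 \<union> - ball 0 1 = (UNIV :: 'a set)" by auto
    ultimately show ?thesis by (simp add: P_def[abs_def])
  qed
  have seg: "(\<integral>t. indicator {0..1} t *\<^sub>R k (y + t *\<^sub>R e) \<partial>lborel) = P (y + e) - P y" for y
  proof -
    let ?S = "{t. norm (y + t *\<^sub>R e) = 1}"
    \<comment> \<open>\<open>P\<close> may fail to be differentiable on the sphere, but the segment
      crosses it at the roots of a nonzero quadratic, and the fundamental theorem tolerates finitely
      many exceptions.\<close>
    have fin: "finite ?S"
    proof (rule finite_subset)
      let ?p = "[: y \<bullet> y - 1, 2 * (y \<bullet> e), e \<bullet> e :]"
      show "?S \<subseteq> {t. poly ?p t = 0}"
      proof safe
        fix t assume "norm (y + t *\<^sub>R e) = 1"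
        then have "(y + t *\<^sub>R e) \<bullet> (y + t *\<^sub>R e) = 1" by (simp add: norm_eq_1)
        then show "poly ?p t = 0" by (simp add: inner_simps inner_commute algebra_simps)
      qed
      have "?p \<noteq> 0" using e by simp
      then show "finite {t. poly ?p t = 0}" by (rule poly_roots_finite)
    qed
    have "((\<lambda>t. k (y + t *\<^sub>R e)) has_integral P (y + 1 *\<^sub>R e) - P (y + 0 *\<^sub>R e)) {0..1}"
    proof (rule fundamental_theorem_of_calculus_interior_strong[where S="{t. norm (y + t *\<^sub>R e) = 1}"])
      show "continuous_on {0..1} (\<lambda>t. P (y + t *\<^sub>R e))"
        by (rule continuous_on_compose2[OF contP]) (auto intro!: continuous_intros)
    next
      show "finite {t. norm (y + t *\<^sub>R e) = 1}" by (rule fin)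
    next
      fix t assume t: "t \<in> {0<..<1} - ?S"
      have l: "((\<lambda>t. y + t *\<^sub>R e) has_derivative (\<lambda>h. h *\<^sub>R e)) (at t)"
        by (auto intro!: derivative_eq_intros)
      have "(P has_derivative (\<lambda>h. ?D (y + t *\<^sub>R e) h)) (at (y + t *\<^sub>R e))"
      proof (cases "norm (y + t *\<^sub>R e) < 1")
        case True
        define z where "z = y + t *\<^sub>R e"
        have z: "z \<in> ball 0 1" "z \<in> U" using True U(2) by (auto simp: z_def)
        have "((\<lambda>y. (1 - y \<bullet> y) * f y) has_derivative (\<lambda>h. (1 - z \<bullet> z) * f' z h - 2 * (z \<bullet> h) * f z)) (at z)"
          using der[OF z(2)] by (auto intro!: derivative_eq_intros simp: inner_commute algebra_simps)
        then have "(P has_derivative (\<lambda>h. (1 - z \<bullet> z) * f' z h - 2 * (z \<bullet> h) * f z)) (at z)"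
          by (rule has_derivative_transform_within_open[where s="ball 0 1"]) (use z in \<open>auto simp: P_def\<close>)
        then show ?thesis using z by (simp add: z_def)
      next
        case False
        define z where "z = y + t *\<^sub>R e"
        have z: "z \<in> - cball 0 1" using False t by (auto simp: z_def)
        have "((\<lambda>y. 0) has_derivative (\<lambda>h. 0)) (at z)" by simp
        then have "(P has_derivative (\<lambda>h. 0)) (at z)"
          by (rule has_derivative_transform_within_open[where s="- cball 0 1"]) (use z in \<open>auto simp: P_def\<close>)
        then show ?thesis using z by (simp add: z_def)
      qed
      from has_derivative_compose[OF l this]
      have "((\<lambda>t. P (y + t *\<^sub>R e)) has_derivative (\<lambda>h. ?D (y + t *\<^sub>R e) (h *\<^sub>R e))) (at t)" .
      moreover have "?D (y + t *\<^sub>R e) (h *\<^sub>R e) = h *\<^sub>R k (y + t *\<^sub>R e)" for h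
      proof (cases "y + t *\<^sub>R e \<in> ball 0 1")
        case True
        then have "y + t *\<^sub>R e \<in> U" using U(2) by auto
        then have "linear (f' (y + t *\<^sub>R e))" using der has_derivative_linear by blast
        from linear_scale[OF this] show ?thesis by (simp add: k_def algebra_simps)
      qed (simp add: k_def)
      ultimately show "((\<lambda>t. P (y + t *\<^sub>R e)) has_vector_derivative k (y + t *\<^sub>R e)) (at t)"
        unfolding has_vector_derivative_def by simp
    qed simp
    then have "((\<lambda>t. if t \<in> {0..1} then k (y + t *\<^sub>R e) else 0) has_integral P (y + e) - P y) UNIV"
      by (subst has_integral_restrict_UNIV) simp
    also have "(\<lambda>t. if t \<in> {0..1} then k (y + t *\<^sub>R e) else 0) = (\<lambda>t. indicator {0..1} t *\<^sub>R k (y + t *\<^sub>R e))"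
      by (auto simp: indicator_def)
    finally have "((\<lambda>t. indicator {0..1} t *\<^sub>R k (y + t *\<^sub>R e)) has_integral P (y + e) - P y) UNIV" .
    moreover have "integrable lborel (\<lambda>t. indicator {0..1::real} t *\<^sub>R k (y + t *\<^sub>R e))"
      by (rule integrableI_bounded_set_indicator[where B=B])
         (use kB in \<open>auto simp: emeasure_lborel_Icc_eq\<close>)
    ultimately show ?thesis using has_integral_integral_lborel has_integral_unique by blast
  qed
  have intP: "integrable lborel P"
  proof -
    have "integrable lborel (\<lambda>y. indicator (cball 0 1) y *\<^sub>R P y)"
      using contP by (intro borel_integrable_compact compact_cball continuous_on_subset[OF contP]) auto
    also have "(\<lambda>y. indicator (cball 0 1) y *\<^sub>R P y) = P" by (auto simp: P_def indicator_def)
    finally show ?thesis .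
  qed
  have Pm[measurable]: "P \<in> borel_measurable borel" using intP by simp
  have tr: "(\<integral>y. P (y + e) \<partial>lborel) = (\<integral>y. P y \<partial>lborel)"
    using integral_lborel_affine[of P 1 e] by (simp add: add.commute)
  have intP2: "integrable lborel (\<lambda>y. P (y + e))"
  proof -
    have "integrable (distr lborel borel ((+) e)) P" using intP by (simp add: lborel_distr_plus)
    then show ?thesis by (simp add: integrable_distr_eq add.commute)
  qed
  have "(\<integral>y. k y \<partial>lborel) = (\<integral>y. (\<integral>t. indicator {0..1} t *\<^sub>R k (y + t *\<^sub>R e) \<partial>lborel) \<partial>lborel)"
  proof (rule integral_eq_segments)
    show "k y = 0" if "y \<notin> cball 0 1" for y using that by (simp add: k_def)
    show "\<bar>k y\<bar> \<le> B" for y by (rule kB)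
  qed measurable
  also have "\<dots> = (\<integral>y. P (y + e) - P y \<partial>lborel)" unfolding seg ..
  also have "\<dots> = 0" using intP intP2 tr by simp
  finally show ?thesis unfolding k_def set_lebesgue_integral_def .
qed

section \<open>Mean values over balls\<close>

lemma ball_integral_sum:
  fixes f :: "'i \<Rightarrow> 'a::euclidean_space \<Rightarrow> real"
  assumes "\<And>i. i \<in> I \<Longrightarrow> continuous_on (cball 0 1) (f i)"
  shows "(LINT y:ball 0 1|lborel. (\<Sum>i\<in>I. f i y)) = (\<Sum>i\<in>I. (LINT y:ball 0 1|lborel. f i y))"
  using ball_set_integrable[OF assms]
  unfolding set_lebesgue_integral_def set_integrable_def scaleR_sum_right
  by (intro Bochner_Integration.integral_sum)

lemma ball_integral_swap:
  fixes F :: "'a::euclidean_space \<Rightarrow> real \<Rightarrow> real"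
  assumes "continuous_on (cball 0 1 \<times> {a..b}) (\<lambda>(y,s). F y s)"
  shows "(LINT y:ball 0 1|lborel. (LINT s:{a..b}|lborel. F y s))
       = (LINT s:{a..b}|lborel. (LINT y:ball 0 1|lborel. F y s))"
proof -
  have "integrable lborel (\<lambda>p. indicator (cball 0 1 \<times> {a..b}) p *\<^sub>R (\<lambda>(y,s). F y s) p)"
    by (rule borel_integrable_compact[OF compact_Times[OF compact_cball compact_Icc] assms])
  then have "set_integrable lborel (cball 0 1 \<times> {a..b}) (\<lambda>(y,s). F y s)"
    unfolding set_integrable_def .
  then have "set_integrable lborel (ball 0 1 \<times> {a..b}) (\<lambda>(y,s). F y s)"
  proof (rule set_integrable_subset)
    have "ball (0::'a) 1 \<times> {a..b} \<in> sets (lborel \<Otimes>\<^sub>M lborel)" by (intro pair_measureI) auto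
    then show "ball (0::'a) 1 \<times> {a..b} \<in> sets lborel" unfolding lborel_prod .
  qed auto
  then have "integrable lborel (\<lambda>(y,s). indicator (ball 0 1) y *\<^sub>R (indicator {a..b} s *\<^sub>R F y s))"
    unfolding set_integrable_def by (simp add: case_prod_unfold indicator_times mult.assoc)
  then have "integrable (lborel \<Otimes>\<^sub>M lborel) (\<lambda>(y,s). indicator (ball 0 1) y *\<^sub>R (indicator {a..b} s *\<^sub>R F y s))"
    by (simp only: lborel_prod)
  from lborel_pair.Fubini_integral[OF this]
  show ?thesis
    unfolding set_lebesgue_integral_def
    by (simp add: mult.left_commute flip: integral_mult_right_zero)
qed

lemma continuous_on_ball_integral:
  fixes F :: "'a::euclidean_space \<Rightarrow> real \<Rightarrow> real"
  assumes "continuous_on (cball 0 1 \<times> {a..b}) (\<lambda>(y,s). F y s)"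
  shows "continuous_on {a..b} (\<lambda>s. LINT y:ball 0 1|lborel. F y s)"
proof (rule continuous_on_sequentiallyI)
  fix u :: "nat \<Rightarrow> real" and s assume u: "\<forall>n. u n \<in> {a..b}" and s: "s \<in> {a..b}" and lim: "u \<longlonglongrightarrow> s"
  have c1: "continuous_on (cball 0 1) (\<lambda>y. F y t)" if "t \<in> {a..b}" for t
  proof -
    have "continuous_on (cball 0 1) (\<lambda>y. (\<lambda>(y,s). F y s) (y, t))"
      using that by (intro continuous_on_compose2[OF assms] continuous_intros) auto
    then show ?thesis by simp
  qed
  have c2: "continuous_on {a..b} (\<lambda>t. F y t)" if "y \<in> cball 0 1" for y
  proof -
    have "continuous_on {a..b} (\<lambda>t. (\<lambda>(y,s). F y s) (y, t))"
      using that by (intro continuous_on_compose2[OF assms] continuous_intros) auto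
    then show ?thesis by simp
  qed
  obtain B where B: "\<And>p. p \<in> cball 0 1 \<times> {a..b} \<Longrightarrow> norm ((\<lambda>(y,s). F y s) p) \<le> B"
    using compact_imp_bounded[OF compact_continuous_image[OF assms compact_Times[OF compact_cball compact_Icc]]]
    unfolding bounded_iff by auto
  show "(\<lambda>n. LINT y:ball 0 1|lborel. F y (u n)) \<longlonglongrightarrow> (LINT y:ball 0 1|lborel. F y s)"
    unfolding set_lebesgue_integral_def
  proof (rule integral_dominated_convergence[where w="\<lambda>y. indicator (ball 0 1) y *\<^sub>R B"])
    show "(\<lambda>y. indicator (ball 0 1) y *\<^sub>R F y s) \<in> borel_measurable lborel"
      using ball_set_integrable[OF c1[OF s]] unfolding set_integrable_def by simp
    show "(\<lambda>y. indicator (ball 0 1) y *\<^sub>R F y (u i)) \<in> borel_measurable lborel" for i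
      using ball_set_integrable[OF c1, of "u i"] u unfolding set_integrable_def by simp
    show "integrable lborel (\<lambda>y::'a. indicator (ball 0 1) y *\<^sub>R B)"
      using ball_set_integrable[of "\<lambda>_::'a. B"] unfolding set_integrable_def by simp
    show "AE x in lborel. (\<lambda>i. indicator (ball 0 1) x *\<^sub>R F x (u i)) \<longlonglongrightarrow> indicator (ball 0 1) x *\<^sub>R F x s"
    proof (rule AE_I2)
      fix x :: 'a
      show "(\<lambda>i. indicator (ball 0 1) x *\<^sub>R F x (u i)) \<longlonglongrightarrow> indicator (ball 0 1) x *\<^sub>R F x s"
      proof (cases "x \<in> ball 0 1")
        case True
        then have "x \<in> cball 0 1" by auto
        from continuous_on_tendsto_compose[OF c2[OF this] lim s] u True
        show ?thesis by simp
      qed simp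
    qed
    show "AE x in lborel. norm (indicator (ball 0 1) x *\<^sub>R F x (u i)) \<le> indicator (ball 0 1) x *\<^sub>R B" for i
      using B[of "(_, u i)"] u by (intro AE_I2) (auto simp: indicator_def)
  qed
qed

context
  fixes v :: "'a::euclidean_space \<Rightarrow> real" and g H U
  assumes h: "harmonic_with v g H U" and U: "open U" "cball 0 1 \<subseteq> U"
begin

text \<open>Integration by parts for each component of the gradient, summed: the cutoff multiplies
  the Laplacian, which is zero, and only its own derivative \<open>- 2 * y\<close> survives.\<close>

lemma harmonic_ball_flux: "(LINT y:ball 0 1|lborel. g y \<bullet> y) = 0"
proof -
  let ?F = "\<lambda>i y. (1 - y \<bullet> y) * (H y i \<bullet> i) - 2 * (y \<bullet> i) * (g y \<bullet> i)"
  have ibp: "(LINT y:ball 0 1|lborel. ?F i y) = 0"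
    if i: "i \<in> Basis" for i
    using harmonic_withD(2)[OF h] harmonic_withD(3)[OF h i] i
    by (intro ball_integration_by_parts[where f="\<lambda>y. g y \<bullet> i" and f'="\<lambda>y k. H y k \<bullet> i", OF U])
       (auto intro!: continuous_intros has_derivative_inner_left)
  have "0 = (\<Sum>i\<in>Basis. (LINT y:ball 0 1|lborel. ?F i y))"
    using ibp by simp
  also have "\<dots> = (LINT y:ball 0 1|lborel. (\<Sum>i\<in>Basis. ?F i y))"
    using harmonic_with_continuous_cball(2,3)[OF h U(2)] by (intro ball_integral_sum[symmetric] continuous_intros)
  also have "\<dots> = (LINT y:ball 0 1|lborel. -2 * (g y \<bullet> y))"
  proof (intro set_lebesgue_integral_cong allI impI)
    fix y :: 'a assume "y \<in> ball 0 1"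
    then have "y \<in> U" using U(2) by (meson ball_subset_cball subsetD)
    then have "(\<Sum>i\<in>Basis. H y i \<bullet> i) = 0" by (rule harmonic_withD(4)[OF h])
    moreover have "(\<Sum>i\<in>Basis. ?F i y)
      = (1 - y \<bullet> y) * (\<Sum>i\<in>Basis. H y i \<bullet> i) - 2 * (g y \<bullet> y)"
      by (simp add: sum_subtractf sum_distrib_left euclidean_inner[of "g y" y] mult_ac)
    ultimately show "(\<Sum>i\<in>Basis. ?F i y) = -2 * (g y \<bullet> y)" by simp
  qed simp
  also have "\<dots> = -2 * (LINT y:ball 0 1|lborel. g y \<bullet> y)" by (rule set_integral_mult_right)
  finally show ?thesis by simp
qed

text \<open>The same summation for the field \<open>(y \<bullet> e) *\<^sub>R g y\<close>, whose
  divergence is \<open>g y \<bullet> e\<close> because \<open>v\<close> is harmonic.\<close>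

lemma harmonic_ball_flux_moment:
  "(LINT y:ball 0 1|lborel. (1 - y \<bullet> y) * (g y \<bullet> e)) = 2 * (LINT y:ball 0 1|lborel. (g y \<bullet> y) * (y \<bullet> e))"
proof -
  let ?F = "\<lambda>i y. (1 - y \<bullet> y) * ((H y i \<bullet> i) * (y \<bullet> e) + (g y \<bullet> i) * (i \<bullet> e)) - 2 * (y \<bullet> i) * ((g y \<bullet> i) * (y \<bullet> e))"
  have ibp: "(LINT y:ball 0 1|lborel. ?F i y) = 0"
    if i: "i \<in> Basis" for i
  proof (rule ball_integration_by_parts[where f="\<lambda>y. (g y \<bullet> i) * (y \<bullet> e)" and f'="\<lambda>y k. (H y k \<bullet> i) * (y \<bullet> e) + (g y \<bullet> i) * (k \<bullet> e)", OF U])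
    show "continuous_on U (\<lambda>y. H y i \<bullet> i * (y \<bullet> e) + g y \<bullet> i * (i \<bullet> e))"
      using harmonic_withD(3)[OF h i] harmonic_with_continuous(2)[OF h] by (intro continuous_intros)
    show "((\<lambda>y. g y \<bullet> i * (y \<bullet> e)) has_derivative (\<lambda>k. H y k \<bullet> i * (y \<bullet> e) + g y \<bullet> i * (k \<bullet> e))) (at y)" if "y \<in> U" for y
      using harmonic_withD(2)[OF h that] by (auto intro!: derivative_eq_intros simp: algebra_simps)
  qed (use i in auto)
  have "0 = (\<Sum>i\<in>Basis. (LINT y:ball 0 1|lborel. ?F i y))"
    using ibp by simp
  also have "\<dots> = (LINT y:ball 0 1|lborel. (\<Sum>i\<in>Basis. ?F i y))"
    using harmonic_with_continuous_cball(2,3)[OF h U(2)] by (intro ball_integral_sum[symmetric] continuous_intros)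
  also have "\<dots> = (LINT y:ball 0 1|lborel. (1 - y \<bullet> y) * (g y \<bullet> e) - 2 * ((g y \<bullet> y) * (y \<bullet> e)))"
  proof (intro set_lebesgue_integral_cong allI impI)
    fix y :: 'a assume "y \<in> ball 0 1"
    then have "y \<in> U" using U(2) by (meson ball_subset_cball subsetD)
    then have "(\<Sum>i\<in>Basis. H y i \<bullet> i) = 0" by (rule harmonic_withD(4)[OF h])
    moreover have "(\<Sum>i\<in>Basis. ?F i y)
      = (1 - y \<bullet> y) * (y \<bullet> e) * (\<Sum>i\<in>Basis. H y i \<bullet> i) + (1 - y \<bullet> y) * (\<Sum>i\<in>Basis. (g y \<bullet> i) * (e \<bullet> i)) - 2 * (y \<bullet> e) * (\<Sum>i\<in>Basis. (g y \<bullet> i) * (y \<bullet> i))"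
      by (simp add: sum_subtractf sum.distrib sum_distrib_left algebra_simps inner_commute[of e])
    ultimately show "(\<Sum>i\<in>Basis. ?F i y) = (1 - y \<bullet> y) * (g y \<bullet> e) - 2 * ((g y \<bullet> y) * (y \<bullet> e))"
      by (simp add: euclidean_inner[symmetric] mult_ac inner_commute[of e "g y"] inner_commute[of y "g y"])
  qed simp
  also have "\<dots> = (LINT y:ball 0 1|lborel. (1 - y \<bullet> y) * (g y \<bullet> e)) - 2 * (LINT y:ball 0 1|lborel. (g y \<bullet> y) * (y \<bullet> e))"
    using harmonic_with_continuous_cball(1,2)[OF h U(2)] by (subst set_integral_diff(2)) (auto intro!: ball_set_integrable continuous_intros)
  finally show ?thesis by simp
qed

text \<open>A second evaluation of the integral in \<open>harmonic_ball_flux_moment\<close>, this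
  time by integrating \<open>v\<close> itself by parts. Comparing the two at all radii yields the
  mean value formula for the gradient.\<close>

lemma harmonic_ball_moment:
  "(LINT y:ball 0 1|lborel. (1 - y \<bullet> y) * (g y \<bullet> e)) = 2 * (LINT y:ball 0 1|lborel. (y \<bullet> e) * v y)"
proof (cases "e = 0")
  case False
  have "0 = (LINT y:ball 0 1|lborel. (1 - y \<bullet> y) * (g y \<bullet> e) - 2 * (y \<bullet> e) * v y)"
    using harmonic_withD(1)[OF h] harmonic_with_continuous(2)[OF h] False
    by (intro ball_integration_by_parts[where f=v and f'="\<lambda>y k. g y \<bullet> k", symmetric, OF U])
       (auto intro!: continuous_intros)
  also have "\<dots> = (LINT y:ball 0 1|lborel. (1 - y \<bullet> y) * (g y \<bullet> e)) - (LINT y:ball 0 1|lborel. 2 * ((y \<bullet> e) * v y))"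
    using harmonic_with_continuous_cball(1,2)[OF h U(2)] by (subst set_integral_diff(2)[symmetric]) (auto intro!: ball_set_integrable continuous_intros simp: mult.assoc)
  finally show ?thesis by simp
qed simp

end

context
  fixes v :: "'a::euclidean_space \<Rightarrow> real" and g H U
  assumes h: "harmonic_with v g H U" and U: "open U" "cball 0 1 \<subseteq> U"
begin

text \<open>\<open>v y - v 0\<close> is the integral of \<open>g (s *\<^sub>R y) \<bullet> y\<close>
  over s in [0, 1]. After exchanging integrals, the inner one is the flux of a dilated function,
  which vanishes for \<open>s > 0\<close>; the point \<open>s = 0\<close> is a null set.\<close>

lemma harmonic_mean_value_ball: "(LINT y:ball 0 1|lborel. v y) = measure lborel (ball 0 1 :: 'a set) * v 0"
proof -
  note cont = harmonic_with_continuous_cball(2,1)[OF h U(2)]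
  have cF: "continuous_on (cball 0 1 \<times> {0..1}) (\<lambda>(y,s). g (s *\<^sub>R y) \<bullet> y)"
    unfolding case_prod_unfold
    by (intro continuous_intros continuous_on_compose2[OF cont(1)]) (auto intro!: mult_le_one)
  have flux: "(LINT y:ball 0 1|lborel. g (s *\<^sub>R y) \<bullet> y) = 0" if s: "0 < s" "s \<le> 1" for s
  proof -
    have "(LINT y:ball 0 1|lborel. (s *\<^sub>R g (s *\<^sub>R y)) \<bullet> y) = 0"
      by (rule harmonic_ball_flux[OF harmonic_scale_ball[OF h U s]])
    then show ?thesis using s by simp
  qed
  have inner: "(LINT s:{0..1}|lborel. g (s *\<^sub>R y) \<bullet> y) = v y - v 0" if y: "y \<in> ball 0 1" for y
  proof -
    have yc: "y \<in> cball 0 1" using y by auto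
    have "(\<integral>s. indicator {0..1} s *\<^sub>R (g (s *\<^sub>R y) \<bullet> y) \<partial>lborel) = v (1 *\<^sub>R y) - v (0 *\<^sub>R y)"
    proof (rule integral_FTC_atLeastAtMost)
      fix s :: real assume s: "0 \<le> s" "s \<le> 1"
      then have "s *\<^sub>R y \<in> U" using scaleR_cball[OF yc] U(2) by auto
      from harmonic_withD(1)[OF h this]
      have "((\<lambda>s. v (s *\<^sub>R y)) has_derivative (\<lambda>k. g (s *\<^sub>R y) \<bullet> (k *\<^sub>R y))) (at s within {0..1})"
        by (rule has_derivative_compose[rotated]) (auto intro!: derivative_eq_intros)
      then show "((\<lambda>s. v (s *\<^sub>R y)) has_vector_derivative g (s *\<^sub>R y) \<bullet> y) (at s within {0..1})"
        by (simp add: has_vector_derivative_def)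
    next
      show "continuous_on {0..1} (\<lambda>s. g (s *\<^sub>R y) \<bullet> y)"
        by (intro continuous_intros continuous_on_compose2[OF cont(1)]) (use yc in \<open>auto intro!: mult_le_one\<close>)
    qed simp
    then show ?thesis by (simp add: set_lebesgue_integral_def)
  qed
  have "(LINT y:ball 0 1|lborel. v y) - measure lborel (ball 0 1 :: 'a set) * v 0
      = (LINT y:ball 0 1|lborel. v y - v 0)"
    using cont by (subst set_integral_diff(2))
      (auto intro!: ball_set_integrable continuous_intros simp: set_lebesgue_integral_def[of _ _ "\<lambda>_. v 0"])
  also have "\<dots> = (LINT y:ball 0 1|lborel. (LINT s:{0..1}|lborel. g (s *\<^sub>R y) \<bullet> y))"
    by (intro set_lebesgue_integral_cong allI impI) (simp_all add: inner)
  also have "\<dots> = (LINT s:{0..1}|lborel. (LINT y:ball 0 1|lborel. g (s *\<^sub>R y) \<bullet> y))"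
    by (rule ball_integral_swap[OF cF])
  also have "\<dots> = (\<integral>(s::real). (0::real) \<partial>lborel)"
    unfolding set_lebesgue_integral_def[of _ "{0..1}"]
  proof (rule integral_cong_AE)
    have "AE s in lborel. s \<noteq> (0::real)" by (rule AE_lborel_singleton)
    then show "AE s in lborel. indicator {0..1} s *\<^sub>R (LINT y:ball 0 1|lborel. g (s *\<^sub>R y) \<bullet> y) = 0"
      by eventually_elim (auto simp: indicator_def flux)
    show "(\<lambda>s. indicator {0..1} s *\<^sub>R (LINT y:ball 0 1|lborel. g (s *\<^sub>R y) \<bullet> y)) \<in> borel_measurable lborel"
      using borel_measurable_continuous_on_indicator[OF _ continuous_on_ball_integral[OF cF]] by simp
  qed simp
  finally show ?thesis by simp
qed

text \<open>\<open>K s\<close> is a weighted mean of the directional derivative over the ball of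
  radius s. By \<open>K1\<close>, \<open>s * K s\<close> is a moment of \<open>v\<close>; formally,
  its derivative is \<open>K s\<close> by \<open>K2\<close>. Hence \<open>K\<close> is constant, and
  \<open>K 0\<close> and \<open>K 1\<close> are the two sides of the claim.\<close>

lemma harmonic_gradient_mean_value_ball:
  "2 * (LINT y:ball 0 1|lborel. (y \<bullet> e) * v y) = (LINT y:ball (0::'a) 1|lborel. 1 - y \<bullet> y) * (g 0 \<bullet> e)"
proof -
  let ?G = "\<lambda>y t. (g (t *\<^sub>R y) \<bullet> y) * (y \<bullet> e)"
  note cont = harmonic_with_continuous_cball(2,1)[OF h U(2)]
  txt \<open>\<open>K3\<close> is the integrated form of \<open>s K'(s) = 0\<close>.\<close>
  define K where "K s = (LINT y:ball 0 1|lborel. (1 - y \<bullet> y) * (g (s *\<^sub>R y) \<bullet> e))" for s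
  have contK: "continuous_on {0..1} K" unfolding K_def
    by (rule continuous_on_ball_integral, unfold case_prod_unfold,
        intro continuous_intros continuous_on_compose2[OF cont(1)]) (auto intro!: mult_le_one)
  have K1: "s * K s = 2 * (LINT y:ball 0 1|lborel. (y \<bullet> e) * v (s *\<^sub>R y))" if s: "0 < s" "s \<le> 1" for s
    using harmonic_ball_moment[OF harmonic_scale_ball[OF h U s], of e]
    by (simp add: K_def mult.left_commute)
  have K2: "K s = 2 * (LINT y:ball 0 1|lborel. (g (s *\<^sub>R y) \<bullet> y) * (y \<bullet> e))" if s: "0 < s" "s \<le> 1" for s
    using harmonic_ball_flux_moment[OF harmonic_scale_ball[OF h U s], of e] s
    by (simp add: K_def mult.left_commute mult.assoc)
  have K3: "K 1 - s * K s = integral {s..1} K" if s: "0 < s" "s \<le> 1" for s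
  proof -
    have cF: "continuous_on (cball 0 1 \<times> {s..1}) (\<lambda>(y,t). ?G y t)"
      unfolding case_prod_unfold
      by (intro continuous_intros continuous_on_compose2[OF cont(1)]) (use s in \<open>auto intro!: mult_le_one\<close>)
    have inner: "(LINT t:{s..1}|lborel. ?G y t) = (y \<bullet> e) * v y - (y \<bullet> e) * v (s *\<^sub>R y)"
      if y: "y \<in> ball 0 1" for y
    proof -
      have yc: "y \<in> cball 0 1" using y by auto
      have "(\<integral>t. indicator {s..1} t *\<^sub>R (?G y t) \<partial>lborel) = v (1 *\<^sub>R y) * (y \<bullet> e) - v (s *\<^sub>R y) * (y \<bullet> e)"
      proof (rule integral_FTC_atLeastAtMost)
        fix t :: real assume t: "s \<le> t" "t \<le> 1"
        then have "t *\<^sub>R y \<in> U" using scaleR_cball[OF yc] U(2) s by auto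
        from harmonic_withD(1)[OF h this]
        have "((\<lambda>t. v (t *\<^sub>R y)) has_derivative (\<lambda>k. g (t *\<^sub>R y) \<bullet> (k *\<^sub>R y))) (at t within {s..1})"
          by (rule has_derivative_compose[rotated]) (auto intro!: derivative_eq_intros)
        from has_derivative_mult_left[OF this, of "y \<bullet> e"]
        show "((\<lambda>t. v (t *\<^sub>R y) * (y \<bullet> e)) has_vector_derivative ?G y t) (at t within {s..1})"
          by (simp add: has_vector_derivative_def mult.assoc)
      next
        show "continuous_on {s..1} (\<lambda>t. ?G y t)"
          by (intro continuous_intros continuous_on_compose2[OF cont(1)]) (use yc s in \<open>auto intro!: mult_le_one\<close>)
      qed (use s in simp)
      then show ?thesis
        unfolding set_lebesgue_integral_def by (simp only: scaleR_one mult.commute[of "y \<bullet> e"])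
    qed
    have cs: "continuous_on (cball 0 1) (\<lambda>y. v (s *\<^sub>R y))"
      by (intro continuous_intros continuous_on_compose2[OF cont(2)]) (use s in \<open>auto intro!: mult_le_one\<close>)
    have "K 1 - s * K s = 2 * (LINT y:ball 0 1|lborel. (y \<bullet> e) * v y - (y \<bullet> e) * v (s *\<^sub>R y))"
      using K1[of 1] K1[OF s] cont cs
      by (subst set_integral_diff(2)) (auto intro!: ball_set_integrable continuous_intros)
    also have "(LINT y:ball 0 1|lborel. (y \<bullet> e) * v y - (y \<bullet> e) * v (s *\<^sub>R y))
       = (LINT y:ball 0 1|lborel. (LINT t:{s..1}|lborel. ?G y t))"
      by (intro set_lebesgue_integral_cong allI impI) (simp, rule inner[symmetric])
    also have "\<dots> = (LINT t:{s..1}|lborel. (LINT y:ball 0 1|lborel. ?G y t))"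
      by (rule ball_integral_swap[OF cF])
    also have "2 * \<dots> = (LINT t:{s..1}|lborel. K t)"
      unfolding set_integral_mult_right[symmetric]
      by (intro set_lebesgue_integral_cong allI impI) (use s K2 in auto)
    also have "\<dots> = integral {s..1} K"
      using s by (intro set_borel_integral_eq_integral borel_integrable_atLeastAtMost' continuous_on_subset[OF contK]) auto
    finally show ?thesis .
  qed
  \<comment> \<open>\<open>K\<close> is only known to be continuous, so the argument differentiates
    its primitive \<open>J\<close>: the quotient \<open>(J t + s * K s) / t\<close> equals
    \<open>K t\<close> and has derivative zero.\<close>
  have const: "K s = K 1" if s: "0 < s" "s \<le> 1" for s
  proof -
    define J where "J t = integral {s..t} K" for t
    have contJK: "continuous_on {s..1} K" using s by (intro continuous_on_subset[OF contK]) auto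
    have J: "t * K t = J t + s * K s" if t: "t \<in> {s..1}" for t
    proof -
      have "integral {s..1} K = integral {s..t} K + integral {t..1} K"
        using t contJK by (intro Henstock_Kurzweil_Integration.integral_combine[symmetric] integrable_continuous_interval) auto
      then show ?thesis using K3[of t] K3[of s] s t by (simp add: J_def)
    qed
    have "((\<lambda>t. (J t + s * K s) / t) has_real_derivative 0) (at t within {s..1})" if t: "t \<in> {s..1}" for t
    proof -
      have "(J has_real_derivative K t) (at t within {s..1})"
        unfolding J_def using integral_has_real_derivative[OF contJK t] .
      then have "((\<lambda>t. (J t + s * K s) / t) has_real_derivative (K t * t - (J t + s * K s)) / (t * t)) (at t within {s..1})"
        using t s by (auto intro!: derivative_eq_intros)
      then show ?thesis using J[OF t] by (simp add: mult.commute)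
    qed
    then have "\<exists>c. \<forall>t\<in>{s..1}. (J t + s * K s) / t = c"
      by (intro has_field_derivative_zero_constant) auto
    then obtain c where c: "\<And>t. t \<in> {s..1} \<Longrightarrow> (J t + s * K s) / t = c" by blast
    have "K t = c" if "t \<in> {s..1}" for t
      using c[OF that] J[OF that] that s by (simp add: field_simps)
    then show ?thesis using s by simp
  qed
  \<comment> \<open>Dilation by 0 is excluded from \<open>K1\<close> and \<open>K2\<close>;
    continuity reaches the endpoint, where the gradient factor no longer depends on y.\<close>
  have "K 0 = K 1"
  proof -
    have "(\<lambda>n. inverse (real (Suc n))) \<longlonglongrightarrow> 0" by (rule LIMSEQ_inverse_real_of_nat)
    then have "(\<lambda>n. K (inverse (real (Suc n)))) \<longlonglongrightarrow> K 0"
      by (intro continuous_on_tendsto_compose[OF contK]) (auto simp: inverse_eq_divide)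
    moreover have "K (inverse (real (Suc n))) = K 1" for n
      by (rule const) (auto simp: inverse_eq_divide)
    ultimately show ?thesis by (simp add: LIMSEQ_const_iff)
  qed
  moreover have "K 0 = (LINT y:ball (0::'a) 1|lborel. 1 - y \<bullet> y) * (g 0 \<bullet> e)"
    by (simp add: K_def)
  ultimately show ?thesis using K1[of 1] by simp
qed

end

section \<open>Harmonic functions with polynomial zonal boundary values\<close>

lemma harmonic_with_add:
  assumes 1: "harmonic_with u g H S" and 2: "harmonic_with v k K S"
  shows "harmonic_with (\<lambda>x. u x + v x) (\<lambda>x. g x + k x) (\<lambda>x h. H x h + K x h) S"
  unfolding harmonic_with_def
proof (intro conjI ballI)
  fix x assume x: "x \<in> S"
  show "((\<lambda>x. u x + v x) has_derivative (\<lambda>h. (g x + k x) \<bullet> h)) (at x)"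
    using has_derivative_add[OF harmonic_withD(1)[OF 1 x] harmonic_withD(1)[OF 2 x]]
    by (simp add: inner_add_left)
  show "((\<lambda>x. g x + k x) has_derivative (\<lambda>h. H x h + K x h)) (at x)"
    by (rule has_derivative_add[OF harmonic_withD(2)[OF 1 x] harmonic_withD(2)[OF 2 x]])
  show "(\<Sum>i\<in>Basis. (H x i + K x i) \<bullet> i) = 0"
    using harmonic_withD(4)[OF 1 x] harmonic_withD(4)[OF 2 x] by (simp add: inner_add_left sum.distrib)
next
  fix i :: 'a assume "i \<in> Basis"
  then show "continuous_on S (\<lambda>x. H x i + K x i)"
    by (intro continuous_intros harmonic_withD(3)[OF 1] harmonic_withD(3)[OF 2])
qed

lemma harmonic_with_cmult:
  assumes "harmonic_with u g H S"
  shows "harmonic_with (\<lambda>x. c * u x) (\<lambda>x. c *\<^sub>R g x) (\<lambda>x h. c *\<^sub>R H x h) S"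
  unfolding harmonic_with_def
proof (intro conjI ballI)
  fix x assume x: "x \<in> S"
  show "((\<lambda>x. c * u x) has_derivative (\<lambda>h. (c *\<^sub>R g x) \<bullet> h)) (at x)"
    using has_derivative_mult_right[OF harmonic_withD(1)[OF assms x], of c] by simp
  show "((\<lambda>x. c *\<^sub>R g x) has_derivative (\<lambda>h. c *\<^sub>R H x h)) (at x)"
    by (rule has_derivative_scaleR_right[OF harmonic_withD(2)[OF assms x]])
  show "(\<Sum>i\<in>Basis. c *\<^sub>R H x i \<bullet> i) = 0"
    using harmonic_withD(4)[OF assms x] by (simp add: sum_distrib_left[symmetric])
next
  fix i :: 'a assume "i \<in> Basis"
  then show "continuous_on S (\<lambda>x. c *\<^sub>R H x i)"
    by (intro continuous_intros harmonic_withD(3)[OF assms])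
qed

definition zmon :: "'a::euclidean_space \<Rightarrow> nat \<Rightarrow> nat \<Rightarrow> 'a \<Rightarrow> real" where
  "zmon e j m y = (y \<bullet> y) ^ j * (y \<bullet> e) ^ m"

text \<open>Truncated subtraction is harmless here: where \<open>j - 1\<close> or
  \<open>m - 1\<close> is cut off at 0, the coefficient in front is 0.\<close>

definition zgrad :: "'a::euclidean_space \<Rightarrow> nat \<Rightarrow> nat \<Rightarrow> 'a \<Rightarrow> 'a" where
  "zgrad e j m y = (2 * real j * zmon e (j - 1) m y) *\<^sub>R y + (real m * zmon e j (m - 1) y) *\<^sub>R e"

definition zhess :: "'a::euclidean_space \<Rightarrow> nat \<Rightarrow> nat \<Rightarrow> 'a \<Rightarrow> 'a \<Rightarrow> 'a" where
  "zhess e j m y h = (2 * real j * (zgrad e (j - 1) m y \<bullet> h)) *\<^sub>R y + (2 * real j * zmon e (j - 1) m y) *\<^sub>R h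
     + (real m * (zgrad e j (m - 1) y \<bullet> h)) *\<^sub>R e"

lemma zmon_has_derivative:
  "(zmon e j m has_derivative (\<lambda>h. zgrad e j m y \<bullet> h)) (at y)"
  unfolding zmon_def[abs_def] zgrad_def zmon_def
  by (auto intro!: derivative_eq_intros simp: inner_commute algebra_simps)

lemma zgrad_has_derivative:
  "(zgrad e j m has_derivative zhess e j m y) (at y)"
proof -
  have "((\<lambda>y. (2 * real j * zmon e (j - 1) m y) *\<^sub>R y + (real m * zmon e j (m - 1) y) *\<^sub>R e)
      has_derivative zhess e j m y) (at y)"
    unfolding zhess_def[abs_def]
    by (auto intro!: derivative_eq_intros zmon_has_derivative simp: algebra_simps)
  then show ?thesis by (simp only: zgrad_def[abs_def])
qed

lemma continuous_on_zmon [continuous_intros]: "continuous_on S (zmon e j m)"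
  unfolding zmon_def[abs_def] by (intro continuous_intros)

lemma continuous_on_zgrad [continuous_intros]: "continuous_on S (zgrad e j m)"
  unfolding zgrad_def[abs_def] by (intro continuous_intros)

lemma continuous_on_zhess: "continuous_on S (\<lambda>y. zhess e j m y h)"
  unfolding zhess_def by (intro continuous_intros)

text \<open>The Laplacian sends the exponents (j, m) to (j - 1, m) and (j, m - 2). Along the family
  (j, k - 2 j) the second image of one member is the first image of the next, so a suitable
  combination can be harmonic. The coefficients come from Euler's identity and from \<open>e\<close>
  having norm 1.\<close>

lemma zhess_trace:
  fixes e :: "'a::euclidean_space"
  assumes e: "norm e = 1"
  shows "(\<Sum>i\<in>Basis. zhess e j m y i \<bullet> i)
       = 2 * real j * (2 * real (j - 1) + real DIM('a) + 2 * real m) * zmon e (j - 1) m y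
         + real m * real (m - 1) * zmon e j (m - 2) y"
proof -
  have ee: "e \<bullet> e = 1" using e by (simp add: norm_eq_1)
  have "(\<Sum>i\<in>Basis. zhess e j m y i \<bullet> i)
     = 2 * real j * (\<Sum>i\<in>Basis. (zgrad e (j - 1) m y \<bullet> i) * (y \<bullet> i))
       + 2 * real j * zmon e (j - 1) m y * (\<Sum>i\<in>(Basis::'a set). i \<bullet> i)
       + real m * (\<Sum>i\<in>Basis. (zgrad e j (m - 1) y \<bullet> i) * (e \<bullet> i))"
    unfolding zhess_def by (simp add: inner_add_left sum.distrib sum_distrib_left mult.assoc)
  also have "\<dots> = 2 * real j * (zgrad e (j - 1) m y \<bullet> y) + 2 * real j * zmon e (j - 1) m y * DIM('a)
       + real m * (zgrad e j (m - 1) y \<bullet> e)"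
    by (simp add: euclidean_inner[symmetric] inner_same_Basis)
  also have "zgrad e (j - 1) m y \<bullet> y = (2 * real (j - 1) + real m) * zmon e (j - 1) m y" if "j > 0"
  proof -
    have 1: "real (j - 1) * ((y \<bullet> y) ^ (j - 1 - 1) * (y \<bullet> y)) = real (j - 1) * (y \<bullet> y) ^ (j - 1)"
      by (cases "j - 1") auto
    have 2: "real m * ((y \<bullet> e) ^ (m - 1) * (y \<bullet> e)) = real m * (y \<bullet> e) ^ m"
      by (cases m) auto
    have 3: "zgrad e (j - 1) m y \<bullet> y
        = 2 * (real (j - 1) * ((y \<bullet> y) ^ (j - 1 - 1) * (y \<bullet> y))) * (y \<bullet> e) ^ m
          + (y \<bullet> y) ^ (j - 1) * (real m * ((y \<bullet> e) ^ (m - 1) * (y \<bullet> e)))"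
      unfolding zgrad_def zmon_def inner_add_left inner_scaleR_left inner_commute[of e y] by (simp add: mult_ac)
    show ?thesis unfolding 3 1 2 zmon_def by (simp only: ring_distribs mult_ac)
  qed
  then have "2 * real j * (zgrad e (j - 1) m y \<bullet> y) = 2 * real j * ((2 * real (j - 1) + real m) * zmon e (j - 1) m y)"
    by (cases "j = 0") auto
  also have "real m * (zgrad e j (m - 1) y \<bullet> e) = 2 * real j * real m * zmon e (j - 1) m y + real m * real (m - 1) * zmon e j (m - 2) y"
  proof -
    have 1: "real m * ((y \<bullet> e) ^ (m - 1) * (y \<bullet> e)) = real m * (y \<bullet> e) ^ m"
      by (cases m) auto
    have 2: "real m * (zgrad e j (m - 1) y \<bullet> e) = 2 * real j * (y \<bullet> y) ^ (j - 1) * (real m * ((y \<bullet> e) ^ (m - 1) * (y \<bullet> e)))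
       + real m * real (m - 1) * ((y \<bullet> y) ^ j * (y \<bullet> e) ^ (m - 2))"
      unfolding zgrad_def zmon_def inner_add_left inner_scaleR_left ee
      by (simp add: algebra_simps numeral_2_eq_2)
    show ?thesis unfolding 2 1 zmon_def by (simp only: mult_ac)
  qed
  finally show ?thesis by (simp add: algebra_simps)
qed

text \<open>A harmonic polynomial with leading term \<open>(y \<bullet> e) ^ k\<close> equals on the
  sphere that power plus multiples of \<open>(y \<bullet> e) ^ (k - 2 * j)\<close> with
  \<open>j \<ge> 1\<close>. The induction hypothesis supplies harmonic functions with exactly these
  lower boundary values, and subtracting them leaves the pure power.\<close>

lemma harmonic_zonal_power:
  fixes e :: "'a::euclidean_space"
  assumes e: "norm e = 1"
  shows "\<exists>u g H. harmonic_with u g H (UNIV :: 'a set) \<and> (\<forall>y. norm y = 1 \<longrightarrow> u y = (y \<bullet> e) ^ k)"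
proof (induction k rule: less_induct)
  case (less k)
  define n where "n = DIM('a)"
  txt \<open>The coefficients make the Laplacian of \<open>\<Sum>j. c j * \<bar>y\<bar>^(2 j) * (y \<bullet> e)^(k - 2 j)\<close> telescope.\<close>
  define d where "d j = real (k - 2 * j) * real (k - 2 * j - 1)
      / (2 * real (j + 1) * (2 * real j + real n + 2 * real (k - 2 * (j + 1))))" for j
  define c where "c j = (\<Prod>i<j. - d i)" for j
  define N where "N = k div 2"
  define u where "u y = (\<Sum>j\<le>N. c j * zmon e j (k - 2 * j) y)" for y
  define g where "g y = (\<Sum>j\<le>N. c j *\<^sub>R zgrad e j (k - 2 * j) y)" for y
  define H where "H y h = (\<Sum>j\<le>N. c j *\<^sub>R zhess e j (k - 2 * j) y h)" for y h
  have n: "n \<ge> 1" by (simp add: n_def Suc_leI)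
  have h: "harmonic_with u g H UNIV"
    unfolding harmonic_with_def
  proof (intro conjI ballI)
    fix y
    show "(u has_derivative (\<lambda>h. g y \<bullet> h)) (at y)"
      unfolding u_def[abs_def] g_def
      by (auto intro!: derivative_eq_intros zmon_has_derivative simp: inner_sum_left)
    show "(g has_derivative H y) (at y)"
      unfolding g_def[abs_def] H_def
      by (auto intro!: derivative_eq_intros zgrad_has_derivative)
    show "continuous_on UNIV (\<lambda>x. H x i)" for i
      unfolding H_def by (intro continuous_intros continuous_on_zhess)
    define A where "A j = c j * (2 * real j * (2 * real (j - 1) + real n + 2 * real (k - 2 * j)) * zmon e (j - 1) (k - 2 * j) y)" for j
    define B where "B j = c j * (real (k - 2 * j) * real (k - 2 * j - 1) * zmon e j (k - 2 * j - 2) y)" for j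
    have AB: "A (Suc j) = - B j" for j
    proof -
      have "2 * real (j + 1) * (2 * real j + real n + 2 * real (k - 2 * (j + 1))) \<noteq> 0" using n by simp
      then have "c (Suc j) * (2 * real (j + 1) * (2 * real j + real n + 2 * real (k - 2 * (j + 1))))
         = - c j * (real (k - 2 * j) * real (k - 2 * j - 1))"
        unfolding c_def d_def by simp
      moreover have "k - 2 * Suc j = k - 2 * j - 2" "k - 2 * (j + 1) = k - 2 * j - 2" "Suc j - 1 = j" by simp_all
      ultimately show ?thesis unfolding A_def B_def
        by (simp only: mult.assoc[symmetric] Suc_eq_plus1 mult_minus_left)
    qed
    have A0: "A 0 = 0" by (simp add: A_def)
    \<comment> \<open>The last exponent \<open>k - 2 * N\<close> is 0 or 1, so its second derivative
      vanishes and the telescoping sum closes.\<close>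
    have BN: "B N = 0"
    proof -
      have "k - 2 * N = 0 \<or> k - 2 * N - 1 = 0" by (auto simp: N_def)
      then show ?thesis by (auto simp: B_def)
    qed
    have "(\<Sum>i\<in>Basis. H y i \<bullet> i) = (\<Sum>j\<le>N. c j * (\<Sum>i\<in>Basis. zhess e j (k - 2 * j) y i \<bullet> i))"
      unfolding H_def inner_sum_left by (subst sum.swap) (simp add: sum_distrib_left)
    also have "\<dots> = (\<Sum>j\<le>N. A j + B j)"
      unfolding zhess_trace[OF e] A_def B_def n_def by (simp add: algebra_simps)
    also have "\<dots> = (\<Sum>j\<le>N. A j) + (\<Sum>j\<le>N. B j)" by (rule sum.distrib)
    also have "(\<Sum>j\<le>N. A j) = A 0 + (\<Sum>j<N. A (Suc j))" by (rule sum.atMost_shift)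
    also have "\<dots> = - (\<Sum>j<N. B j)" by (simp add: A0 AB sum_negf)
    also have "(\<Sum>j\<le>N. B j) = (\<Sum>j<N. B j)" using BN by (simp add: lessThan_Suc_atMost[symmetric])
    finally show "(\<Sum>i\<in>Basis. H y i \<bullet> i) = 0" by simp
  qed
  have us: "u y = (\<Sum>j\<le>N. c j * (y \<bullet> e) ^ (k - 2 * j))" if "norm y = 1" for y
    using that by (simp add: u_def zmon_def norm_eq_1)
  have "\<exists>w. \<forall>j\<in>{1..N}. \<exists>g H. harmonic_with (w j) g H UNIV \<and> (\<forall>y. norm y = 1 \<longrightarrow> w j y = (y \<bullet> e) ^ (k - 2 * j))"
  proof (rule bchoice, rule ballI)
    fix j assume "j \<in> {1..N}"
    then have "k - 2 * j < k" by (auto simp: N_def)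
    from less.IH[OF this]
    show "\<exists>w g H. harmonic_with w g H UNIV \<and> (\<forall>y. norm y = 1 \<longrightarrow> w y = (y \<bullet> e) ^ (k - 2 * j))" .
  qed
  then obtain w where w: "\<And>j. j \<in> {1..N} \<Longrightarrow> \<exists>g H. harmonic_with (w j) g H UNIV"
      "\<And>j y. j \<in> {1..N} \<Longrightarrow> norm y = 1 \<Longrightarrow> w j y = (y \<bullet> e) ^ (k - 2 * j)" by blast
  have "\<exists>g H. harmonic_with (\<lambda>y. u y + (\<Sum>j\<in>J. - c j * w j y)) g H UNIV" if "finite J" "J \<subseteq> {1..N}" for J
    using that
  proof (induction J rule: finite_induct)
    case empty
    then show ?case using h by auto
  next
    case (insert j J)
    then obtain g1 H1 g2 H2 where 1: "harmonic_with (\<lambda>y. u y + (\<Sum>j\<in>J. - c j * w j y)) g1 H1 UNIV"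
      and 2: "harmonic_with (w j) g2 H2 UNIV" using w(1)[of j] by auto
    have "(\<lambda>y. u y + (\<Sum>j\<in>insert j J. - c j * w j y)) = (\<lambda>y. (u y + (\<Sum>j\<in>J. - c j * w j y)) + (- c j) * w j y)"
      using insert by (simp add: algebra_simps)
    then show ?case using harmonic_with_add[OF 1 harmonic_with_cmult[OF 2, of "- c j"]] by auto
  qed
  from this[of "{1..N}"] obtain g' H' where
    h': "harmonic_with (\<lambda>y. u y + (\<Sum>j\<in>{1..N}. - c j * w j y)) g' H' UNIV" by auto
  moreover have "u y + (\<Sum>j\<in>{1..N}. - c j * w j y) = (y \<bullet> e) ^ k" if y: "norm y = 1" for y
  proof -
    have "u y = c 0 * (y \<bullet> e) ^ k + (\<Sum>j\<in>{1..N}. c j * (y \<bullet> e) ^ (k - 2 * j))"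
      unfolding us[OF y] by (simp add: atMost_atLeast0 sum.atLeast_Suc_atMost)
    moreover have "(\<Sum>j\<in>{1..N}. - c j * w j y) = - (\<Sum>j\<in>{1..N}. c j * (y \<bullet> e) ^ (k - 2 * j))"
      using w(2) y by (simp add: sum_negf)
    ultimately show ?thesis by (simp add: c_def)
  qed
  ultimately show ?case by blast
qed

lemma harmonic_zonal_polynomial:
  fixes e :: "'a::euclidean_space"
  assumes e: "norm e = 1"
  shows "\<exists>u g H. harmonic_with u g H (UNIV :: 'a set) \<and> (\<forall>y. norm y = 1 \<longrightarrow> u y = (\<Sum>i\<le>(N::nat). a i * (y \<bullet> e) ^ i))"
proof (induction N)
  case 0
  from harmonic_zonal_power[OF e, of 0] obtain u g H where
    "harmonic_with u g H (UNIV :: 'a set)" "\<And>y. norm y = 1 \<Longrightarrow> u y = (y \<bullet> e) ^ 0" by auto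
  then show ?case
    by (intro exI[of _ "\<lambda>x. a 0 * u x"] exI[of _ "\<lambda>x. a 0 *\<^sub>R g x"] exI[of _ "\<lambda>x h. a 0 *\<^sub>R H x h"])
       (simp add: harmonic_with_cmult)
next
  case (Suc N)
  then obtain u g H where 1: "harmonic_with u g H (UNIV :: 'a set)"
    "\<And>y. norm y = 1 \<Longrightarrow> u y = (\<Sum>i\<le>N. a i * (y \<bullet> e) ^ i)" by auto
  from harmonic_zonal_power[OF e, of "Suc N"] obtain v k K where
    2: "harmonic_with v k K (UNIV :: 'a set)" "\<And>y. norm y = 1 \<Longrightarrow> v y = (y \<bullet> e) ^ Suc N" by auto
  have "harmonic_with (\<lambda>x. u x + a (Suc N) * v x) (\<lambda>x. g x + a (Suc N) *\<^sub>R k x) (\<lambda>x h. H x h + a (Suc N) *\<^sub>R K x h) UNIV"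
    by (rule harmonic_with_add[OF 1(1) harmonic_with_cmult[OF 2(1)]])
  note A = this
  have B: "\<forall>y. norm y = 1 \<longrightarrow> u y + a (Suc N) * v y = (\<Sum>i\<le>Suc N. a i * (y \<bullet> e) ^ i)"
    using 1(2) 2(2) by simp
  show ?case by (intro exI conjI) (rule A, rule B)
qed

section \<open>The Kelvin transform\<close>

text \<open>Inversion in the sphere with centre \<open>c\<close> and squared radius
  \<open>R\<close>.\<close>

definition inversion :: "real \<Rightarrow> 'a::euclidean_space \<Rightarrow> 'a \<Rightarrow> 'a" where
  "inversion R c y = c + (R / ((y - c) \<bullet> (y - c))) *\<^sub>R (y - c)"

text \<open>A multiple of the reflection in the hyperplane orthogonal to \<open>y - c\<close>, so
  the inversion is conformal. At \<open>y = 0\<close>, with \<open>c\<close> parallel to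
  \<open>x\<close>, this reflection is the source of \<open>mirror e\<close>.\<close>

definition dinversion :: "real \<Rightarrow> 'a::euclidean_space \<Rightarrow> 'a \<Rightarrow> 'a \<Rightarrow> 'a" where
  "dinversion R c y h = (R / ((y - c) \<bullet> (y - c))) *\<^sub>R h
     - (2 * R * ((y - c) \<bullet> h) / ((y - c) \<bullet> (y - c))\<^sup>2) *\<^sub>R (y - c)"

lemma inversion_has_derivative:
  assumes "y \<noteq> c"
  shows "(inversion R c has_derivative dinversion R c y) (at y)"
proof -
  have nz: "(y - c) \<bullet> (y - c) \<noteq> 0" using assms by simp
  show ?thesis
    unfolding inversion_def[abs_def] dinversion_def[abs_def]
    by (auto intro!: derivative_eq_intros nz simp: assms)
       (simp add: fun_eq_iff inner_commute power2_eq_square algebra_simps diff_divide_distrib)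
qed

lemma rho_powr_has_derivative:
  fixes y c :: "'a::euclidean_space"
  assumes "y \<noteq> c"
  shows "((\<lambda>y. ((y - c) \<bullet> (y - c)) powr a) has_derivative
     (\<lambda>h. 2 * a * ((y - c) \<bullet> (y - c)) powr (a - 1) * ((y - c) \<bullet> h))) (at y)"
proof -
  have nz: "(y - c) \<bullet> (y - c) > 0" using assms by simp
  have 1: "((\<lambda>y. (y - c) \<bullet> (y - c)) has_derivative (\<lambda>h. 2 * ((y - c) \<bullet> h))) (at y)"
    by (auto intro!: derivative_eq_intros simp: inner_commute algebra_simps)
  have "((\<lambda>x. x powr a) has_real_derivative a * ((y - c) \<bullet> (y - c)) powr (a - 1)) (at ((y - c) \<bullet> (y - c)))"
    using nz by (rule has_real_derivative_powr)
  then have "((\<lambda>x. x powr a) has_derivative (\<lambda>h. a * ((y - c) \<bullet> (y - c)) powr (a - 1) * h)) (at ((y - c) \<bullet> (y - c)))"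
    by (simp add: has_field_derivative_def mult_commute_abs)
  from has_derivative_compose[OF 1 this] show ?thesis by (simp add: mult_ac)
qed

text \<open>The power is taken of the squared distance, so \<open>p\<close> corresponds to |y -
  c|^(- 2 p), which is |y - c|^(2 - n) for \<open>n = 2 * p + 2\<close>. The derivative formulas
  hold for every \<open>p\<close>; the dimension enters only with the trace.\<close>

definition kelvin :: "real \<Rightarrow> real \<Rightarrow> 'a::euclidean_space \<Rightarrow> ('a \<Rightarrow> real) \<Rightarrow> 'a \<Rightarrow> real" where
  "kelvin p R c u y = ((y - c) \<bullet> (y - c)) powr - p * u (inversion R c y)"

definition kelvin_grad :: "real \<Rightarrow> real \<Rightarrow> 'a::euclidean_space \<Rightarrow> ('a \<Rightarrow> real) \<Rightarrow> ('a \<Rightarrow> 'a) \<Rightarrow> 'a \<Rightarrow> 'a" where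
  "kelvin_grad p R c u g y = ((y - c) \<bullet> (y - c)) powr (- p - 1) *\<^sub>R
     (R *\<^sub>R g (inversion R c y)
      - (2 * (p * u (inversion R c y) + R * ((y - c) \<bullet> g (inversion R c y)) / ((y - c) \<bullet> (y - c)))) *\<^sub>R (y - c))"

definition kelvin_hess :: "real \<Rightarrow> real \<Rightarrow> 'a::euclidean_space \<Rightarrow> ('a \<Rightarrow> real) \<Rightarrow> ('a \<Rightarrow> 'a) \<Rightarrow> ('a \<Rightarrow> 'a \<Rightarrow> 'a) \<Rightarrow> 'a \<Rightarrow> 'a \<Rightarrow> 'a" where
  "kelvin_hess p R c u g H y h =
     (let d = y - c; r = d \<bullet> d; z = inversion R c y; w = dinversion R c y h; q = d \<bullet> g z in
      (2 * (- p - 1) * r powr (- p - 2) * (d \<bullet> h)) *\<^sub>R (R *\<^sub>R g z - (2 * (p * u z + R * q / r)) *\<^sub>R d)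
      + r powr (- p - 1) *\<^sub>R (R *\<^sub>R H z w
          - (2 * (p * (g z \<bullet> w) + R * (h \<bullet> g z + d \<bullet> H z w) / r - 2 * R * (d \<bullet> h) * q / r\<^sup>2)) *\<^sub>R d
          - (2 * (p * u z + R * q / r)) *\<^sub>R h))"

lemma kelvin_has_derivative:
  fixes c :: "'a::euclidean_space"
  assumes y: "y \<noteq> c"
    and u: "(u has_derivative (\<lambda>h. g (inversion R c y) \<bullet> h)) (at (inversion R c y))"
  shows "(kelvin p R c u has_derivative (\<lambda>h. kelvin_grad p R c u g y \<bullet> h)) (at y)"
proof -
  define d where "d = y - c"
  define r where "r = d \<bullet> d"
  have r: "r > 0" using y by (simp add: r_def d_def)
  have 1: "((\<lambda>y. u (inversion R c y)) has_derivative (\<lambda>h. g (inversion R c y) \<bullet> dinversion R c y h)) (at y)"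
    by (rule has_derivative_compose[OF inversion_has_derivative[OF y] u])
  have p1: "r powr - p = r powr (- p - 1) * r" using r by (simp add: powr_diff)
  have eq: "r powr - p * (g (inversion R c y) \<bullet> dinversion R c y h) + 2 * - p * r powr (- p - 1) * (d \<bullet> h) * u (inversion R c y)
     = kelvin_grad p R c u g y \<bullet> h" for h
    unfolding kelvin_grad_def dinversion_def d_def[symmetric] r_def[symmetric] p1 using r
    by (simp add: inner_diff_left inner_diff_right inner_commute power2_eq_square field_simps)
  show ?thesis
    unfolding kelvin_def[abs_def]
    using has_derivative_mult[OF rho_powr_has_derivative[OF y, of "- p"] 1] eq
    by (simp add: d_def r_def)
qed

lemma kelvin_grad_has_derivative:
  fixes c :: "'a::euclidean_space"
  assumes y: "y \<noteq> c"
    and u: "(u has_derivative (\<lambda>h. g (inversion R c y) \<bullet> h)) (at (inversion R c y))"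
    and g: "(g has_derivative H (inversion R c y)) (at (inversion R c y))"
  shows "(kelvin_grad p R c u g has_derivative kelvin_hess p R c u g H y) (at y)"
proof -
  let ?u = "\<lambda>y. u (inversion R c y)" and ?g = "\<lambda>y. g (inversion R c y)"
  let ?H = "\<lambda>h. H (inversion R c y) (dinversion R c y h)"
  have nz: "(y - c) \<bullet> (y - c) \<noteq> 0" using y by simp
  have 1: "((\<lambda>y. ?u y) has_derivative (\<lambda>h. ?g y \<bullet> dinversion R c y h)) (at y)"
    by (rule has_derivative_compose[OF inversion_has_derivative[OF y] u])
  have 2: "((\<lambda>y. ?g y) has_derivative (\<lambda>h. ?H h)) (at y)"
    by (rule has_derivative_compose[OF inversion_has_derivative[OF y] g])
  define Q where "Q = (\<lambda>y. ((y - c) \<bullet> ?g y) / ((y - c) \<bullet> (y - c)))"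
  define dQ where "dQ = (\<lambda>h. (h \<bullet> ?g y + (y - c) \<bullet> ?H h) / ((y - c) \<bullet> (y - c))
          - 2 * ((y - c) \<bullet> h) * ((y - c) \<bullet> ?g y) / ((y - c) \<bullet> (y - c))\<^sup>2)"
  have 3: "(Q has_derivative dQ) (at y)"
    unfolding Q_def dQ_def
    by (rule derivative_eq_intros 2 refl nz)+
       (use nz in \<open>simp add: fun_eq_iff inner_commute power2_eq_square field_simps\<close>)
  have 4: "((\<lambda>y. R *\<^sub>R ?g y
      - (2 * (p * ?u y + R * Q y)) *\<^sub>R (y - c)) has_derivative
     (\<lambda>h. R *\<^sub>R ?H h
       - ((2 * (p * (?g y \<bullet> dinversion R c y h) + R * dQ h)) *\<^sub>R (y - c)
        + (2 * (p * ?u y + R * Q y)) *\<^sub>R h))) (at y)"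
    by (auto intro!: derivative_eq_intros 1 2 3)
  have k: "kelvin_grad p R c u g = (\<lambda>y. ((y - c) \<bullet> (y - c)) powr (- p - 1) *\<^sub>R
     (R *\<^sub>R ?g y - (2 * (p * ?u y + R * Q y)) *\<^sub>R (y - c)))"
    by (simp add: kelvin_grad_def[abs_def] Q_def)
  have 5: "- p - 1 - 1 = - p - 2" by simp
  show ?thesis
    unfolding k
  proof (rule has_derivative_eq_rhs[OF has_derivative_scaleR[OF rho_powr_has_derivative[OF y, of "- p - 1"] 4]], rule ext)
    fix h
    define d where "d = y - c"
    define r where "r = d \<bullet> d"
    define z where "z = inversion R c y"
    define w where "w = dinversion R c y h"
    show "((y - c) \<bullet> (y - c)) powr (- p - 1) *\<^sub>R
        (R *\<^sub>R ?H h
         - ((2 * (p * (?g y \<bullet> dinversion R c y h) + R * dQ h)) *\<^sub>R (y - c)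
           + (2 * (p * ?u y + R * Q y)) *\<^sub>R h))
        + (2 * (- p - 1) * ((y - c) \<bullet> (y - c)) powr (- p - 1 - 1) * ((y - c) \<bullet> h)) *\<^sub>R
        (R *\<^sub>R ?g y - (2 * (p * ?u y + R * Q y)) *\<^sub>R (y - c))
      = kelvin_hess p R c u g H y h"
      unfolding kelvin_hess_def Let_def 5 Q_def dQ_def
        d_def[symmetric] r_def[symmetric] z_def[symmetric] w_def[symmetric]
      by (simp add: algebra_simps diff_divide_distrib add_divide_distrib)
  qed
qed

text \<open>Since the inversion is conformal, the trace of \<open>H\<close> along it leaves only the
  second derivative \<open>T\<close> in direction \<open>d\<close>. The \<open>T\<close> terms
  cancel, as do the \<open>q\<close> terms outside \<open>m\<close>; the coefficient of
  \<open>m\<close> is proportional to \<open>4 * (p + 1) - 2 * DIM('a)\<close>, which is zero for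
  this exponent.\<close>

lemma kelvin_hess_trace:
  fixes c :: "'a::euclidean_space"
  assumes y: "y \<noteq> c" and n: "real DIM('a) = 2 * p + 2"
    and lin: "linear (H (inversion R c y))" and tr: "(\<Sum>i\<in>Basis. H (inversion R c y) i \<bullet> i) = 0"
  shows "(\<Sum>i\<in>Basis. kelvin_hess p R c u g H y i \<bullet> i) = 0"
proof -
  define d where "d = y - c"
  define r where "r = d \<bullet> d"
  define z where "z = inversion R c y"
  define G where "G = g z"
  define q where "q = d \<bullet> G"
  define m where "m = p * u z + R * q / r"
  define T where "T = d \<bullet> H z d"
  have r: "r > 0" using y by (simp add: r_def d_def)
  define w where "w i = (R / r) *\<^sub>R i - (2 * R * (d \<bullet> i) / r\<^sup>2) *\<^sub>R d" for i
  have w: "dinversion R c y i = w i" for i by (simp add: dinversion_def w_def d_def r_def)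
  have linz: "linear (H z)" using lin by (simp add: z_def)
  have Hw: "H z (w i) = (R / r) *\<^sub>R H z i - (2 * R * (d \<bullet> i) / r\<^sup>2) *\<^sub>R H z d" for i
    by (simp add: w_def linear_diff[OF linz] linear_scale[OF linz])
  have sd: "(\<Sum>i\<in>Basis. (d \<bullet> i) * (a \<bullet> i)) = d \<bullet> a" for a by (simp add: euclidean_inner[symmetric])
  have S1: "(\<Sum>i\<in>Basis. H z (w i) \<bullet> i) = - (2 * R / r\<^sup>2) * T"
  proof -
    have "(\<Sum>i\<in>Basis. H z (w i) \<bullet> i) = (R / r) * (\<Sum>i\<in>Basis. H z i \<bullet> i) - (2 * R / r\<^sup>2) * (\<Sum>i\<in>Basis. (d \<bullet> i) * (H z d \<bullet> i))"
      by (simp add: Hw inner_diff_left sum_subtractf sum_distrib_left mult_ac)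
    then show ?thesis using tr by (simp add: sd T_def z_def)
  qed
  have wd: "(\<Sum>i\<in>Basis. (d \<bullet> i) * (a \<bullet> w i)) = - (R / r) * (a \<bullet> d)" for a
  proof -
    have "(\<Sum>i\<in>Basis. (d \<bullet> i) * (a \<bullet> w i)) = (R / r) * (\<Sum>i\<in>Basis. (d \<bullet> i) * (a \<bullet> i)) - (2 * R * (a \<bullet> d) / r\<^sup>2) * (\<Sum>i\<in>Basis. (d \<bullet> i) * (d \<bullet> i))"
      by (simp add: w_def inner_diff_right sum_subtractf sum_distrib_left sum_divide_distrib algebra_simps)
    also have "\<dots> = (R / r) * (a \<bullet> d) - (2 * R * (a \<bullet> d) / r\<^sup>2) * r"
      unfolding sd r_def by (simp add: inner_commute)
    also have "\<dots> = - (R / r) * (a \<bullet> d)" using r by (simp add: power2_eq_square field_simps)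
    finally show ?thesis .
  qed
  have wH: "(\<Sum>i\<in>Basis. (d \<bullet> i) * (d \<bullet> H z (w i))) = - (R / r) * T"
  proof -
    have "(\<Sum>i\<in>Basis. (d \<bullet> i) * (d \<bullet> H z (w i))) = (R / r) * (\<Sum>i\<in>Basis. (d \<bullet> i) * (d \<bullet> H z i)) - (2 * R * T / r\<^sup>2) * (\<Sum>i\<in>Basis. (d \<bullet> i) * (d \<bullet> i))"
      by (simp add: Hw T_def inner_diff_right sum_subtractf sum_distrib_left sum_divide_distrib algebra_simps)
    also have "(\<Sum>i\<in>Basis. (d \<bullet> i) * (d \<bullet> H z i)) = T"
    proof -
      have "H z d = H z (\<Sum>i\<in>Basis. (d \<bullet> i) *\<^sub>R i)" by (simp add: euclidean_representation)
      also have "\<dots> = (\<Sum>i\<in>Basis. (d \<bullet> i) *\<^sub>R H z i)" by (simp add: linear_sum[OF linz] linear_scale[OF linz])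
      finally show ?thesis by (simp add: T_def inner_sum_right)
    qed
    also have "(R / r) * T - (2 * R * T / r\<^sup>2) * (\<Sum>i\<in>Basis. (d \<bullet> i) * (d \<bullet> i)) = - (R / r) * T"
      unfolding sd r_def[symmetric] using r by (simp add: power2_eq_square field_simps)
    finally show ?thesis .
  qed
  have hs: "kelvin_hess p R c u g H y i \<bullet> i
     = 2 * (- p - 1) * r powr (- p - 2) * (R * ((d \<bullet> i) * (G \<bullet> i)) - 2 * m * ((d \<bullet> i) * (d \<bullet> i)))
       + r powr (- p - 1) * (R * (H z (w i) \<bullet> i)
          - 2 * p * ((d \<bullet> i) * (G \<bullet> w i)) - 2 * R / r * ((d \<bullet> i) * (G \<bullet> i)) - 2 * R / r * ((d \<bullet> i) * (d \<bullet> H z (w i)))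
          + 4 * R * q / r\<^sup>2 * ((d \<bullet> i) * (d \<bullet> i)) - 2 * m * (i \<bullet> i))" for i
    unfolding kelvin_hess_def Let_def w d_def[symmetric] r_def[symmetric] z_def[symmetric] G_def[symmetric] q_def[symmetric] m_def[symmetric]
    by (simp add: inner_add_left inner_diff_left inner_commute[of i G] add_divide_distrib algebra_simps)
  have "(\<Sum>i\<in>Basis. kelvin_hess p R c u g H y i \<bullet> i)
     = 2 * (- p - 1) * r powr (- p - 2) * (R * q - 2 * m * r)
       + r powr (- p - 1) * (R * (- (2 * R / r\<^sup>2) * T)
          - 2 * p * (- (R / r) * q) - 2 * R / r * q - 2 * R / r * (- (R / r) * T)
          + 4 * R * q / r\<^sup>2 * r - 2 * m * DIM('a))"
    unfolding hs sum.distrib sum_subtractf sum_distrib_left[symmetric] S1 wd wH sd r_def[symmetric] q_def[symmetric] inner_commute[of G d]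
    by (simp add: inner_same_Basis)
  also have "r powr (- p - 1) = r powr (- p - 2) * r"
    using r by (simp add: powr_diff power2_eq_square powr_numeral)
  also have "2 * (- p - 1) * r powr (- p - 2) * (R * q - 2 * m * r)
       + r powr (- p - 2) * r * (R * (- (2 * R / r\<^sup>2) * T)
          - 2 * p * (- (R / r) * q) - 2 * R / r * q - 2 * R / r * (- (R / r) * T)
          + 4 * R * q / r\<^sup>2 * r - 2 * m * DIM('a)) = 0"
    unfolding n using r by (simp add: field_simps power2_eq_square)
  finally show ?thesis .
qed

lemma harmonic_with_kelvin:
  fixes c :: "'a::euclidean_space"
  assumes h: "harmonic_with u g H U" and n: "real DIM('a) = 2 * p + 2"
  shows "harmonic_with (kelvin p R c u) (kelvin_grad p R c u g) (kelvin_hess p R c u g H) {y. y \<noteq> c \<and> inversion R c y \<in> U}"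
  unfolding harmonic_with_def
proof (intro conjI ballI)
  fix y assume "y \<in> {y. y \<noteq> c \<and> inversion R c y \<in> U}"
  then have y: "y \<noteq> c" "inversion R c y \<in> U" by auto
  note D = harmonic_withD(1,2,4)[OF h y(2)]
  show "(kelvin p R c u has_derivative (\<lambda>h. kelvin_grad p R c u g y \<bullet> h)) (at y)"
    by (rule kelvin_has_derivative[where u=u and g=g, OF y(1) D(1)])
  show "(kelvin_grad p R c u g has_derivative kelvin_hess p R c u g H y) (at y)"
    by (rule kelvin_grad_has_derivative[where u=u and g=g and H=H, OF y(1) D(1,2)])
  show "(\<Sum>i\<in>Basis. kelvin_hess p R c u g H y i \<bullet> i) = 0"
    using kelvin_hess_trace[where H=H, OF y(1) n has_derivative_linear[OF D(2)] D(3)] .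
next
  fix i :: 'a assume i: "i \<in> Basis"
  let ?S = "{y. y \<noteq> c \<and> inversion R c y \<in> U}"
  have ci: "continuous_on ?S (inversion R c)"
    unfolding inversion_def[abs_def] by (intro continuous_intros) auto
  have cw: "continuous_on ?S (\<lambda>y. dinversion R c y i)"
    unfolding dinversion_def by (intro continuous_intros) auto
  have cu: "continuous_on ?S (\<lambda>y. u (inversion R c y))" "continuous_on ?S (\<lambda>y. g (inversion R c y))"
    by (rule continuous_on_compose2[OF harmonic_with_continuous(1)[OF h] ci], force,
        rule continuous_on_compose2[OF harmonic_with_continuous(2)[OF h] ci], force)
  have cHj: "continuous_on ?S (\<lambda>y. H (inversion R c y) j)" if "j \<in> Basis" for j
    by (rule continuous_on_compose2[OF harmonic_withD(3)[OF h that] ci]) force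
  \<comment> \<open>Continuity of the Hessian is given on basis vectors only, whereas here its
    argument varies with y; linearity reduces it to them.\<close>
  have "continuous_on ?S (\<lambda>y. \<Sum>j\<in>Basis. (dinversion R c y i \<bullet> j) *\<^sub>R H (inversion R c y) j)"
    by (intro continuous_intros cw cHj)
  also have "?this \<longleftrightarrow> continuous_on ?S (\<lambda>y. H (inversion R c y) (dinversion R c y i))"
  proof (intro continuous_on_cong refl)
    fix y assume "y \<in> ?S"
    then have lin: "linear (H (inversion R c y))" using harmonic_withD(2)[OF h] has_derivative_linear by auto
    have "H (inversion R c y) (dinversion R c y i) = H (inversion R c y) (\<Sum>j\<in>Basis. (dinversion R c y i \<bullet> j) *\<^sub>R j)"
      by (simp add: euclidean_representation)
    then show "(\<Sum>j\<in>Basis. (dinversion R c y i \<bullet> j) *\<^sub>R H (inversion R c y) j) = H (inversion R c y) (dinversion R c y i)"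
      by (simp add: linear_sum[OF lin] linear_scale[OF lin])
  qed
  finally have cH: "continuous_on ?S (\<lambda>y. H (inversion R c y) (dinversion R c y i))" .
  show "continuous_on ?S (\<lambda>y. kelvin_hess p R c u g H y i)"
    unfolding kelvin_hess_def Let_def
    by (intro continuous_intros cw cu cH continuous_on_powr) auto
qed

section \<open>Integration over the unit sphere in polar coordinates about an interior point\<close>

text \<open>For a unit vector \<open>w\<close> the ray \<open>z + t w\<close> leaves the ball of radius \<open>R\<close> at \<open>t = hit z R w\<close>, and
  \<open>chord\<close> is half the length of the chord through \<open>z\<close> in direction \<open>w\<close>.\<close>

definition chord :: "'a::euclidean_space \<Rightarrow> real \<Rightarrow> 'a \<Rightarrow> real" where
  "chord z R w = sqrt ((z \<bullet> w)\<^sup>2 + R\<^sup>2 - z \<bullet> z)"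

definition hit :: "'a::euclidean_space \<Rightarrow> real \<Rightarrow> 'a \<Rightarrow> real" where
  "hit z R w = chord z R w - z \<bullet> w"

lemma chord_measurable [measurable]: "chord z R \<in> borel_measurable borel"
  unfolding chord_def by measurable

lemma hit_measurable [measurable]: "hit z R \<in> borel_measurable borel"
  unfolding hit_def by measurable

context
  fixes z w :: "'a::euclidean_space" and R :: real
  assumes z: "norm z < R" and w: "norm w = 1"
begin

lemma norm_sq_less: "z \<bullet> z < R\<^sup>2"
  using z by (simp add: dot_square_norm power_strict_mono)

lemma chord_sq: "(chord z R w)\<^sup>2 = (z \<bullet> w)\<^sup>2 + R\<^sup>2 - z \<bullet> z"
  using norm_sq_less zero_le_power2[of "z \<bullet> w"] unfolding chord_def by (intro real_sqrt_pow2) linarith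

lemma chord_ge: "sqrt (R\<^sup>2 - z \<bullet> z) \<le> chord z R w"
  unfolding chord_def by (intro real_sqrt_le_mono) simp

lemma chord_pos: "0 < chord z R w"
proof -
  have "0 < sqrt (R\<^sup>2 - z \<bullet> z)" using norm_sq_less by simp
  then show ?thesis using chord_ge by linarith
qed

lemma chord_gt_abs: "\<bar>z \<bullet> w\<bar> < chord z R w"
proof -
  have "\<bar>z \<bullet> w\<bar> = sqrt ((z \<bullet> w)\<^sup>2)" by simp
  also have "\<dots> < chord z R w" unfolding chord_def using norm_sq_less by (intro real_sqrt_less_mono) simp
  finally show ?thesis .
qed

lemma hit_pos: "0 < hit z R w"
  using chord_gt_abs by (simp add: hit_def)

lemma norm_line_sq: "(norm (z + t *\<^sub>R w))\<^sup>2 = (t + z \<bullet> w)\<^sup>2 + z \<bullet> z - (z \<bullet> w)\<^sup>2"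
proof -
  have "w \<bullet> w = 1" using w by (simp add: norm_eq_1)
  then show ?thesis
    unfolding power2_norm_eq_inner
    by (simp add: inner_add_left inner_add_right inner_commute power2_eq_square algebra_simps)
qed

lemma norm_hit: "norm (z + hit z R w *\<^sub>R w) = R"
proof -
  have "(norm (z + hit z R w *\<^sub>R w))\<^sup>2 = R\<^sup>2"
    unfolding norm_line_sq using chord_sq by (simp add: hit_def)
  moreover have "0 \<le> R" using z norm_ge_zero[of z] by linarith
  ultimately show ?thesis by (simp add: power2_eq_iff_nonneg)
qed

lemma hit_le: "hit z R w \<le> 2 * R"
proof -
  have "hit z R w = norm (hit z R w *\<^sub>R w)" using w hit_pos by simp
  also have "\<dots> \<le> norm (z + hit z R w *\<^sub>R w) + norm z"
    by (metis add_diff_cancel_left' norm_triangle_ineq4)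
  finally show ?thesis using norm_hit z by simp
qed

lemma norm_line_less_iff:
  assumes t: "t > 0"
  shows "norm (z + t *\<^sub>R w) < R \<longleftrightarrow> t < hit z R w"
proof -
  have R0: "0 \<le> R" using z norm_ge_zero[of z] by linarith
  have "norm (z + t *\<^sub>R w) < R \<longleftrightarrow> (norm (z + t *\<^sub>R w))\<^sup>2 < R\<^sup>2"
    using R0 by (simp add: power_strict_mono abs_le_square_iff[symmetric] linorder_not_le[symmetric])
  also have "\<dots> \<longleftrightarrow> (t + z \<bullet> w)\<^sup>2 < (chord z R w)\<^sup>2"
    unfolding norm_line_sq chord_sq by auto
  also have "\<dots> \<longleftrightarrow> \<bar>t + z \<bullet> w\<bar> < chord z R w"
    using chord_pos by (metis abs_le_square_iff abs_of_pos linorder_not_le)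
  also have "\<dots> \<longleftrightarrow> t < hit z R w"
    using t chord_gt_abs by (auto simp: hit_def abs_less_iff)
  finally show ?thesis .
qed

end

abbreviation (input) target :: "'a::euclidean_space \<Rightarrow> 'a \<Rightarrow> 'a" where
  "target z h \<equiv> z + hit z 1 (dir h) *\<^sub>R dir h"

abbreviation (input) jacobian :: "'a::euclidean_space \<Rightarrow> 'a \<Rightarrow> real" where
  "jacobian z h \<equiv> real DIM('a) * hit z 1 (dir h) ^ (DIM('a) - 1) / chord z 1 (dir h)"

text \<open>For unit \<open>w\<close>, \<open>chord z 1 w\<close> is the cosine of the angle between the ray and the outer normal at the
  point it hits, so this is the surface integral of \<open>F\<close>; for continuous \<open>F\<close> it does not depend on \<open>z\<close>.
  The origin is removed because \<open>dir 0 = 0\<close> is not a unit vector.\<close>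

definition sphere_integral :: "'a::euclidean_space \<Rightarrow> ('a \<Rightarrow> real) \<Rightarrow> real" where
  "sphere_integral z F = (LINT h:ball 0 1 - {0}|lborel. jacobian z h * F (target z h))"

text \<open>A ray from \<open>z\<close> runs through the shell between the radii \<open>R\<close>
  and 1 exactly while \<open>t\<close> lies between its two hitting times. The last bound is linear
  in \<open>1 - R\<close>: it will dominate the difference quotients in the limit
  \<open>R \<longrightarrow> 1\<close>.\<close>

lemma shell_integral_eq:
  fixes F :: "'a::euclidean_space \<Rightarrow> real" and z :: 'a
  assumes F: "continuous_on UNIV F" "\<And>y. 0 \<le> F y" "\<And>y. F y \<le> K" and z: "norm z < R" and R: "R < 1"
  defines "\<Phi> \<equiv> \<lambda>h. (\<integral>t. indicator {hit z R (dir h)..hit z 1 (dir h)} t *\<^sub>R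
     (real DIM('a) * t ^ (DIM('a) - 1) * F (z + t *\<^sub>R dir h)) \<partial>lborel)"
  shows "(LINT y:ball 0 1|lborel. F y) - (LINT y:ball 0 R|lborel. F y) = (LINT h:ball 0 1|lborel. \<Phi> h)"
    and "set_borel_measurable lborel (ball 0 1) \<Phi>"
    and "\<And>h. h \<noteq> 0 \<Longrightarrow> 0 \<le> \<Phi> h \<and> \<Phi> h \<le> (1 - R) * (2 / sqrt (1 - z \<bullet> z) * (real DIM('a) * 2 ^ (DIM('a) - 1) * K))"
proof -
  let ?n = "DIM('a)"
  let ?w = "\<lambda>h::'a. dir h"
  have z1: "norm z < 1" using z R by simp
  have [measurable]: "F \<in> borel_measurable borel" using F(1) by (rule borel_measurable_continuous_onI)
  have \<Phi>_meas [measurable]: "\<Phi> \<in> borel_measurable borel"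
    unfolding \<Phi>_def indicator_def atLeastAtMost_iff by measurable
  show "set_borel_measurable lborel (ball 0 1) \<Phi>"
    unfolding set_borel_measurable_def real_scaleR_def
    by (intro borel_measurable_times borel_measurable_indicator) (auto simp: \<Phi>_meas)
  define G where "G w t = real ?n * t ^ (?n - 1) * F (z + t *\<^sub>R w)" for w :: 'a and t
  have contG: "continuous_on A (G w)" for A and w :: 'a
    unfolding G_def by (intro continuous_intros continuous_on_compose2[OF F(1)]) auto
  have hits: "0 < hit z R w" "hit z R w \<le> hit z 1 w" "hit z 1 w \<le> 2"
    "hit z 1 w - hit z R w \<le> (1 - R) * (2 / sqrt (1 - z \<bullet> z))" if w: "norm w = 1" for w
  proof -
    show "0 < hit z R w" by (rule hit_pos[OF z w])
    show "hit z 1 w \<le> 2" using hit_le[OF z1 w] by simp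
    have R0: "0 \<le> R" using z norm_ge_zero[of z] by linarith
    have R2: "R\<^sup>2 \<le> 1" using R R0 by (simp add: power_le_one)
    show "hit z R w \<le> hit z 1 w"
      unfolding hit_def chord_def using R2 by simp
    \<comment> \<open>Rationalising the difference of two square roots brings out the factor
      \<open>1 - R\<close>; \<open>chord_ge\<close> keeps the remaining denominator away from 0,
      uniformly in \<open>w\<close>.\<close>
    have "(chord z 1 w - chord z R w) * (chord z 1 w + chord z R w) = 1 - R\<^sup>2"
      using chord_sq[OF z w] chord_sq[OF z1 w] by (simp add: power2_eq_square algebra_simps)
    also have "\<dots> = (1 - R) * (1 + R)" by (simp add: power2_eq_square algebra_simps)
    finally have e: "chord z 1 w - chord z R w = (1 - R) * ((1 + R) / (chord z 1 w + chord z R w))"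
      using chord_pos[OF z w] chord_pos[OF z1 w] by (simp add: field_simps)
    have sq: "0 < sqrt (1 - z \<bullet> z)" using norm_sq_less[OF z1 w] by simp
    have "(1 + R) / (chord z 1 w + chord z R w) \<le> 2 / sqrt (1 - z \<bullet> z)"
      using chord_ge[OF z1 w] chord_pos[OF z w] R R0 sq by (intro frac_le) auto
    then have "(1 - R) * ((1 + R) / (chord z 1 w + chord z R w)) \<le> (1 - R) * (2 / sqrt (1 - z \<bullet> z))"
      using R by (intro mult_left_mono) auto
    then show "hit z 1 w - hit z R w \<le> (1 - R) * (2 / sqrt (1 - z \<bullet> z))"
      unfolding e[symmetric] by (simp add: hit_def)
  qed
  have K: "0 \<le> K" using F(2,3) order_trans by blast
  have \<Phi>_G: "\<Phi> h = (\<integral>t. indicator {hit z R (?w h)..hit z 1 (?w h)} t *\<^sub>R G (?w h) t \<partial>lborel)" for h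
    unfolding \<Phi>_def G_def ..
  have intG: "integrable lborel (\<lambda>t. indicator {a..b} t *\<^sub>R G w t)" for a b and w :: 'a
    by (intro borel_integrable_compact compact_Icc contG)
  show bnd: "0 \<le> \<Phi> h \<and> \<Phi> h \<le> (1 - R) * (2 / sqrt (1 - z \<bullet> z) * (real ?n * 2 ^ (?n - 1) * K))" if h: "h \<noteq> 0" for h
  proof -
    have w: "norm (?w h) = 1" using h by simp
    note hw = hits[OF w]
    have Gb: "0 \<le> G (?w h) t \<and> G (?w h) t \<le> real ?n * 2 ^ (?n - 1) * K" if "t \<in> {hit z R (?w h)..hit z 1 (?w h)}" for t
      unfolding G_def using that hw F(2,3) by (auto intro!: mult_mono power_mono mult_nonneg_nonneg)
    have m1: "0 \<le> \<Phi> h" unfolding \<Phi>_G using Gb by (intro Bochner_Integration.integral_nonneg) (auto simp: indicator_def)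
    have m2: "\<Phi> h \<le> (\<integral>t. indicator {hit z R (?w h)..hit z 1 (?w h)} t *\<^sub>R (real ?n * 2 ^ (?n - 1) * K) \<partial>lborel)"
      unfolding \<Phi>_G using Gb
      by (intro integral_mono intG borel_integrable_compact) (auto simp: indicator_def)
    have m3: "(\<integral>t. indicator {hit z R (?w h)..hit z 1 (?w h)} t *\<^sub>R (real ?n * 2 ^ (?n - 1) * K) \<partial>lborel)
       = (hit z 1 (?w h) - hit z R (?w h)) * (real ?n * 2 ^ (?n - 1) * K)"
      using hw by simp
    have m4: "(hit z 1 (?w h) - hit z R (?w h)) * (real ?n * 2 ^ (?n - 1) * K)
       \<le> ((1 - R) * (2 / sqrt (1 - z \<bullet> z))) * (real ?n * 2 ^ (?n - 1) * K)"
      using hw K by (intro mult_right_mono) auto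
    show ?thesis using m1 order_trans[OF m2[unfolded m3] m4] by (simp only: mult.assoc simp_thms)
  qed
  define S where "S = ball 0 1 - ball (0::'a) R"
  have [measurable]: "S \<in> sets borel" unfolding S_def by measurable
  have iF: "set_integrable lborel (ball 0 1) F"
    by (rule ball_set_integrable) (rule continuous_on_subset[OF F(1)], simp)
  have sub: "ball (0::'a) R \<subseteq> ball 0 1" using R by (simp add: subset_ball)
  have iFR: "set_integrable lborel (ball 0 R) F" by (rule set_integrable_subset[OF iF _ sub]) simp
  have iFS: "set_integrable lborel S F" by (rule set_integrable_subset[OF iF]) (auto simp: S_def)
  let ?g = "\<lambda>(w::'a) (t::real). ennreal (?n * t ^ (?n - 1)) * indicator {0<..} t * ennreal (indicator S (z + t *\<^sub>R w) * F (z + t *\<^sub>R w))"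
  have "(LINT y:ball 0 1|lborel. F y) - (LINT y:ball 0 R|lborel. F y) = (LINT y:S|lborel. F y)"
  proof -
    have "ball 0 1 = S \<union> ball 0 R" using sub by (auto simp: S_def)
    then have "(LINT y:ball 0 1|lborel. F y) = (LINT y:S|lborel. F y) + (LINT y:ball 0 R|lborel. F y)"
      using set_integral_Un[OF _ iFS iFR] by (auto simp: S_def)
    then show ?thesis by simp
  qed
  moreover have "ennreal (LINT y:S|lborel. F y) = ennreal (LINT h:ball 0 1|lborel. \<Phi> h)"
  proof -
    have "ennreal (LINT y:S|lborel. F y) = (\<integral>\<^sup>+y. ennreal (indicator S y * F y) \<partial>lborel)"
      using iFS F(2) unfolding set_lebesgue_integral_def set_integrable_def
      by (subst nn_integral_eq_integral) auto
    also have "\<dots> = (\<integral>\<^sup>+y. ennreal (indicator S (z + y) * F (z + y)) \<partial>lborel)"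
      by (rule nn_integral_lborel_translate[symmetric]) measurable
    also have "\<dots> = (\<integral>\<^sup>+h. indicator (ball 0 1) h * (\<integral>\<^sup>+t. ?g (?w h) t \<partial>lborel) \<partial>lborel)"
      by (rule nn_integral_polar) measurable
    also have "\<dots> = (\<integral>\<^sup>+h. ennreal (indicator (ball 0 1) h * \<Phi> h) \<partial>lborel)"
    proof (rule nn_integral_cong_AE)
      have "AE h in lborel. h \<noteq> (0::'a)" by (rule AE_lborel_singleton)
      then show "AE h in lborel. indicator (ball 0 1) h * (\<integral>\<^sup>+t. ?g (?w h) t \<partial>lborel)
          = ennreal (indicator (ball 0 1) h * \<Phi> h)"
      proof eventually_elim
        case (elim h)
        define w where "w = ?w h"
        have w: "norm w = 1" using elim by (simp add: w_def)
        note hw = hits[OF w]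
        have "(\<integral>\<^sup>+t. ?g w t \<partial>lborel)
           = (\<integral>\<^sup>+t. ennreal (indicator {hit z R w..hit z 1 w} t *\<^sub>R G w t) \<partial>lborel)"
        proof (rule nn_integral_cong_AE)
          \<comment> \<open>The shell omits the unit sphere while the interval is closed, so the two
            differ at this single \<open>t\<close>.\<close>
          have "AE t in lborel. t \<noteq> hit z 1 w" by (rule AE_lborel_singleton)
          then show "AE t in lborel. ?g w t
             = ennreal (indicator {hit z R w..hit z 1 w} t *\<^sub>R G w t)"
          proof eventually_elim
            case (elim t)
            show ?case
            proof (cases "t > 0")
              case True
              have "z + t *\<^sub>R w \<in> S \<longleftrightarrow> t \<in> {hit z R w..hit z 1 w}"
                using norm_line_less_iff[OF z w True] norm_line_less_iff[OF z1 w True] elim by (auto simp: S_def)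
              then show ?thesis using True F(2)
                by (auto simp: indicator_def G_def ennreal_mult[symmetric] mult.assoc)
            qed (use hw in auto)
          qed
        qed
        also have "\<dots> = ennreal (\<integral>t. indicator {hit z R w..hit z 1 w} t *\<^sub>R G w t \<partial>lborel)"
        proof (rule nn_integral_eq_integral[OF intG])
          show "AE t in lborel. 0 \<le> indicator {hit z R w..hit z 1 w} t *\<^sub>R G w t"
            using hw F(2) by (auto simp: indicator_def G_def)
        qed
        also have "\<dots> = ennreal (\<Phi> h)" by (simp add: \<Phi>_G w_def)
        finally show ?case by (simp add: w_def indicator_def)
      qed
    qed
    also have "\<dots> = ennreal (LINT h:ball 0 1|lborel. \<Phi> h)"
      unfolding set_lebesgue_integral_def real_scaleR_def
    proof (rule nn_integral_eq_integral)
      have nz: "AE h in lborel. h \<noteq> (0::'a)" by (rule AE_lborel_singleton)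
      define C where "C = (1 - R) * (2 / sqrt (1 - z \<bullet> z) * (real ?n * 2 ^ (?n - 1) * K))"
      show "integrable lborel (\<lambda>h. indicator (ball 0 1) h * \<Phi> h)"
      proof (rule integrableI_bounded_set[where A="ball 0 1" and B=C])
        show "emeasure lborel (ball (0::'a) 1) < \<infinity>" by (intro emeasure_bounded_finite bounded_ball)
        show "AE h in lborel. h \<in> ball 0 1 \<longrightarrow> norm (indicator (ball 0 1) h * \<Phi> h) \<le> C"
          using nz by eventually_elim (use bnd in \<open>auto simp: C_def\<close>)
        show "(\<lambda>h. indicator (ball 0 1) h * \<Phi> h) \<in> borel_measurable lborel"
          by (intro borel_measurable_times borel_measurable_indicator) (auto simp: \<Phi>_meas)
      qed auto
      show "AE h in lborel. 0 \<le> indicator (ball 0 1) h * \<Phi> h"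
        using nz by eventually_elim (use bnd in auto)
    qed
    finally show ?thesis .
  qed
  moreover have "0 \<le> (LINT y:S|lborel. F y)"
    using F(2) by (auto simp: set_lebesgue_integral_def intro!: Bochner_Integration.integral_nonneg)
  moreover have "0 \<le> (LINT h:ball 0 1|lborel. \<Phi> h)"
    unfolding set_lebesgue_integral_def real_scaleR_def
  proof (rule integral_nonneg_AE)
    have "AE h in lborel. h \<noteq> (0::'a)" by (rule AE_lborel_singleton)
    then show "AE h in lborel. 0 \<le> indicator (ball 0 1) h * \<Phi> h"
      by eventually_elim (use bnd in auto)
  qed
  ultimately show "(LINT y:ball 0 1|lborel. F y) - (LINT y:ball 0 R|lborel. F y) = (LINT h:ball 0 1|lborel. \<Phi> h)"
    by simp
qed

lemma sphere_integrable:
  fixes F :: "'a::euclidean_space \<Rightarrow> real" and z :: 'a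
  assumes [measurable]: "F \<in> borel_measurable borel" and F: "\<And>y. norm y = 1 \<Longrightarrow> \<bar>F y\<bar> \<le> K" and z: "norm z < 1"
  shows "set_integrable lborel (ball 0 1 - {0}) (\<lambda>h. jacobian z h * F (target z h))"
  unfolding set_integrable_def
proof (rule integrableI_bounded_set[where A="ball 0 1 - {0}" and B="real DIM('a) * 2 ^ (DIM('a) - 1) / sqrt (1 - z \<bullet> z) * K"])
  have [measurable]: "ball (0::'a) 1 - {0} \<in> sets borel" by auto
  show "emeasure lborel (ball (0::'a) 1 - {0}) < \<infinity>" by (intro emeasure_bounded_finite bounded_diff bounded_ball)
  show "(\<lambda>h. indicator (ball 0 1 - {0}) h *\<^sub>R (jacobian z h * F (target z h))) \<in> borel_measurable lborel"
    by measurable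
  have "AE h in lborel. h \<noteq> (0::'a)" by (rule AE_lborel_singleton)
  then show "AE h in lborel. h \<in> ball 0 1 - {0} \<longrightarrow> norm (indicator (ball 0 1 - {0}) h *\<^sub>R (jacobian z h * F (target z h))) \<le> real DIM('a) * 2 ^ (DIM('a) - 1) / sqrt (1 - z \<bullet> z) * K"
  proof eventually_elim
    case (elim h)
    define w where "w = dir h"
    have w: "norm w = 1" using elim by (simp add: w_def)
    have sq: "0 < sqrt (1 - z \<bullet> z)" using norm_sq_less[OF z w] by simp
    have "sqrt (1 - z \<bullet> z) \<le> chord z 1 w" using chord_ge[OF z w] by simp
    moreover have "\<bar>F (z + hit z 1 w *\<^sub>R w)\<bar> \<le> K" using F norm_hit[OF z w] by simp
    moreover have "0 < hit z 1 w" "hit z 1 w \<le> 2" using hit_pos[OF z w] hit_le[OF z w] by simp_all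
    ultimately have "\<bar>real DIM('a) * hit z 1 w ^ (DIM('a) - 1) / chord z 1 w\<bar> * \<bar>F (z + hit z 1 w *\<^sub>R w)\<bar>
        \<le> real DIM('a) * 2 ^ (DIM('a) - 1) / sqrt (1 - z \<bullet> z) * K"
      using sq chord_pos[OF z w] by (intro mult_mono) (auto intro!: frac_le mult_left_mono power_mono simp: abs_mult)
    then show ?case by (auto simp: w_def[symmetric] abs_mult[symmetric] indicator_def)
  qed
qed auto

text \<open>The derivative of the integral over the ball of radius R at R = 1, taken ray by ray
  under dominated convergence. The hitting time has derivative \<open>1 / chord z 1 w\<close> there,
  which is the denominator of \<open>jacobian\<close>.\<close>

lemma shell_limit_nonneg:
  fixes F :: "'a::euclidean_space \<Rightarrow> real" and z :: 'a
  assumes F: "continuous_on UNIV F" "\<And>y. 0 \<le> F y" "\<And>y. F y \<le> K" and z: "norm z < 1"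
    and R: "\<And>i::nat. norm z < R i" "\<And>i. R i < 1" "R \<longlonglongrightarrow> 1"
  shows "(\<lambda>i. ((LINT y:ball 0 1|lborel. F y) - (LINT y:ball 0 (R i)|lborel. F y)) / (1 - R i)) \<longlonglongrightarrow> sphere_integral z F"
proof -
  let ?n = "DIM('a)"
  let ?w = "\<lambda>h::'a. dir h"
  have [measurable]: "F \<in> borel_measurable borel" using F(1) by (rule borel_measurable_continuous_onI)
  define G where "G w t = real ?n * t ^ (?n - 1) * F (z + t *\<^sub>R w)" for w :: 'a and t
  define P where "P R h = (\<integral>t. indicator {hit z R (?w h)..hit z 1 (?w h)} t *\<^sub>R G (?w h) t \<partial>lborel)" for R h
  note shell = shell_integral_eq[OF F R(1,2), folded G_def]
  have contG: "continuous_on A (G w)" for A and w :: 'a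
    unfolding G_def by (intro continuous_intros continuous_on_compose2[OF F(1)]) auto
  define C where "C = 2 / sqrt (1 - z \<bullet> z) * (real ?n * 2 ^ (?n - 1) * K)"
  have nz: "AE h in lborel. h \<noteq> (0::'a)" by (rule AE_lborel_singleton)
  have "(\<lambda>i. LINT h:ball 0 1|lborel. P (R i) h / (1 - R i)) \<longlonglongrightarrow> sphere_integral z F"
    unfolding set_lebesgue_integral_def sphere_integral_def
  proof (rule integral_dominated_convergence[where w="\<lambda>h. indicator (ball 0 1) h *\<^sub>R C"])
    show "integrable lborel (\<lambda>h::'a. indicator (ball 0 1) h *\<^sub>R C)"
      using ball_set_integrable[of "\<lambda>_::'a. C"] by (simp add: set_integrable_def)
    show "(\<lambda>h. indicator (ball 0 1) h *\<^sub>R (P (R i) h / (1 - R i))) \<in> borel_measurable lborel" for i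
    proof -
      have "(\<lambda>h. (indicator (ball 0 1) h *\<^sub>R P (R i) h) / (1 - R i)) \<in> borel_measurable lborel"
        using shell(2)[of i] unfolding set_borel_measurable_def P_def by (intro borel_measurable_divide) auto
      then show ?thesis by simp
    qed
    show "AE h in lborel. norm (indicator (ball 0 1) h *\<^sub>R (P (R i) h / (1 - R i))) \<le> indicator (ball 0 1) h *\<^sub>R C" for i
      using nz
    proof eventually_elim
      case (elim h)
      have "0 \<le> P (R i) h" "P (R i) h \<le> (1 - R i) * C" using shell(3)[OF elim, of i] by (auto simp: C_def P_def)
      then have "\<bar>P (R i) h / (1 - R i)\<bar> \<le> C" using R(2)[of i] by (simp add: field_simps)
      then show ?case by (auto simp: indicator_def)
    qed
    show "AE h in lborel. (\<lambda>i. indicator (ball 0 1) h *\<^sub>R (P (R i) h / (1 - R i))) \<longlonglongrightarrow> indicator (ball 0 1 - {0}) h *\<^sub>R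
       (jacobian z h * F (target z h))"
      using nz
    proof eventually_elim
      case (elim h)
      define w where "w = ?w h"
      have w: "norm w = 1" using elim by (simp add: w_def)
      have hz: "0 < hit z 1 w" "hit z 1 w \<le> 2" using hit_pos[OF z w] hit_le[OF z w] by simp_all
      define J where "J t = integral {0..t} (G w)" for t
      have PJ: "P (R i) h = J (hit z 1 w) - J (hit z (R i) w)" for i
      proof -
        have h0: "0 \<le> hit z (R i) w" using hit_pos[OF R(1) w] by (simp add: less_imp_le)
        have "0 \<le> R i" using R(1)[of i] norm_ge_zero[of z] by linarith
        then have "(R i)\<^sup>2 \<le> 1" using R(2)[of i] by (simp add: power_le_one)
        then have h1: "hit z (R i) w \<le> hit z 1 w" unfolding hit_def chord_def by simp
        have "P (R i) h = (LINT t:{hit z (R i) w..hit z 1 w}|lborel. G w t)"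
          by (simp add: P_def w_def set_lebesgue_integral_def)
        also have "\<dots> = integral {hit z (R i) w..hit z 1 w} (G w)"
          by (intro set_borel_integral_eq_integral borel_integrable_atLeastAtMost' contG)
        also have "\<dots> = J (hit z 1 w) - J (hit z (R i) w)"
          using Henstock_Kurzweil_Integration.integral_combine[where f="G w", OF h0 h1 integrable_continuous_interval[OF contG]]
          by (simp add: J_def)
        finally show ?thesis .
      qed
      \<comment> \<open>Any interval with the hitting time in its interior serves; hitting times lie
        strictly above 0 and are at most 2.\<close>
      have "(J has_real_derivative G w (hit z 1 w)) (at (hit z 1 w) within {0..3})"
        unfolding J_def using hz by (intro integral_has_real_derivative contG) auto
      moreover have "at (hit z 1 w) within {0..3} = at (hit z 1 w)"
        using hz by (intro at_within_Icc_at) auto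
      ultimately have dJ: "(J has_real_derivative G w (hit z 1 w)) (at (hit z 1 w))" by simp
      have "(z \<bullet> w)\<^sup>2 + 1\<^sup>2 - z \<bullet> z > 0" using chord_sq[OF z w] chord_pos[OF z w] by (metis zero_less_power)
      then have dh: "((\<lambda>R. hit z R w) has_real_derivative 1 / chord z 1 w) (at 1)"
        unfolding hit_def chord_def by (auto intro!: derivative_eq_intros simp: divide_simps)
      have "((\<lambda>R. J (hit z R w)) has_real_derivative G w (hit z 1 w) * (1 / chord z 1 w)) (at 1)"
        by (rule DERIV_chain2[OF dJ dh])
      then have "((\<lambda>R. (J (hit z R w) - J (hit z 1 w)) / (R - 1)) \<longlongrightarrow> G w (hit z 1 w) * (1 / chord z 1 w)) (at 1)"
        by (simp add: has_field_derivative_iff)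
      moreover have "filterlim R (at 1) sequentially"
        using R(2,3) by (intro filterlim_atI) (auto simp: less_imp_neq)
      ultimately have "(\<lambda>i. (J (hit z (R i) w) - J (hit z 1 w)) / (R i - 1)) \<longlonglongrightarrow> G w (hit z 1 w) * (1 / chord z 1 w)"
        by (rule filterlim_compose)
      moreover have "(J (hit z (R i) w) - J (hit z 1 w)) / (R i - 1) = P (R i) h / (1 - R i)" for i
        unfolding PJ by (metis minus_diff_eq minus_divide_divide)
      ultimately have "(\<lambda>i. P (R i) h / (1 - R i)) \<longlonglongrightarrow> real ?n * hit z 1 w ^ (?n - 1) / chord z 1 w * F (z + hit z 1 w *\<^sub>R w)"
        by (simp add: G_def)
      then have "(\<lambda>i. indicator (ball 0 1) h *\<^sub>R (P (R i) h / (1 - R i))) \<longlonglongrightarrow>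
          indicator (ball 0 1) h *\<^sub>R (real ?n * hit z 1 w ^ (?n - 1) / chord z 1 w * F (z + hit z 1 w *\<^sub>R w))"
        by (rule tendsto_scaleR[OF tendsto_const])
      moreover have "indicator (ball 0 1 - {0}) h = (indicator (ball 0 1) h :: real)"
        using elim by (simp add: indicator_def)
      ultimately show ?case unfolding w_def by (simp only:)
    qed
  next
    show "(\<lambda>h. indicator (ball 0 1 - {0}) h *\<^sub>R (jacobian z h * F (target z h))) \<in> borel_measurable lborel"
    proof -
      have "\<bar>F y\<bar> \<le> K" for y using F(2,3) by (simp add: abs_of_nonneg)
      then have "set_integrable lborel (ball 0 1 - {0}) (\<lambda>h. jacobian z h * F (target z h))"
        using z by (intro sphere_integrable) auto
      then show ?thesis unfolding set_integrable_def by (rule borel_measurable_integrable)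
    qed
  qed
  moreover have "(LINT h:ball 0 1|lborel. P (R i) h / (1 - R i))
      = ((LINT y:ball 0 1|lborel. F y) - (LINT y:ball 0 (R i)|lborel. F y)) / (1 - R i)" for i
    unfolding shell(1) P_def by simp
  ultimately show ?thesis by (simp only:)
qed

lemma sphere_integral_cong:
  fixes F G :: "'a::euclidean_space \<Rightarrow> real" and z :: 'a
  assumes "norm z < 1" "\<And>y. norm y = 1 \<Longrightarrow> F y = G y"
  shows "sphere_integral z F = sphere_integral z G"
  unfolding sphere_integral_def
proof (intro set_lebesgue_integral_cong allI impI)
  fix h :: 'a assume "h \<in> ball 0 1 - {0}"
  then have "norm (dir h) = 1" by simp
  then have "F (target z h) = G (target z h)"
    by (intro assms(2) norm_hit[OF assms(1)])
  then show "jacobian z h * F (target z h) = jacobian z h * G (target z h)"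
    by (simp only:)
qed auto

lemma sphere_integral_add:
  fixes F G :: "'a::euclidean_space \<Rightarrow> real" and z :: 'a
  assumes "F \<in> borel_measurable borel" "\<And>y. norm y = 1 \<Longrightarrow> \<bar>F y\<bar> \<le> K"
    and "G \<in> borel_measurable borel" "\<And>y. norm y = 1 \<Longrightarrow> \<bar>G y\<bar> \<le> L" and z: "norm z < 1"
  shows "sphere_integral z (\<lambda>y. F y + G y) = sphere_integral z F + sphere_integral z G"
  unfolding sphere_integral_def
  using set_integral_add(2)[OF sphere_integrable[OF assms(1,2) z] sphere_integrable[OF assms(3,4) z]]
  by (simp add: distrib_left)

text \<open>Composition with the nearest-point map makes a function on the closed ball continuous
  and bounded everywhere, and no sphere or ball integral in use sees the difference.\<close>

lemma bounded_continuous_extension: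
  fixes F :: "'a::euclidean_space \<Rightarrow> real"
  assumes F: "continuous_on (cball 0 1) F"
  obtains E K where "continuous_on UNIV E" "\<And>y. y \<in> cball 0 1 \<Longrightarrow> E y = F y" "\<And>y. \<bar>E y\<bar> \<le> K"
proof -
  define E where "E y = F (closest_point (cball 0 1) y)" for y
  have cp: "closest_point (cball 0 1) y \<in> cball (0::'a) 1" for y
    by (intro closest_point_in_set) auto
  have 1: "continuous_on UNIV E"
    unfolding E_def
    by (intro continuous_on_compose2[OF F] continuous_on_closest_point) (use cp in auto)
  have 2: "E y = F y" if "y \<in> cball 0 1" for y
    using that by (simp add: E_def closest_point_self)
  obtain K where "\<forall>x\<in>F ` cball 0 1. norm x \<le> K"
    using compact_imp_bounded[OF compact_continuous_image[OF F compact_cball]] unfolding bounded_iff by blast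
  then have "\<bar>E y\<bar> \<le> K" for y using cp[of y] by (simp add: E_def)
  with 1 2 show thesis by (rule that)
qed

text \<open>Adding a bound \<open>K\<close> makes the extended function nonnegative; both sides are
  additive, so the limit for the constant can be subtracted again.\<close>

lemma shell_limit:
  fixes F :: "'a::euclidean_space \<Rightarrow> real" and z :: 'a
  assumes F: "continuous_on (cball 0 1) F" and z: "norm z < 1"
    and R: "\<And>i::nat. norm z < R i" "\<And>i. R i < 1" "R \<longlonglongrightarrow> 1"
  shows "(\<lambda>i. ((LINT y:ball 0 1|lborel. F y) - (LINT y:ball 0 (R i)|lborel. F y)) / (1 - R i)) \<longlonglongrightarrow> sphere_integral z F"
proof -
  obtain E K where contE: "continuous_on UNIV E" and EF: "\<And>y. y \<in> cball 0 1 \<Longrightarrow> E y = F y" and EK: "\<And>y. \<bar>E y\<bar> \<le> K"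
    using bounded_continuous_extension[OF F] by blast
  have K0: "0 \<le> K" using EK[of 0] by linarith
  have [measurable]: "E \<in> borel_measurable borel" using contE by (rule borel_measurable_continuous_onI)
  have 1: "(\<lambda>i. ((LINT y:ball 0 1|lborel. E y + K) - (LINT y:ball 0 (R i)|lborel. E y + K)) / (1 - R i)) \<longlonglongrightarrow> sphere_integral z (\<lambda>y. E y + K)"
  proof (rule shell_limit_nonneg[where K="2 * K", OF _ _ _ z R])
    show "continuous_on UNIV (\<lambda>y. E y + K)" by (intro continuous_intros contE)
    show "0 \<le> E y + K" "E y + K \<le> 2 * K" for y using EK[of y] by (auto simp: abs_le_iff)
  qed
  have 2: "(\<lambda>i. ((LINT y:ball (0::'a) 1|lborel. K) - (LINT y:ball (0::'a) (R i)|lborel. K)) / (1 - R i)) \<longlonglongrightarrow> sphere_integral z (\<lambda>_. K)"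
    using K0 by (intro shell_limit_nonneg[where K=K] z R) auto
  have intE: "set_integrable lborel (ball 0 1) E" "set_integrable lborel (ball (0::'a) 1) (\<lambda>_. K)"
    by (intro ball_set_integrable continuous_on_subset[OF contE] continuous_intros subset_UNIV)+
  have sub: "ball (0::'a) (R i) \<subseteq> ball 0 1" for i using R(2)[of i] by (simp add: subset_ball)
  have intE': "set_integrable lborel (ball 0 (R i)) E" "set_integrable lborel (ball (0::'a) (R i)) (\<lambda>_. K)" for i
    using set_integrable_subset[OF intE(1) _ sub] set_integrable_subset[OF intE(2) _ sub] by auto
  have sum: "sphere_integral z (\<lambda>y. E y + K) = sphere_integral z E + sphere_integral z (\<lambda>_. K)"
    using EK by (intro sphere_integral_add[where K=K and L="\<bar>K\<bar>"] z) auto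
  have "(\<lambda>i. ((LINT y:ball 0 1|lborel. E y) - (LINT y:ball 0 (R i)|lborel. E y)) / (1 - R i)) \<longlonglongrightarrow> sphere_integral z E"
    using tendsto_diff[OF 1 2] unfolding sum set_integral_add(2)[OF intE] set_integral_add(2)[OF intE']
    by (simp add: diff_divide_distrib[symmetric] algebra_simps)
  moreover have "(LINT y:ball 0 1|lborel. E y) = (LINT y:ball 0 1|lborel. F y)"
    by (intro set_lebesgue_integral_cong) (auto simp: EF)
  moreover have "(LINT y:ball 0 (R i)|lborel. E y) = (LINT y:ball 0 (R i)|lborel. F y)" for i
    using R(2)[of i] by (intro set_lebesgue_integral_cong) (auto simp: EF)
  moreover have "sphere_integral z E = sphere_integral z F"
    by (rule sphere_integral_cong[OF z]) (simp add: EF)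
  ultimately show ?thesis by simp
qed

lemma sphere_integrable_continuous:
  fixes F :: "'a::euclidean_space \<Rightarrow> real" and z :: 'a
  assumes F: "continuous_on (cball 0 1) F" and z: "norm z < 1"
  shows "set_integrable lborel (ball 0 1 - {0}) (\<lambda>h. jacobian z h * F (target z h))"
proof -
  obtain E K where contE: "continuous_on UNIV E" and EF: "\<And>y. y \<in> cball 0 1 \<Longrightarrow> E y = F y" and EK: "\<And>y. \<bar>E y\<bar> \<le> K"
    using bounded_continuous_extension[OF F] by blast
  have "set_integrable lborel (ball 0 1 - {0}) (\<lambda>h. jacobian z h * E (target z h))"
    using contE EK z by (intro sphere_integrable borel_measurable_continuous_onI)
  also have "?this \<longleftrightarrow> ?thesis"
  proof (rule set_integrable_cong[OF refl refl])
    fix h :: 'a assume "h \<in> ball 0 1 - {0}"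
    then have w: "norm (dir h) = 1" by simp
    have "E (target z h) = F (target z h)"
      using norm_hit[OF z w] by (intro EF) (simp only: mem_cball dist_0_norm)
    then show "jacobian z h * E (target z h) = jacobian z h * F (target z h)" by (simp only:)
  qed
  finally show ?thesis .
qed

lemma sphere_integral_add_continuous:
  fixes F G :: "'a::euclidean_space \<Rightarrow> real" and z :: 'a
  assumes F: "continuous_on (cball 0 1) F" and G: "continuous_on (cball 0 1) G" and z: "norm z < 1"
  shows "sphere_integral z (\<lambda>y. F y + G y) = sphere_integral z F + sphere_integral z G"
  unfolding sphere_integral_def
  using set_integral_add(2)[OF sphere_integrable_continuous[OF F z] sphere_integrable_continuous[OF G z]]
  by (simp add: distrib_left)

lemma sphere_integral_cmult: "sphere_integral z (\<lambda>y. c * F y) = c * sphere_integral z F"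
  unfolding sphere_integral_def set_integral_mult_right[symmetric] by (simp add: mult_ac)

lemma sphere_integral_mono:
  fixes F G :: "'a::euclidean_space \<Rightarrow> real" and z :: 'a
  assumes F: "continuous_on (cball 0 1) F" and G: "continuous_on (cball 0 1) G" and z: "norm z < 1"
    and le: "\<And>y. norm y = 1 \<Longrightarrow> F y \<le> G y"
  shows "sphere_integral z F \<le> sphere_integral z G"
  unfolding sphere_integral_def
proof (rule set_integral_mono[OF sphere_integrable_continuous[OF F z] sphere_integrable_continuous[OF G z]])
  fix h :: 'a assume "h \<in> ball 0 1 - {0}"
  then have w: "norm (dir h) = 1" by simp
  show "jacobian z h * F (target z h) \<le> jacobian z h * G (target z h)"
    using hit_pos[OF z w] chord_pos[OF z w]
    by (intro mult_left_mono le norm_hit[OF z w]) (auto intro!: divide_nonneg_nonneg mult_nonneg_nonneg)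
qed

text \<open>Differentiating \<open>R ^ k * c\<close> at \<open>R = 1\<close> gives the sphere
  integral, whatever the centre \<open>z\<close>. Thus the mean value formulas about 0 become
  available in polar coordinates about any interior point.\<close>

lemma sphere_integral_eqI:
  fixes F :: "'a::euclidean_space \<Rightarrow> real" and z :: 'a
  assumes F: "continuous_on (cball 0 1) F" and z: "norm z < 1"
    and N: "\<And>R. 0 < R \<Longrightarrow> R \<le> 1 \<Longrightarrow> (LINT y:ball 0 R|lborel. F y) = R ^ k * c"
  shows "sphere_integral z F = real k * c"
proof -
  \<comment> \<open>The shift by two keeps \<open>norm z < R i\<close> strict already at
    \<open>i = 0\<close>.\<close>
  define R where "R i = 1 - (1 - norm z) * inverse (real (Suc (Suc i)))" for i :: nat
  have Rz: "norm z < R i" for i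
  proof -
    have "(1 - norm z) * inverse (real (Suc (Suc i))) < (1 - norm z) * 1"
      using z by (intro mult_strict_left_mono) (auto simp: inverse_eq_divide)
    then show ?thesis by (simp add: R_def)
  qed
  have R1: "R i < 1" for i using z by (simp add: R_def)
  have "(\<lambda>i. 1 - (1 - norm z) * inverse (real (Suc (Suc i)))) \<longlonglongrightarrow> 1 - (1 - norm z) * 0"
    by (intro tendsto_diff tendsto_mult tendsto_const LIMSEQ_Suc[OF LIMSEQ_inverse_real_of_nat])
  then have lim: "R \<longlonglongrightarrow> 1" by (simp add: R_def[abs_def])
  have R0: "0 < R i" for i using Rz[of i] norm_ge_zero[of z] by linarith
  have "((\<lambda>R. R ^ k * c) has_real_derivative real k * c) (at 1)"
    by (auto intro!: derivative_eq_intros)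
  then have "((\<lambda>R. (R ^ k * c - 1 ^ k * c) / (R - 1)) \<longlongrightarrow> real k * c) (at 1)"
    by (simp add: has_field_derivative_iff)
  moreover have "filterlim R (at 1) sequentially"
    using R1 lim by (intro filterlim_atI) (auto simp: less_imp_neq)
  ultimately have "(\<lambda>i. (R i ^ k * c - 1 ^ k * c) / (R i - 1)) \<longlonglongrightarrow> real k * c"
    by (rule filterlim_compose)
  moreover have "(R i ^ k * c - 1 ^ k * c) / (R i - 1)
      = ((LINT y:ball 0 1|lborel. F y) - (LINT y:ball 0 (R i)|lborel. F y)) / (1 - R i)" for i
  proof -
    have "(LINT y:ball 0 (R i)|lborel. F y) = R i ^ k * c" "(LINT y:ball 0 1|lborel. F y) = 1 ^ k * c"
      using R0[of i] R1[of i] by (intro N; simp)+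
    then show ?thesis by (metis minus_diff_eq minus_divide_divide)
  qed
  ultimately show ?thesis
    using shell_limit[OF F z Rz R1 lim] LIMSEQ_unique by simp
qed

section \<open>Mean value formulas for the sphere integral\<close>

lemma ball_integral_scale:
  fixes F :: "'a::euclidean_space \<Rightarrow> real"
  assumes F: "continuous_on (cball 0 1) F" and R: "0 < R" "R \<le> 1"
  shows "(LINT y:ball 0 R|lborel. F y) = R ^ DIM('a) * (LINT y:ball 0 1|lborel. F (R *\<^sub>R y))"
proof -
  have "set_integrable lborel (ball 0 R) F"
    by (rule set_integrable_subset[OF ball_set_integrable[OF F]]) (use R in auto)
  then have "(\<lambda>y. indicator (ball 0 R) y *\<^sub>R F y) \<in> borel_measurable borel"
    by (simp add: set_integrable_def)
  from integral_lborel_affine[OF this, of R 0] R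
  have "(LINT y:ball 0 R|lborel. F y) = R ^ DIM('a) * (\<integral>y. indicator (ball 0 R) (R *\<^sub>R y) *\<^sub>R F (R *\<^sub>R y) \<partial>lborel)"
    by (simp add: set_lebesgue_integral_def)
  also have "(\<lambda>y::'a. indicator (ball 0 R) (R *\<^sub>R y) *\<^sub>R F (R *\<^sub>R y)) = (\<lambda>y. indicator (ball 0 1) y *\<^sub>R F (R *\<^sub>R y))"
    using R by (auto simp: fun_eq_iff indicator_def)
  finally show ?thesis by (simp add: set_lebesgue_integral_def)
qed

text \<open>Integration by parts for the coordinate functions. It normalises the gradient formula:
  the weight \<open>1 - y \<bullet> y\<close> is traded for the volume of the ball.\<close>

lemma ball_second_moment:
  "(real DIM('a) + 2) * (LINT y:ball (0::'a::euclidean_space) 1|lborel. 1 - y \<bullet> y) = 2 * measure lborel (ball 0 1 :: 'a set)"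
proof -
  define V where "V = measure lborel (ball 0 1 :: 'a set)"
  define Q where "Q = (LINT y:ball (0::'a) 1|lborel. y \<bullet> y)"
  have W: "(LINT y:ball (0::'a) 1|lborel. 1 - y \<bullet> y) = V - Q"
    unfolding Q_def by (subst set_integral_diff(2))
      (auto intro!: ball_set_integrable continuous_intros simp: set_lebesgue_integral_def[of _ _ "\<lambda>_. 1"] V_def)
  have "0 = (\<Sum>i\<in>(Basis::'a set). (LINT y:ball 0 1|lborel. (1 - y \<bullet> y) * (i \<bullet> i) - 2 * (y \<bullet> i) * (y \<bullet> i)))"
  proof -
    have "(LINT y:ball 0 1|lborel. (1 - y \<bullet> y) * (i \<bullet> i) - 2 * (y \<bullet> i) * (y \<bullet> i)) = 0" if "i \<in> Basis" for i :: 'a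
      by (rule ball_integration_by_parts[where U=UNIV and f="\<lambda>y. y \<bullet> i" and f'="\<lambda>y k. k \<bullet> i"])
         (use that in \<open>auto intro!: derivative_eq_intros continuous_intros\<close>)
    then show ?thesis by simp
  qed
  also have "\<dots> = (LINT y:ball (0::'a) 1|lborel. (\<Sum>i\<in>(Basis::'a set). (1 - y \<bullet> y) * (i \<bullet> i) - 2 * (y \<bullet> i) * (y \<bullet> i)))"
    by (intro ball_integral_sum[symmetric] continuous_intros)
  also have "\<dots> = (LINT y:ball (0::'a) 1|lborel. real DIM('a) * (1 - y \<bullet> y) - 2 * (y \<bullet> y))"
  proof (intro set_lebesgue_integral_cong allI impI)
    fix y :: 'a
    have "(\<Sum>i\<in>Basis. 2 * (y \<bullet> i) * (y \<bullet> i)) = 2 * (y \<bullet> y)"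
      by (simp add: euclidean_inner[of y y] sum_distrib_left mult.assoc)
    then show "(\<Sum>i\<in>(Basis::'a set). (1 - y \<bullet> y) * (i \<bullet> i) - 2 * (y \<bullet> i) * (y \<bullet> i)) = real DIM('a) * (1 - y \<bullet> y) - 2 * (y \<bullet> y)"
      by (simp add: sum_subtractf inner_same_Basis)
  qed simp
  also have "\<dots> = real DIM('a) * (V - Q) - 2 * Q"
    by (subst set_integral_diff(2)) (auto intro!: ball_set_integrable continuous_intros simp: W Q_def)
  finally show ?thesis unfolding W V_def[symmetric] by (simp add: algebra_simps)
qed

context
  fixes v :: "'a::euclidean_space \<Rightarrow> real" and g H U and z :: 'a
  assumes h: "harmonic_with v g H U" and U: "open U" "cball 0 1 \<subseteq> U" and z: "norm z < 1"
begin

lemma sphere_mean_value: "sphere_integral z v = real DIM('a) * measure lborel (ball 0 1 :: 'a set) * v 0"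
proof -
  note cv = harmonic_with_continuous_cball(1)[OF h U(2)]
  have "sphere_integral z v = real DIM('a) * (measure lborel (ball 0 1 :: 'a set) * v 0)"
  proof (rule sphere_integral_eqI[OF cv z])
    fix R :: real assume R: "0 < R" "R \<le> 1"
    show "(LINT y:ball 0 R|lborel. v y) = R ^ DIM('a) * (measure lborel (ball 0 1 :: 'a set) * v 0)"
      using harmonic_mean_value_ball[OF harmonic_scale_ball[OF h U R]] ball_integral_scale[OF cv R] by simp
  qed
  then show ?thesis by simp
qed

text \<open>The integral over the ball of radius \<open>R\<close> has degree
  \<open>DIM('a) + 2\<close>: the volume gives \<open>DIM('a)\<close>, the factor
  \<open>y \<bullet> e\<close> gives one, and the gradient of the dilated function one more. The
  factor \<open>DIM('a) + 2\<close> from differentiation cancels against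
  \<open>ball_second_moment\<close>.\<close>

lemma sphere_gradient_mean_value:
  "sphere_integral z (\<lambda>y. v y * (y \<bullet> e)) = measure lborel (ball 0 1 :: 'a set) * (g 0 \<bullet> e)"
proof -
  have cv: "continuous_on (cball 0 1) (\<lambda>y. v y * (y \<bullet> e))"
    by (intro continuous_intros harmonic_with_continuous_cball(1)[OF h U(2)])
  define W where "W = (LINT y:ball (0::'a) 1|lborel. 1 - y \<bullet> y)"
  have "sphere_integral z (\<lambda>y. v y * (y \<bullet> e)) = real (DIM('a) + 2) * (W / 2 * (g 0 \<bullet> e))"
  proof (rule sphere_integral_eqI[OF cv z])
    fix R :: real assume R: "0 < R" "R \<le> 1"
    have "2 * (LINT y:ball 0 1|lborel. (y \<bullet> e) * v (R *\<^sub>R y)) = R * W * (g 0 \<bullet> e)"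
      using harmonic_gradient_mean_value_ball[OF harmonic_scale_ball[OF h U R], of e] by (simp add: W_def)
    moreover have "(LINT y:ball 0 1|lborel. v (R *\<^sub>R y) * ((R *\<^sub>R y) \<bullet> e)) = R * (LINT y:ball 0 1|lborel. (y \<bullet> e) * v (R *\<^sub>R y))"
      unfolding set_integral_mult_right[symmetric] by (simp add: mult_ac)
    ultimately show "(LINT y:ball 0 R|lborel. v y * (y \<bullet> e)) = R ^ (DIM('a) + 2) * (W / 2 * (g 0 \<bullet> e))"
      using ball_integral_scale[OF cv R] by (simp add: power2_eq_square)
  qed
  also have "\<dots> = (real DIM('a) + 2) * W / 2 * (g 0 \<bullet> e)" by simp
  also have "\<dots> = measure lborel (ball 0 1 :: 'a set) * (g 0 \<bullet> e)"
    unfolding W_def ball_second_moment by simp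
  finally show ?thesis .
qed

end

section \<open>Directional integrals\<close>

lemma norm_mirror: "norm v = 1 \<Longrightarrow> norm (mirror v h) = norm h"
  by (simp add: norm_eq_sqrt_inner mirror_def inner_diff_left inner_diff_right inner_commute norm_eq_1)

lemma mirror_scaleR: "mirror v (c *\<^sub>R h) = c *\<^sub>R mirror v h"
  by (simp add: mirror_def algebra_simps)

lemma mirror_mirror: "norm v = 1 \<Longrightarrow> mirror v (mirror v h) = h"
  by (simp add: mirror_def inner_diff_left norm_eq_1 algebra_simps)

lemma inner_mirror: "mirror v h \<bullet> k = h \<bullet> mirror v k"
  by (simp add: mirror_def inner_diff_left inner_diff_right inner_commute mult.commute mult.left_commute)

lemma mirror_swap:
  assumes "norm l = 1" "norm e = 1" "l \<noteq> e"
  defines "v \<equiv> (l - e) /\<^sub>R norm (l - e)"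
  shows "norm v = 1" "mirror v l = e" "mirror v e = l"
proof -
  have nz: "norm (l - e) \<noteq> 0" using assms by simp
  show "norm v = 1" using nz by (simp add: v_def)
  have sq: "(norm (l - e))\<^sup>2 = 2 * (1 - l \<bullet> e)"
    using assms(1,2) by (simp add: power2_norm_eq_inner inner_diff_left inner_diff_right inner_commute norm_eq_1)
  have lv: "(l \<bullet> v) *\<^sub>R v = (1 / 2) *\<^sub>R (l - e)"
  proof -
    have "(l \<bullet> v) *\<^sub>R v = ((1 - l \<bullet> e) / (norm (l - e))\<^sup>2) *\<^sub>R (l - e)"
      using assms(1) by (simp add: v_def inner_diff_right norm_eq_1 power2_eq_square divide_inverse mult_ac)
    also have "(1 - l \<bullet> e) / (norm (l - e))\<^sup>2 = 1 / 2"
    proof -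
      have "1 - l \<bullet> e \<noteq> 0" using sq nz by auto
      then show ?thesis unfolding sq by simp
    qed
    finally show ?thesis .
  qed
  show l: "mirror v l = e"
  proof -
    have "mirror v l = l - 2 *\<^sub>R ((l \<bullet> v) *\<^sub>R v)" by (simp add: mirror_def)
    then show ?thesis unfolding lv by simp
  qed
  show "mirror v e = l" using mirror_mirror[OF \<open>norm v = 1\<close>, of l] l by simp
qed

lemma directional_integral_le:
  fixes E :: "'a::euclidean_space \<Rightarrow> real"
  assumes [measurable]: "E \<in> borel_measurable borel" and B: "\<And>w. norm w = 1 \<Longrightarrow> \<bar>E w\<bar> \<le> B"
    and mono: "\<And>w w'. norm w = 1 \<Longrightarrow> norm w' = 1 \<Longrightarrow> \<bar>w' \<bullet> e\<bar> \<le> \<bar>w \<bullet> e\<bar> \<Longrightarrow> E w' \<le> E w"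
    and l: "norm l = 1" and e: "norm e = 1"
  shows "(LINT h:ball 0 1 - {0}|lborel. E (dir h) * \<bar>dir h \<bullet> l\<bar>)
       \<le> (LINT h:ball 0 1 - {0}|lborel. E (dir h) * \<bar>dir h \<bullet> e\<bar>)"
proof (cases "l = e")
  case False
  define v where "v = (l - e) /\<^sub>R norm (l - e)"
  note v = mirror_swap[OF l e False, folded v_def]
  have [measurable]: "ball (0::'a) 1 - {0} \<in> sets borel" by auto
  have B0: "0 \<le> B" using B[OF e] by linarith
  have int: "set_integrable lborel (ball 0 1 - {0}) (\<lambda>h. E (T (dir h)) * \<bar>dir h \<bullet> k\<bar>)"
    if k: "norm k = 1" and [measurable]: "T \<in> borel_measurable borel" and T: "\<And>h. norm (T h) = norm h" for k and T :: "'a \<Rightarrow> 'a"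
    unfolding set_integrable_def
  proof (rule integrableI_bounded_set[where A="ball 0 1 - {0}" and B=B])
    show "emeasure lborel (ball (0::'a) 1 - {0}) < \<infinity>" by (intro emeasure_bounded_finite bounded_diff bounded_ball)
    have b: "\<bar>indicator (ball 0 1 - {0}) h *\<^sub>R (E (T (dir h)) * \<bar>dir h \<bullet> k\<bar>)\<bar> \<le> B" if "h \<noteq> 0" for h :: 'a
    proof -
      define w where "w = dir h"
      have w: "norm w = 1" using that by (simp add: w_def)
      have "\<bar>w \<bullet> k\<bar> \<le> 1" using Cauchy_Schwarz_ineq2[of w k] w k by simp
      moreover have "\<bar>E (T w)\<bar> \<le> B" using B T w by simp
      ultimately have "\<bar>E (T w)\<bar> * \<bar>w \<bullet> k\<bar> \<le> B * 1" using B0 by (intro mult_mono) auto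
      then show ?thesis using B0 by (auto simp: w_def[symmetric] abs_mult indicator_def)
    qed
    show "AE h in lborel. h \<in> ball (0::'a) 1 - {0} \<longrightarrow> norm (indicator (ball 0 1 - {0}) h *\<^sub>R (E (T (dir h)) * \<bar>dir h \<bullet> k\<bar>)) \<le> B"
      using b by (intro AE_I2 impI) (auto simp only: real_norm_def)
    show "(\<lambda>h. indicator (ball 0 1 - {0}) h *\<^sub>R (E (T (dir h)) * \<bar>dir h \<bullet> k\<bar>)) \<in> borel_measurable lborel"
      by measurable
  qed auto
  define I where "I T k = (LINT h:ball 0 1 - {0}|lborel. E (T (dir h)) * \<bar>dir h \<bullet> k\<bar>)" for T :: "'a \<Rightarrow> 'a" and k
  have flip: "I (\<lambda>h. h) k = I (mirror v) (mirror v k)" for k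
  proof -
    have "I (\<lambda>h. h) k = (\<integral>h. indicator (ball 0 1 - {0}) (mirror v h) *\<^sub>R (E (dir (mirror v h)) * \<bar>dir (mirror v h) \<bullet> k\<bar>) \<partial>lborel)"
      unfolding I_def set_lebesgue_integral_def by (rule integral_mirror[OF _ v(1), symmetric]) measurable
    also have "\<dots> = I (mirror v) (mirror v k)"
      unfolding I_def set_lebesgue_integral_def
    proof (rule Bochner_Integration.integral_cong[OF refl])
      fix h :: 'a
      have "mirror v h = 0 \<longleftrightarrow> h = 0" using norm_mirror[OF v(1), of h] by (metis norm_eq_zero)
      then have "indicator (ball 0 1 - {0}) (mirror v h) = (indicator (ball 0 1 - {0}) h :: real)"
        using norm_mirror[OF v(1), of h] by (auto simp: indicator_def)
      then show "indicator (ball 0 1 - {0}) (mirror v h) *\<^sub>R (E (dir (mirror v h)) * \<bar>dir (mirror v h) \<bullet> k\<bar>)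
         = indicator (ball 0 1 - {0}) h *\<^sub>R (E (mirror v (dir h)) * \<bar>dir h \<bullet> mirror v k\<bar>)"
        by (simp add: norm_mirror[OF v(1)] mirror_scaleR inner_mirror)
    qed
    finally show ?thesis .
  qed
  have id: "I (\<lambda>h. h) e = I (mirror v) l" "I (\<lambda>h. h) l = I (mirror v) e"
    using flip[of e] flip[of l] v by auto
  have i1: "set_integrable lborel (ball 0 1 - {0}) (\<lambda>h. E (dir h) * \<bar>dir h \<bullet> e\<bar>)"
    by (rule int[OF e, of "\<lambda>h. h"]) auto
  have i2: "set_integrable lborel (ball 0 1 - {0}) (\<lambda>h. E (dir h) * \<bar>dir h \<bullet> l\<bar>)"
    by (rule int[OF l, of "\<lambda>h. h"]) auto
  have i3: "set_integrable lborel (ball 0 1 - {0}) (\<lambda>h. E (mirror v (dir h)) * \<bar>dir h \<bullet> e\<bar>)"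
    by (rule int[OF e]) (use norm_mirror[OF v(1)] in auto)
  have i4: "set_integrable lborel (ball 0 1 - {0}) (\<lambda>h. E (mirror v (dir h)) * \<bar>dir h \<bullet> l\<bar>)"
    by (rule int[OF l]) (use norm_mirror[OF v(1)] in auto)
  txt \<open>The reflection \<open>mirror v\<close> swaps \<open>l\<close> and \<open>e\<close>, so the difference of the two sides of the claim is half the
    integral of a product of two factors of equal sign.\<close>
  have "I (\<lambda>h. h) l + I (mirror v) e \<le> I (\<lambda>h. h) e + I (mirror v) l"
    unfolding I_def set_integral_add(2)[OF i2 i3, symmetric] set_integral_add(2)[OF i1 i4, symmetric]
  proof (rule set_integral_mono)
    fix h :: 'a assume "h \<in> ball 0 1 - {0}"
    then have w: "norm (dir h) = 1" by simp
    define w where "w = dir h"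
    have w: "norm w = 1" "norm (mirror v w) = 1" using w norm_mirror[OF v(1)] by (auto simp: w_def)
    have me: "mirror v w \<bullet> e = w \<bullet> l" by (simp add: inner_mirror v)
    have "0 \<le> (E w - E (mirror v w)) * (\<bar>w \<bullet> e\<bar> - \<bar>w \<bullet> l\<bar>)"
    proof (cases "\<bar>w \<bullet> l\<bar> \<le> \<bar>w \<bullet> e\<bar>")
      case True
      then show ?thesis using mono[OF w] me by simp
    next
      case False
      then have "E w \<le> E (mirror v w)" using mono[OF w(2,1)] me by simp
      then show ?thesis using False by (intro mult_nonpos_nonpos) auto
    qed
    then show "E (dir h) * \<bar>dir h \<bullet> l\<bar> + E (mirror v (dir h)) * \<bar>dir h \<bullet> e\<bar>
       \<le> E (dir h) * \<bar>dir h \<bullet> e\<bar> + E (mirror v (dir h)) * \<bar>dir h \<bullet> l\<bar>"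
      unfolding w_def[symmetric] by (simp add: algebra_simps)
  qed (intro set_integral_add i1 i2 i3 i4)+
  then show ?thesis using id by (simp add: I_def)
qed simp

section \<open>The inversion that preserves the unit ball\<close>

lemma inversion_norm:
  fixes c :: "'a::euclidean_space"
  assumes y: "y \<noteq> c" and R: "R = c \<bullet> c - 1"
  shows "1 - (norm (inversion R c y))\<^sup>2 = R / ((y - c) \<bullet> (y - c)) * (1 - (norm y)\<^sup>2)"
proof -
  define d where "d = y - c"
  define r where "r = d \<bullet> d"
  have r: "r \<noteq> 0" using y by (simp add: r_def d_def)
  have yd: "(norm y)\<^sup>2 = r + 2 * (c \<bullet> d) + c \<bullet> c"
    unfolding power2_norm_eq_inner r_def d_def
    by (simp add: inner_diff_left inner_diff_right inner_commute)
  have "(norm (inversion R c y))\<^sup>2 = c \<bullet> c + 2 * (R / r) * (c \<bullet> d) + (R / r)\<^sup>2 * r"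
    unfolding power2_norm_eq_inner inversion_def d_def[symmetric] r_def[symmetric]
    by (simp add: inner_add_left inner_add_right inner_commute power2_eq_square r_def)
  also have "(R / r)\<^sup>2 * r = R / r * R" using r by (simp add: power2_eq_square)
  finally have n: "(norm (inversion R c y))\<^sup>2 = c \<bullet> c + 2 * (R / r) * (c \<bullet> d) + R / r * R" .
  \<comment> \<open>By Pythagoras, this relation says that the sphere of inversion meets the unit
    sphere at right angles when \<open>R > 0\<close>.\<close>
  have cc: "c \<bullet> c = R + 1" using R by simp
  have "1 - (norm (inversion R c y))\<^sup>2 = R / r * (1 - (r + 2 * (c \<bullet> d) + c \<bullet> c))"
    unfolding n cc using r by (simp add: field_simps)
  then show ?thesis unfolding yd d_def[symmetric] r_def[symmetric] .
qed

lemma inversion_inversion: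
  assumes y: "y \<noteq> c" and R: "R \<noteq> 0"
  shows "inversion R c (inversion R c y) = y"
proof -
  define d where "d = y - c"
  define r where "r = d \<bullet> d"
  have r: "r \<noteq> 0" using y by (simp add: r_def d_def)
  have 1: "inversion R c y = c + (R / r) *\<^sub>R d" by (simp add: inversion_def d_def r_def)
  have "inversion R c (c + (R / r) *\<^sub>R d) = c + (R / ((R / r) * ((R / r) * r)) * (R / r)) *\<^sub>R d"
    by (simp add: inversion_def r_def)
  also have "R / ((R / r) * ((R / r) * r)) * (R / r) = 1" using r R by (simp add: field_simps)
  finally show ?thesis unfolding 1 by (simp add: d_def)
qed

lemma continuous_on_inversion:
  "c \<notin> S \<Longrightarrow> continuous_on S (inversion R c)"
  unfolding inversion_def[abs_def] by (intro continuous_intros) auto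

section \<open>The extremal problem at a point\<close>

text \<open>\<open>a = (n - 2) / n\<close>, and \<open>inversion R c\<close> is the inversion that preserves the unit ball and exchanges
  \<open>0\<close> and \<open>x\<close>. The point \<open>z = a x\<close> is chosen so that the value \<open>u x\<close> cancels in
  \<open>kelvin_gradient_formula\<close>.\<close>

context
  fixes x :: "'a::euclidean_space" and p a r R :: real and z c e :: 'a
  assumes dim: "DIM('a) \<ge> 3" and x0: "x \<noteq> 0" and x1: "norm x < 1"
    and p: "p = (real DIM('a) - 2) / 2" and a: "a = p / (p + 1)" and r: "r = norm x"
    and z: "z = a *\<^sub>R x" and c: "c = (1 / r\<^sup>2) *\<^sub>R x" and R: "R = 1 / r\<^sup>2 - 1"
    and e: "e = (1 / r) *\<^sub>R x"
begin

lemma params: "0 < p" "0 < a" "a < 1" "0 < r" "r < 1" "0 < R" "real DIM('a) = 2 * p + 2"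
  "real DIM('a) * a = 2 * p" "norm e = 1" "x = r *\<^sub>R e"
proof -
  show "0 < p" using dim by (simp add: p)
  then show "0 < a" "a < 1" by (simp_all add: a)
  show r0: "0 < r" "r < 1" using x0 x1 by (simp_all add: r)
  have "r\<^sup>2 < 1" using r0 by (simp add: power_less_one_iff)
  then show "0 < R" using r0 by (simp add: R)
  show n: "real DIM('a) = 2 * p + 2" unfolding p by (simp add: diff_divide_distrib)
  show "real DIM('a) * a = 2 * p" unfolding n a using \<open>0 < p\<close> by (simp add: field_simps)
  show "norm e = 1" using r0 by (simp add: e r)
  show "x = r *\<^sub>R e" using r0 by (simp add: e)
qed

lemma inner_params: "x \<bullet> x = r\<^sup>2" "z \<bullet> z = a\<^sup>2 * r\<^sup>2" "c \<bullet> c = 1 / r\<^sup>2" "R = c \<bullet> c - 1"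
proof -
  show xx: "x \<bullet> x = r\<^sup>2" unfolding r by (simp add: dot_square_norm)
  show "z \<bullet> z = a\<^sup>2 * r\<^sup>2" unfolding z by (simp add: xx power2_eq_square)
  have "c \<bullet> c = (1 / r\<^sup>2) * ((1 / r\<^sup>2) * r\<^sup>2)" unfolding c by (simp add: xx)
  then show cc: "c \<bullet> c = 1 / r\<^sup>2" using params(4) by simp
  show "R = c \<bullet> c - 1" unfolding cc by (rule R)
qed

lemma norm_z: "norm z < 1"
proof -
  have "a * r < 1 * 1" using params(2-5) by (intro mult_strict_mono) auto
  then show ?thesis using params(2,4) by (simp add: z flip: r)
qed

lemma c_outside: "c \<notin> cball 0 1"
proof -
  have "norm c = 1 / r" using params(4) by (simp add: c power2_eq_square flip: r)
  then show ?thesis using params(1-9) by simp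
qed

lemma inversion_0: "inversion R c 0 = x"
proof -
  have "inversion R c 0 = (1 - R * r\<^sup>2) *\<^sub>R c"
    using inner_params by (simp add: inversion_def algebra_simps)
  also have "1 - R * r\<^sup>2 = r\<^sup>2" using params(1-9) by (simp add: R field_simps)
  finally show ?thesis using params(1-9) by (simp add: c)
qed

lemma inversion_ball:
  assumes "y \<in> cball 0 1"
  shows "inversion R c y \<in> cball 0 1" "norm y = 1 \<Longrightarrow> norm (inversion R c y) = 1"
proof -
  have y: "y \<noteq> c" using assms c_outside by auto
  have q: "0 \<le> R / ((y - c) \<bullet> (y - c))" using params(6) by (intro divide_nonneg_nonneg) auto
  have "(norm y)\<^sup>2 \<le> 1" using assms by (simp add: power_le_one)
  then have "0 \<le> 1 - (norm (inversion R c y))\<^sup>2"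
    unfolding inversion_norm[OF y inner_params(4)] using q by (intro mult_nonneg_nonneg) auto
  then show "inversion R c y \<in> cball 0 1"
    by (simp add: power_le_one_iff abs_square_le_1)
  assume "norm y = 1"
  then have "1 - (norm (inversion R c y))\<^sup>2 = 0"
    unfolding inversion_norm[OF y inner_params(4)] by simp
  then show "norm (inversion R c y) = 1"
    by (simp add: power2_eq_1_iff) (metis norm_ge_zero not_one_le_zero neg_0_le_iff_le le_minus_one_simps(3))
qed

lemma kelvin_domain:
  assumes "open U" "cball 0 1 \<subseteq> U"
  shows "open {y. y \<noteq> c \<and> inversion R c y \<in> U}" "cball 0 1 \<subseteq> {y. y \<noteq> c \<and> inversion R c y \<in> U}"
proof -
  have "open ((- {c}) \<inter> inversion R c -` U)"
    by (intro continuous_open_preimage continuous_on_inversion assms) auto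
  also have "(- {c}) \<inter> inversion R c -` U = {y. y \<noteq> c \<and> inversion R c y \<in> U}" by auto
  finally show "open {y. y \<noteq> c \<and> inversion R c y \<in> U}" .
  show "cball 0 1 \<subseteq> {y. y \<noteq> c \<and> inversion R c y \<in> U}"
    using inversion_ball(1) assms(2) c_outside by auto
qed

lemma kelvin_value_formula:
  assumes h: "harmonic_with u g H U" and U: "open U" "cball 0 1 \<subseteq> U" and z': "norm z' < 1"
  shows "sphere_integral z' (kelvin p R c u) = real DIM('a) * measure lborel (ball 0 1 :: 'a set) * ((1 / r\<^sup>2) powr - p * u x)"
  using sphere_mean_value[OF harmonic_with_kelvin[OF h params(7), of R c] kelvin_domain[OF U] z']
  by (simp add: kelvin_def inversion_0 inner_params(3))

text \<open>The gradient of the Kelvin transform at 0 contains \<open>2 * p * u x\<close> times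
  \<open>c\<close>, from differentiating the power of the distance. The mean value formula weighted
  by \<open>z \<bullet> l\<close> produces the same term, because \<open>DIM('a) * a = 2 * p\<close>
  and both \<open>z\<close> and \<open>c\<close> are multiples of \<open>x\<close>. What is left is
  the gradient of \<open>u\<close> seen through the reflection in the derivative of the
  inversion.\<close>

lemma kelvin_gradient_formula:
  assumes h: "harmonic_with u g H U" and U: "open U" "cball 0 1 \<subseteq> U"
  shows "sphere_integral z (\<lambda>y. kelvin p R c u y * ((y - z) \<bullet> l))
    = measure lborel (ball 0 1 :: 'a set) * (1 / r\<^sup>2) powr (- p - 1) * R * (g x \<bullet> mirror e l)"
proof -
  let ?q = "(1 / r\<^sup>2) powr (- p - 1)"
  let ?V = "measure lborel (ball 0 1 :: 'a set)"
  note K = harmonic_with_kelvin[OF h params(7), of R c] kelvin_domain[OF U] norm_z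
  note cK = harmonic_with_continuous_cball(1)[OF K(1,3)]
  have "sphere_integral z (\<lambda>y. kelvin p R c u y * ((y - z) \<bullet> l))
     = sphere_integral z (\<lambda>y. kelvin p R c u y * (y \<bullet> l) + (- (z \<bullet> l)) * kelvin p R c u y)"
    by (simp add: inner_diff_left algebra_simps)
  also have "\<dots> = sphere_integral z (\<lambda>y. kelvin p R c u y * (y \<bullet> l)) + sphere_integral z (\<lambda>y. (- (z \<bullet> l)) * kelvin p R c u y)"
    by (intro sphere_integral_add_continuous continuous_intros cK norm_z)
  also have "\<dots> = ?V * (kelvin_grad p R c u g 0 \<bullet> l) - (z \<bullet> l) * (real DIM('a) * ?V * ((1 / r\<^sup>2) powr - p * u x))"
    unfolding sphere_integral_cmult sphere_gradient_mean_value[OF K] kelvin_value_formula[OF h U norm_z] by simp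
  also have "kelvin_grad p R c u g 0 \<bullet> l
     = ?q * (R * (g x \<bullet> l) + 2 * (p * u x - R * (c \<bullet> g x) * r\<^sup>2) * (c \<bullet> l))"
    unfolding kelvin_grad_def inversion_0 using params(4)
    by (simp add: inner_params(3) inner_diff_left inner_add_left algebra_simps)
  also have "(z \<bullet> l) * (real DIM('a) * ?V * ((1 / r\<^sup>2) powr - p * u x))
     = ?V * ?q * (2 * p * u x * (c \<bullet> l))"
  proof -
    have 1: "(1 / r\<^sup>2) powr - p = ?q * (1 / r\<^sup>2)"
      using params(4) by (simp add: powr_diff)
    have 2: "(z \<bullet> l) * real DIM('a) * (1 / r\<^sup>2) = 2 * p * (c \<bullet> l)"
      unfolding params(8)[symmetric] z c using params(4) by simp
    have "(z \<bullet> l) * (real DIM('a) * ?V * ((1 / r\<^sup>2) powr - p * u x))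
      = ?V * ?q * u x * ((z \<bullet> l) * real DIM('a) * (1 / r\<^sup>2))"
      unfolding 1 by (simp only: mult_ac)
    then show ?thesis unfolding 2 by (simp only: mult_ac)
  qed
  also have "?V * (?q * (R * (g x \<bullet> l) + 2 * (p * u x - R * (c \<bullet> g x) * r\<^sup>2) * (c \<bullet> l)))
      - ?V * ?q * (2 * p * u x * (c \<bullet> l))
     = ?V * ?q * R * (g x \<bullet> l - 2 * (c \<bullet> g x) * r\<^sup>2 * (c \<bullet> l))"
    by (simp add: algebra_simps)
  also have "g x \<bullet> l - 2 * (c \<bullet> g x) * r\<^sup>2 * (c \<bullet> l) = g x \<bullet> mirror e l"
    using params(4) by (simp add: mirror_def inner_diff_right e c inner_commute power2_eq_square)
  finally show ?thesis .
qed

text \<open>For \<open>y\<close> on the unit sphere, the squared distances to \<open>c\<close> and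
  to \<open>z\<close> are both affine in \<open>y \<bullet> x\<close>, since \<open>c\<close> and
  \<open>z\<close> are multiples of \<open>x\<close>. Eliminating \<open>y \<bullet> x\<close>
  expresses the distance to \<open>c\<close> through the hitting time alone.\<close>

lemma sphere_point:
  assumes w: "norm w = 1"
  shows "a * r\<^sup>2 * ((z + hit z 1 w *\<^sub>R w - c) \<bullet> (z + hit z 1 w *\<^sub>R w - c)) = (hit z 1 w)\<^sup>2 - (1 - a) * (1 - a * r\<^sup>2)"
    and "0 < a * r\<^sup>2 * ((z + hit z 1 w *\<^sub>R w - c) \<bullet> (z + hit z 1 w *\<^sub>R w - c))"
proof -
  define y where "y = z + hit z 1 w *\<^sub>R w"
  have ny: "norm y = 1" unfolding y_def by (rule norm_hit[OF norm_z w])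
  then have yy: "y \<bullet> y = 1" by (simp add: norm_eq_1)
  have yc: "y \<bullet> c = (y \<bullet> x) / r\<^sup>2" by (simp add: c)
  have yz: "y \<bullet> z = a * (y \<bullet> x)" by (simp add: z)
  have 1: "a * r\<^sup>2 * ((y - c) \<bullet> (y - c)) = a * r\<^sup>2 + a - 2 * a * (y \<bullet> x)"
  proof -
    have "(y - c) \<bullet> (y - c) = 1 - 2 * (y \<bullet> x) / r\<^sup>2 + 1 / r\<^sup>2"
      by (simp add: inner_diff_left inner_diff_right inner_commute[of c y] yy yc inner_params(3))
    then have "r\<^sup>2 * ((y - c) \<bullet> (y - c)) = r\<^sup>2 - 2 * (y \<bullet> x) + 1"
      using params(4) by (simp add: field_simps)
    then have "a * (r\<^sup>2 * ((y - c) \<bullet> (y - c))) = a * (r\<^sup>2 - 2 * (y \<bullet> x) + 1)" by (rule arg_cong)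
    then show ?thesis by (simp add: algebra_simps)
  qed
  have "(hit z 1 w)\<^sup>2 = (y - z) \<bullet> (y - z)"
    using w by (simp add: y_def norm_eq_1 power2_eq_square)
  also have "\<dots> = 1 - 2 * a * (y \<bullet> x) + a\<^sup>2 * r\<^sup>2"
    by (simp add: inner_diff_left inner_diff_right inner_commute[of z y] yy yz inner_params(2))
  finally show "a * r\<^sup>2 * ((z + hit z 1 w *\<^sub>R w - c) \<bullet> (z + hit z 1 w *\<^sub>R w - c)) = (hit z 1 w)\<^sup>2 - (1 - a) * (1 - a * r\<^sup>2)"
    unfolding y_def[symmetric] 1 by (simp add: power2_eq_square algebra_simps)
  have "y \<noteq> c" using ny c_outside by auto
  then show "0 < a * r\<^sup>2 * ((z + hit z 1 w *\<^sub>R w - c) \<bullet> (z + hit z 1 w *\<^sub>R w - c))"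
    unfolding y_def[symmetric] using params(2,4) by simp
qed

text \<open>The parameter s of the overview. The two distances from \<open>z\<close> along a chord
  have product \<open>1 - z \<bullet> z\<close> and differ by twice \<open>z \<bullet> w\<close>,
  which calls for a hyperbolic parametrisation.\<close>

definition slope :: "'a \<Rightarrow> real" where
  "slope w = arsinh (z \<bullet> w / sqrt (1 - z \<bullet> z))"

text \<open>N(w) of the overview: Jacobian times density at the point hit, with one more factor
  \<open>hit z 1 w\<close> because \<open>y - z\<close> is
  \<open>hit z 1 w *\<^sub>R w\<close>.\<close>

definition weight :: "'a \<Rightarrow> real" where
  "weight w = real DIM('a) * hit z 1 w ^ (DIM('a) - 1) / chord z 1 w
     * (((z + hit z 1 w *\<^sub>R w - c) \<bullet> (z + hit z 1 w *\<^sub>R w - c)) powr - p * hit z 1 w)"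

lemma A_pos: "0 < 1 - z \<bullet> z"
  using norm_sq_less[OF norm_z params(9)] by simp

lemma sinh_slope: "sqrt (1 - z \<bullet> z) * sinh (slope w) = z \<bullet> w"
  using A_pos by (simp add: slope_def)

lemma chord_slope: "chord z 1 w = sqrt (1 - z \<bullet> z) * cosh (slope w)"
proof -
  have "(z \<bullet> w)\<^sup>2 + 1\<^sup>2 - z \<bullet> z = (1 - z \<bullet> z) * (sinh (slope w))\<^sup>2 + (1 - z \<bullet> z)"
    unfolding sinh_slope[of w, symmetric] power_mult_distrib using A_pos by simp
  also have "\<dots> = (1 - z \<bullet> z) * (cosh (slope w))\<^sup>2"
    by (simp add: cosh_square_eq algebra_simps)
  finally show ?thesis
    by (simp add: chord_def real_sqrt_mult)
qed

lemma hit_slope: "hit z 1 w = sqrt (1 - z \<bullet> z) * exp (- slope w)"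
  unfolding hit_def chord_slope sinh_slope[of w, symmetric]
  by (simp add: right_diff_distrib[symmetric] cosh_minus_sinh)

lemma slope_minus: "slope (- w) = - slope w"
  by (simp add: slope_def arsinh_minus_real)

lemma slope_abs_mono:
  assumes "\<bar>w' \<bullet> e\<bar> \<le> \<bar>w \<bullet> e\<bar>"
  shows "\<bar>slope w'\<bar> \<le> \<bar>slope w\<bar>"
proof -
  have ze: "z = (a * r) *\<^sub>R e" using params(4) by (simp add: z e)
  have abs: "\<bar>slope v\<bar> = arsinh (\<bar>v \<bullet> e\<bar> * (a * r / sqrt (1 - z \<bullet> z)))" for v
  proof -
    have "\<bar>arsinh t\<bar> = arsinh \<bar>t\<bar>" for t :: real
      by (cases "t \<ge> 0") (auto simp: arsinh_minus_real abs_if arsinh_real_neg_iff)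
    moreover have "\<bar>z \<bullet> v / sqrt (1 - z \<bullet> z)\<bar> = \<bar>v \<bullet> e\<bar> * (a * r / sqrt (1 - z \<bullet> z))"
    proof -
      have "z \<bullet> v = (a * r) * (v \<bullet> e)" by (subst ze) (simp add: inner_commute)
      then show ?thesis using params(2,4) A_pos by (simp add: abs_mult)
    qed
    ultimately show ?thesis by (simp add: slope_def)
  qed
  have "\<bar>w' \<bullet> e\<bar> * (a * r / sqrt (1 - z \<bullet> z)) \<le> \<bar>w \<bullet> e\<bar> * (a * r / sqrt (1 - z \<bullet> z))"
    using assms params(2,4) A_pos by (intro mult_right_mono) auto
  then show ?thesis unfolding abs by (meson arsinh_less_iff_real not_less)
qed

text \<open>The constant b of the overview: the offset in \<open>sphere_point\<close> divided by the
  product of the two distances.\<close>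

definition ratio :: real where "ratio = (1 - a) * (1 - a * r\<^sup>2) / (1 - z \<bullet> z)"

lemma ratio_nonneg: "0 \<le> ratio"
proof -
  have "a * r\<^sup>2 \<le> 1 * 1" using params by (intro mult_mono) (auto simp: power_le_one)
  then show ?thesis unfolding ratio_def using params(3) A_pos by simp
qed

text \<open>This is positivity of the squared distance to \<open>c\<close> in
  \<open>sphere_point\<close>, rewritten with \<open>slope\<close>; it places the binomial series
  inside its disc of convergence.\<close>

lemma ratio_less:
  assumes w: "norm w = 1"
  shows "ratio * exp (2 * slope w) < 1"
proof -
  have h2: "(hit z 1 w)\<^sup>2 = (1 - z \<bullet> z) * exp (- 2 * slope w)"
    unfolding hit_slope power_mult_distrib using A_pos by (simp add: exp_double[symmetric] flip: exp_of_nat_mult)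
  have "(1 - a) * (1 - a * r\<^sup>2) < (1 - z \<bullet> z) * exp (- 2 * slope w)"
    using sphere_point[OF w] h2 by linarith
  then have "ratio < exp (- 2 * slope w)"
    unfolding ratio_def using A_pos by (simp add: field_simps)
  then have "ratio * exp (2 * slope w) < exp (- 2 * slope w) * exp (2 * slope w)"
    by (rule mult_strict_right_mono) simp
  then show ?thesis by (simp flip: exp_add)
qed

lemma weight_slope:
  assumes w: "norm w = 1"
  shows "weight w = real DIM('a) * sqrt (1 - z \<bullet> z) * (1 / (a * r\<^sup>2)) powr - p
      * (exp (- 2 * slope w) * (1 - ratio * exp (2 * slope w)) powr - p / cosh (slope w))"
proof -
  let ?f = "(1 - ratio * exp (2 * slope w)) powr - p"
  let ?q = "(1 / (a * r\<^sup>2)) powr - p"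
  let ?A = "sqrt (1 - z \<bullet> z)"
  define q where "q = (z + hit z 1 w *\<^sub>R w - c) \<bullet> (z + hit z 1 w *\<^sub>R w - c)"
  define h where "h = hit z 1 w"
  have h: "0 < h" unfolding h_def by (rule hit_pos[OF norm_z w])
  have h2: "h\<^sup>2 = (1 - z \<bullet> z) * exp (- 2 * slope w)"
    unfolding h_def hit_slope power_mult_distrib using A_pos by (simp add: exp_double[symmetric] flip: exp_of_nat_mult)
  have qe: "q = 1 / (a * r\<^sup>2) * (h\<^sup>2 * (1 - ratio * exp (2 * slope w)))"
  proof -
    have "h\<^sup>2 * (1 - ratio * exp (2 * slope w)) = h\<^sup>2 - (1 - z \<bullet> z) * ratio * (exp (- 2 * slope w) * exp (2 * slope w))"
      unfolding h2 by (simp add: algebra_simps)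
    also have "\<dots> = h\<^sup>2 - (1 - a) * (1 - a * r\<^sup>2)"
      using A_pos by (simp add: ratio_def flip: exp_add)
    also have "\<dots> = a * r\<^sup>2 * q" using sphere_point(1)[OF w] by (simp add: h_def q_def)
    finally show ?thesis using params(2,4) by (simp add: field_simps)
  qed
  have pos: "0 < 1 - ratio * exp (2 * slope w)" using ratio_less[OF w] by simp
  have 1: "q powr - p = ?q * ((h\<^sup>2) powr - p * ?f)"
  proof -
    have "0 \<le> 1 / (a * r\<^sup>2)" "0 \<le> h\<^sup>2" "0 \<le> 1 - ratio * exp (2 * slope w)"
      using params(2,4) pos by auto
    then show ?thesis unfolding qe by (simp only: powr_mult mult_nonneg_nonneg)
  qed
  \<comment> \<open>Exponent count: n - 1 from the Jacobian, 1 from \<open>y - z\<close>, and - 2 p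
    from the density leave n - 2 p = 2, hence \<open>exp (- 2 * s)\<close> in
    \<open>antipodal\<close>.\<close>
  have 2: "h ^ (DIM('a) - 1) * h * (h\<^sup>2) powr - p = h\<^sup>2"
  proof -
    have "h ^ (DIM('a) - 1) * h = h ^ DIM('a)" by (rule power_minus_mult) simp
    also have "\<dots> = h powr (2 * p + 2)" using h by (simp add: powr_realpow[symmetric] params(7)[symmetric])
    moreover have "(h\<^sup>2) powr - p = h powr (- 2 * p)" using h by (simp add: powr_powr flip: powr_numeral)
    ultimately have "h ^ (DIM('a) - 1) * h * (h\<^sup>2) powr - p = h powr ((2 * p + 2) + (- 2 * p))"
      by (simp only: powr_add)
    then show ?thesis using h by (simp add: powr_numeral)
  qed
  have "weight w = real DIM('a) / chord z 1 w * (h ^ (DIM('a) - 1) * h * q powr - p)"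
    by (simp add: weight_def q_def h_def)
  also have "\<dots> = real DIM('a) / chord z 1 w * ((h ^ (DIM('a) - 1) * h * (h\<^sup>2) powr - p) * ?q * ?f)"
    unfolding 1 by (simp only: mult_ac)
  also have "\<dots> = real DIM('a) / chord z 1 w * (h\<^sup>2 * ?q * ?f)"
    unfolding 2 ..
  also have "\<dots> = real DIM('a) / (?A * cosh (slope w)) * ((?A * ?A) * exp (- 2 * slope w) * ?q * ?f)"
    unfolding chord_slope h2 using A_pos by simp
  also have "\<dots> = real DIM('a) * ?A * ?q
      * (exp (- 2 * slope w) * ?f / cosh (slope w))"
    using A_pos by (simp add: field_simps del: real_sqrt_mult_self)
  finally show ?thesis .
qed

lemma weight_sum_antipodal:
  assumes w: "norm w = 1"
  shows "weight w + weight (- w) = real DIM('a) * sqrt (1 - z \<bullet> z) * (1 / (a * r\<^sup>2)) powr - p * antipodal p ratio (slope w)"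
  unfolding weight_slope[OF w] weight_slope[of "- w", unfolded norm_minus_cancel, OF w] slope_minus antipodal_def
  by (simp add: distrib_left add_divide_distrib)

lemma weight_sum_mono:
  assumes w: "norm w = 1" "norm w' = 1" and le: "\<bar>w' \<bullet> e\<bar> \<le> \<bar>w \<bullet> e\<bar>"
  shows "weight w' + weight (- w') \<le> weight w + weight (- w)"
proof -
  have abs: "antipodal p ratio t = antipodal p ratio \<bar>t\<bar>" for t by (simp add: abs_if antipodal_minus)
  have "ratio * exp (2 * \<bar>slope w\<bar>) < 1"
    using ratio_less[OF w(1)] ratio_less[of "- w"] w(1) by (auto simp: abs_if slope_minus)
  then have "antipodal p ratio (slope w') \<le> antipodal p ratio (slope w)"
    unfolding abs[of "slope w"] abs[of "slope w'"]
    using params(1) ratio_nonneg slope_abs_mono[OF le] by (intro antipodal_mono_nonneg) auto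
  then show ?thesis
    unfolding weight_sum_antipodal[OF w(1)] weight_sum_antipodal[OF w(2)] using A_pos by (intro mult_left_mono) auto
qed

lemma weight_nonneg: "norm w = 1 \<Longrightarrow> 0 \<le> weight w"
  unfolding weight_def using hit_pos[OF norm_z] chord_pos[OF norm_z]
  by (intro mult_nonneg_nonneg divide_nonneg_nonneg) (auto intro: less_imp_le)

lemma weight_measurable [measurable]: "weight \<in> borel_measurable borel"
  unfolding weight_def by measurable

definition dens :: "'a \<Rightarrow> real" where "dens y = ((y - c) \<bullet> (y - c)) powr - p"

abbreviation dint :: "'a \<Rightarrow> real" where
  "dint l \<equiv> sphere_integral z (\<lambda>y. dens y * \<bar>(y - z) \<bullet> l\<bar>)"

lemma continuous_on_dens: "continuous_on (cball 0 1) dens"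
  unfolding dens_def using c_outside by (intro continuous_intros) auto

lemma sphere_integral_weight:
  "dint l
     = (LINT h:ball 0 1 - {0}|lborel. weight (dir h) * \<bar>dir h \<bullet> l\<bar>)"
  "set_integrable lborel (ball 0 1 - {0}) (\<lambda>h. weight (dir h) * \<bar>dir h \<bullet> l\<bar>)"
proof -
  have eq: "real DIM('a) * hit z 1 w ^ (DIM('a) - 1) / chord z 1 w * (dens (z + hit z 1 w *\<^sub>R w) * \<bar>(z + hit z 1 w *\<^sub>R w - z) \<bullet> l\<bar>)
     = weight w * \<bar>w \<bullet> l\<bar>" if w: "norm w = 1" for w
    using hit_pos[OF norm_z w] by (simp add: weight_def dens_def abs_mult)
  have eq': "jacobian z h * (dens (target z h) * \<bar>(target z h - z) \<bullet> l\<bar>)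
     = weight (dir h) * \<bar>dir h \<bullet> l\<bar>" if h: "h \<in> ball 0 1 - {0}" for h
    by (rule eq) (use h in simp)
  show "dint l
     = (LINT h:ball 0 1 - {0}|lborel. weight (dir h) * \<bar>dir h \<bullet> l\<bar>)"
    unfolding sphere_integral_def
    by (intro set_lebesgue_integral_cong allI impI eq') auto
  have "set_integrable lborel (ball 0 1 - {0}) (\<lambda>h. jacobian z h * (dens (target z h) * \<bar>(target z h - z) \<bullet> l\<bar>))"
    by (intro sphere_integrable_continuous continuous_intros continuous_on_dens norm_z)
  also have "?this \<longleftrightarrow> set_integrable lborel (ball 0 1 - {0}) (\<lambda>h. weight (dir h) * \<bar>dir h \<bullet> l\<bar>)"
    by (rule set_integrable_cong[OF refl refl eq'])
  finally show "set_integrable lborel (ball 0 1 - {0}) (\<lambda>h. weight (dir h) * \<bar>dir h \<bullet> l\<bar>)" .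
qed

text \<open>\<open>\<bar>w \<bullet> l\<bar>\<close> is even in \<open>w\<close>, so the weight may
  be replaced by its antipodal sum \<open>E\<close> at the cost of a factor 2. \<open>E\<close> is
  monotone in \<open>\<bar>w \<bullet> e\<bar>\<close>, as the reflection argument requires.\<close>

lemma sphere_integral_le:
  assumes l: "norm l = 1"
  shows "dint l \<le> dint e"
proof -
  have [measurable]: "ball (0::'a) 1 - {0} \<in> sets borel" by auto
  define E where "E w = weight w + weight (- w)" for w
  have double: "(LINT h:ball 0 1 - {0}|lborel. E (dir h) * \<bar>dir h \<bullet> k\<bar>)
      = 2 * dint k" for k
  proof -
    define f where "f h = indicator (ball 0 1 - {0}) h *\<^sub>R (weight (dir h) * \<bar>dir h \<bullet> k\<bar>)" for h :: 'a
    have [measurable]: "f \<in> borel_measurable borel" unfolding f_def by measurable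
    have intf: "integrable lborel f"
      using sphere_integral_weight(2)[of k] unfolding set_integrable_def f_def .
    have neg: "(\<integral>h. f h \<partial>lborel) = (\<integral>h. f (- h) \<partial>lborel)"
      using integral_lborel_affine[of f "-1" 0] by simp
    have intn: "integrable lborel (\<lambda>h. f (- h))"
    proof -
      have "distr lborel borel uminus = (lborel :: 'a measure)"
        by (subst lborel_affine[of "-1" "0::'a"]) (auto simp: density_1 one_ennreal_def[symmetric] distr_distr comp_def)
      then have "integrable (distr lborel borel uminus) f" using intf by simp
      then show ?thesis by (subst (asm) integrable_distr_eq) auto
    qed
    have "(LINT h:ball 0 1 - {0}|lborel. E (dir h) * \<bar>dir h \<bullet> k\<bar>) = (\<integral>h. f h + f (- h) \<partial>lborel)"
      unfolding set_lebesgue_integral_def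
      by (intro Bochner_Integration.integral_cong) (auto simp: f_def E_def indicator_def distrib_right)
    also have "\<dots> = 2 * (\<integral>h. f h \<partial>lborel)" using intf intn neg by simp
    finally show ?thesis unfolding sphere_integral_weight(1) f_def set_lebesgue_integral_def .
  qed
  have mono: "E w' \<le> E w" if "norm w = 1" "norm w' = 1" "\<bar>w' \<bullet> e\<bar> \<le> \<bar>w \<bullet> e\<bar>" for w w'
    unfolding E_def using that by (rule weight_sum_mono)
  \<comment> \<open>Monotonicity supplies the bound as well:
    \<open>\<bar>w \<bullet> e\<bar>\<close> is largest at \<open>w = e\<close>.\<close>
  have "\<bar>E w\<bar> \<le> E e" if w: "norm w = 1" for w
  proof -
    have "\<bar>w \<bullet> e\<bar> \<le> \<bar>e \<bullet> e\<bar>" using Cauchy_Schwarz_ineq2[of w e] w params(9) by (simp add: norm_eq_1)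
    then have "E w \<le> E e" using w params(9) by (intro mono)
    moreover have "0 \<le> E w" unfolding E_def using w by (intro add_nonneg_nonneg weight_nonneg) auto
    ultimately show ?thesis by simp
  qed
  moreover have "E \<in> borel_measurable borel" unfolding E_def by measurable
  ultimately have "(LINT h:ball 0 1 - {0}|lborel. E (dir h) * \<bar>dir h \<bullet> l\<bar>)
       \<le> (LINT h:ball 0 1 - {0}|lborel. E (dir h) * \<bar>dir h \<bullet> e\<bar>)"
    using mono l params(9) by (intro directional_integral_le) auto
  then show ?thesis unfolding double by simp
qed

section \<open>Sharp gradient estimate for functions harmonic near the closed ball\<close>

lemma dens_nonneg: "0 \<le> dens y"
  by (simp add: dens_def)

lemma kelvin_dens: "kelvin p R c u y = dens y * u (inversion R c y)"
  by (simp add: kelvin_def dens_def)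

lemma continuous_on_kelvin:
  assumes "harmonic_with u g H U" "cball 0 1 \<subseteq> U"
  shows "continuous_on (cball 0 1) (kelvin p R c u)"
  unfolding kelvin_dens[abs_def]
  using harmonic_with_continuous(1)[OF assms(1)] inversion_ball(1) assms(2) c_outside
  by (intro continuous_intros continuous_on_dens continuous_on_compose2[OF _ continuous_on_inversion]) auto

lemma volume_pos: "0 < measure lborel (ball 0 1 :: 'a set)"
  by (simp add: content_ball_pos)

text \<open>A maximum principle from positivity: up to a positive constant, \<open>u x\<close> is a
  sphere integral of boundary values of \<open>u\<close> with nonnegative density, and the constant
  function \<open>M\<close> obeys the same formula.\<close>

lemma harmonic_bound_at_point:
  assumes h: "harmonic_with u g H U" and U: "open U" "cball 0 1 \<subseteq> U"
    and M: "\<And>y. norm y = 1 \<Longrightarrow> u y \<le> M"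
  shows "u x \<le> M"
proof -
  let ?C = "real DIM('a) * measure lborel (ball 0 1 :: 'a set) * (1 / r\<^sup>2) powr - p"
  have const: "harmonic_with (\<lambda>_. M) (\<lambda>_. 0) (\<lambda>_ _. 0) (UNIV :: 'a set)"
    by (rule harmonic_with_const)
  have z0: "norm (0::'a) < 1" by simp
  have "sphere_integral 0 (kelvin p R c u) \<le> sphere_integral 0 (kelvin p R c (\<lambda>_. M))"
  proof (rule sphere_integral_mono[OF _ _ z0])
    show "kelvin p R c u y \<le> kelvin p R c (\<lambda>_. M) y" if "norm y = 1" for y
      unfolding kelvin_dens using that by (intro mult_left_mono M inversion_ball(2) dens_nonneg) auto
  qed (use continuous_on_kelvin[OF h U(2)] continuous_on_kelvin[OF const] in auto)
  then have "?C * u x \<le> ?C * M"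
    unfolding kelvin_value_formula[OF h U z0] kelvin_value_formula[OF const open_UNIV subset_UNIV z0]
    by (simp only: mult.assoc)
  moreover have "0 < ?C" using volume_pos params(4) by simp
  ultimately show ?thesis by (simp only: mult_le_cancel_left_pos)
qed

text \<open>The integral for the direction \<open>e\<close> over the normalising factor of
  \<open>kelvin_gradient_formula\<close>; it turns out to be the common value of both extremal
  constants.\<close>

definition sharp_const :: real where
  "sharp_const = dint e
     / (measure lborel (ball 0 1 :: 'a set) * (1 / r\<^sup>2) powr (- p - 1) * R)"

lemma denominator_pos: "0 < measure lborel (ball 0 1 :: 'a set) * (1 / r\<^sup>2) powr (- p - 1) * R"
  using volume_pos params(4,6) by simp

lemma gradient_bound:
  assumes h: "harmonic_with u g H U" and U: "open U" "cball 0 1 \<subseteq> U"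
    and M: "\<And>y. norm y = 1 \<Longrightarrow> \<bar>u y\<bar> \<le> M"
  shows "norm (g x) \<le> sharp_const * M"
proof (cases "g x = 0")
  case True
  have "0 \<le> M" using M[OF params(9)] by simp
  moreover have "0 \<le> dint e"
  proof -
    have "sphere_integral z (\<lambda>_. 0) \<le> dint e"
      by (intro sphere_integral_mono continuous_intros continuous_on_dens norm_z mult_nonneg_nonneg dens_nonneg) auto
    then show ?thesis by (simp add: sphere_integral_def)
  qed
  ultimately show ?thesis
    using True denominator_pos by (simp add: sharp_const_def)
next
  case False
  let ?D = "measure lborel (ball 0 1 :: 'a set) * (1 / r\<^sup>2) powr (- p - 1) * R"
  have M0: "0 \<le> M" using M[OF params(9)] by simp
  define k where "k = g x /\<^sub>R norm (g x)"
  \<comment> \<open>The formula returns the derivative in direction \<open>mirror e l\<close>;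
    reflecting the gradient direction beforehand makes this the full norm.\<close>
  define l where "l = mirror e k"
  have k: "norm k = 1" using False by (simp add: k_def)
  then have l: "norm l = 1" by (simp add: l_def norm_mirror params(9))
  have gk: "g x \<bullet> mirror e l = norm (g x)"
    using False by (simp add: l_def mirror_mirror params(9) k_def dot_square_norm power2_eq_square)
  have "?D * norm (g x) = sphere_integral z (\<lambda>y. kelvin p R c u y * ((y - z) \<bullet> l))"
    unfolding kelvin_gradient_formula[OF h U] gk ..
  also have "\<dots> \<le> sphere_integral z (\<lambda>y. M * (dens y * \<bar>(y - z) \<bullet> l\<bar>))"
  proof (rule sphere_integral_mono[OF _ _ norm_z])
    fix y :: 'a assume y: "norm y = 1"
    have "u (inversion R c y) * ((y - z) \<bullet> l) \<le> \<bar>u (inversion R c y)\<bar> * \<bar>(y - z) \<bullet> l\<bar>"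
      by (simp flip: abs_mult)
    also have "\<dots> \<le> M * \<bar>(y - z) \<bullet> l\<bar>"
      using y by (intro mult_right_mono M inversion_ball(2)) auto
    finally have "dens y * (u (inversion R c y) * ((y - z) \<bullet> l)) \<le> dens y * (M * \<bar>(y - z) \<bullet> l\<bar>)"
      by (rule mult_left_mono[OF _ dens_nonneg])
    then show "kelvin p R c u y * ((y - z) \<bullet> l) \<le> M * (dens y * \<bar>(y - z) \<bullet> l\<bar>)"
      by (simp add: kelvin_dens mult_ac)
  qed (intro continuous_intros continuous_on_dens continuous_on_kelvin[OF h U(2)])+
  also have "\<dots> = M * dint l" by (rule sphere_integral_cmult)
  also have "\<dots> \<le> M * dint e"
    using M0 by (intro mult_left_mono sphere_integral_le l)
  finally show ?thesis
    using denominator_pos by (simp add: sharp_const_def field_simps)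
qed

lemma gradient_bound_sharp:
  assumes eps: "0 < eps"
  shows "\<exists>u g H. harmonic_with u g H (UNIV :: 'a set) \<and> (\<forall>y. norm y = 1 \<longrightarrow> \<bar>u y\<bar> \<le> 1 + eps) \<and> sharp_const - eps \<le> \<bar>g x \<bullet> e\<bar>"
proof -
  let ?D = "measure lborel (ball 0 1 :: 'a set) * (1 / r\<^sup>2) powr (- p - 1) * R"
  define B where "B = sphere_integral z dens"
  \<comment> \<open>The total error is \<open>3 * d * B\<close>: one \<open>d\<close> for replacing
    the sign by the ramp \<open>f\<close>, and \<open>2 * d\<close> for the polynomial, since
    \<open>\<bar>(y - z) \<bullet> e\<bar> \<le> 2\<close>. The added 1 keeps the denominator
    positive.\<close>
  define d where "d = min eps (eps * ?D / (3 * (\<bar>B\<bar> + 1)))"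
  have d: "0 < d" "d \<le> eps" "3 * d * B \<le> eps * ?D"
  proof -
    have "0 < eps * ?D / (3 * (\<bar>B\<bar> + 1))" using eps denominator_pos by simp
    then show d0: "0 < d" using eps by (simp add: d_def)
    show "d \<le> eps" by (simp add: d_def)
    have "3 * d * B \<le> 3 * d * (\<bar>B\<bar> + 1)" using d0 by (intro mult_left_mono) auto
    also have "\<dots> \<le> 3 * (eps * ?D / (3 * (\<bar>B\<bar> + 1))) * (\<bar>B\<bar> + 1)"
      by (intro mult_right_mono mult_left_mono) (auto simp: d_def)
    also have "\<dots> = eps * ?D"
    proof -
      have "3 * (X / (3 * K)) * K = X" if "K \<noteq> 0" for X K :: real using that by simp
      from this[of "\<bar>B\<bar> + 1"] show ?thesis by simp
    qed
    finally show "3 * d * B \<le> eps * ?D" .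
  qed
  txt \<open>The extremal boundary values are the sign of \<open>(y - z) \<bullet> e\<close>, transported by the inversion; they
    are zonal with axis \<open>e\<close>, so polynomials in one variable approximate them.\<close>
  define f where "f t = max (- 1) (min 1 (t / d))" for t :: real
  \<comment> \<open>\<open>m\<close> is the action of the inversion on heights: a unit vector
    \<open>y\<close> with \<open>y \<bullet> e = s\<close> is sent to height \<open>m s\<close>, the
    denominator being the squared distance from \<open>y\<close> to \<open>c\<close>. The inversion
    is an involution, so prescribing \<open>f (m s - z \<bullet> e)\<close> for \<open>u\<close>
    gives \<open>f ((y - z) \<bullet> e)\<close> after inversion.\<close>
  define m where "m s = c \<bullet> e + R / (1 - 2 * s / r + 1 / r\<^sup>2) * (s - c \<bullet> e)" for s
  have cr: "c = (1 / r) *\<^sub>R e" using params(4) by (simp add: c e power2_eq_square)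
  have den: "1 - 2 * s / r + 1 / r\<^sup>2 \<noteq> 0" if "s \<in> {-1..1}" for s
  proof -
    \<comment> \<open>The squared distance to \<open>c\<close> is smallest at the pole
      \<open>s = 1\<close> facing \<open>c\<close>.\<close>
    have "0 < (1 / r - 1)\<^sup>2" using params(4,5) by simp
    also have "\<dots> = 1 - 2 * 1 / r + 1 / r\<^sup>2" by (simp add: power2_eq_square algebra_simps)
    also have "\<dots> \<le> 1 - 2 * s / r + 1 / r\<^sup>2" using that params(4) by (simp add: divide_right_mono)
    finally show ?thesis by simp
  qed
  have "continuous_on {-1..1} (\<lambda>s. f (m s - z \<bullet> e))"
    unfolding f_def m_def using den d params(4) by (intro continuous_intros) auto
  then obtain q where q: "real_polynomial_function q" "\<And>s. s \<in> {-1..1} \<Longrightarrow> \<bar>f (m s - z \<bullet> e) - q s\<bar> < d"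
    using Stone_Weierstrass_real_polynomial_function[OF compact_Icc _ d(1)] by blast
  then obtain a' N where q': "q = (\<lambda>s. \<Sum>i\<le>N. a' i * s ^ i)"
    unfolding real_polynomial_function_iff_sum by blast
  obtain u g H where h: "harmonic_with u g H (UNIV :: 'a set)"
    and u: "\<And>y. norm y = 1 \<Longrightarrow> u y = q (y \<bullet> e)"
    using harmonic_zonal_polynomial[OF params(9), of a' N] unfolding q' by blast
  have ye: "y \<bullet> e \<in> {-1..1}" if "norm y = 1" for y
    using Cauchy_Schwarz_ineq2[of y e] that params(9) by (simp add: abs_le_iff)
  have f1: "\<bar>f t\<bar> \<le> 1" for t by (simp add: f_def)
  have u1: "\<bar>u y\<bar> \<le> 1 + d" if "norm y = 1" for y
    using q(2)[OF ye[OF that]] f1[of "m (y \<bullet> e) - z \<bullet> e"] u[OF that] by linarith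
  have ft: "\<bar>t\<bar> - d \<le> f t * t" for t
  proof -
    consider "t \<ge> d" | "t \<le> - d" | "\<bar>t\<bar> < d" by linarith
    then show ?thesis
    proof cases
      case 1
      then have "f t = 1" using d by (simp add: f_def min_def max_def)
      then show ?thesis using 1 d by simp
    next
      case 2
      then have "f t = - 1" using d by (simp add: f_def min_def max_def divide_simps)
      then show ?thesis using 2 d by simp
    next
      case 3
      then have "\<bar>t / d\<bar> < 1" using d by (simp add: abs_divide)
      then have "f t = t / d" unfolding f_def by linarith
      then have "0 \<le> f t * t" using d by simp
      then show ?thesis using 3 by simp
    qed
  qed
  have inv: "\<bar>f ((y - z) \<bullet> e) - u (inversion R c y)\<bar> < d" if y: "norm y = 1" for y
  proof -
    define w where "w = inversion R c y"
    have yc: "y \<noteq> c" using y c_outside by auto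
    have w: "norm w = 1" unfolding w_def using y by (intro inversion_ball(2)) auto
    have "(w - c) \<bullet> (w - c) = 1 - 2 * (w \<bullet> e) / r + 1 / r\<^sup>2"
      using w params(9) by (simp add: cr inner_diff_left inner_diff_right inner_commute norm_eq_1 power2_eq_square)
    then have "inversion R c w \<bullet> e = m (w \<bullet> e)"
      by (simp add: inversion_def m_def inner_add_left inner_diff_left)
    moreover have "inversion R c w = y"
      unfolding w_def using yc params(6) by (intro inversion_inversion) auto
    ultimately have "m (w \<bullet> e) - z \<bullet> e = (y - z) \<bullet> e" by (simp add: inner_diff_left)
    then show ?thesis using q(2)[OF ye[OF w]] u[OF w] by (simp add: w_def)
  qed
  have cont: "continuous_on (cball 0 1) (\<lambda>y. kelvin p R c u y * ((y - z) \<bullet> e))"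
    by (intro continuous_intros continuous_on_kelvin[OF h]) auto
  have "dint e + (- 3 * d) * B
      = sphere_integral z (\<lambda>y. dens y * \<bar>(y - z) \<bullet> e\<bar> + (- 3 * d) * dens y)"
    unfolding B_def sphere_integral_cmult[symmetric]
    by (intro sphere_integral_add_continuous[symmetric] continuous_intros continuous_on_dens norm_z)
  also have "\<dots> \<le> sphere_integral z (\<lambda>y. kelvin p R c u y * ((y - z) \<bullet> e))"
  proof (rule sphere_integral_mono[OF _ cont norm_z])
    fix y :: 'a assume y: "norm y = 1"
    define t where "t = (y - z) \<bullet> e"
    have t2: "\<bar>t\<bar> \<le> 2"
    proof -
      have "\<bar>t\<bar> \<le> norm (y - z) * norm e" unfolding t_def by (rule Cauchy_Schwarz_ineq2)
      also have "\<dots> \<le> 2" using norm_triangle_ineq4[of y z] y norm_z params(9) by simp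
      finally show ?thesis .
    qed
    have "(f t - u (inversion R c y)) * t \<le> \<bar>f t - u (inversion R c y)\<bar> * \<bar>t\<bar>"
      by (simp flip: abs_mult)
    also have "\<dots> \<le> d * 2" using inv[OF y] t2 d by (intro mult_mono) (auto simp: t_def)
    finally have "\<bar>t\<bar> - 3 * d \<le> u (inversion R c y) * t" using ft[of t] by (simp add: left_diff_distrib)
    then have "dens y * (\<bar>t\<bar> - 3 * d) \<le> dens y * (u (inversion R c y) * t)"
      by (rule mult_left_mono[OF _ dens_nonneg])
    then show "dens y * \<bar>(y - z) \<bullet> e\<bar> + (- 3 * d) * dens y \<le> kelvin p R c u y * ((y - z) \<bullet> e)"
      by (simp add: kelvin_dens t_def algebra_simps)
  qed (intro continuous_intros continuous_on_dens)
  also have "\<dots> = ?D * (g x \<bullet> mirror e e)"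
    by (rule kelvin_gradient_formula[OF h]) auto
  \<comment> \<open>The reflection reverses its own axis; the sign disappears in the absolute
    value.\<close>
  also have "g x \<bullet> mirror e e = - (g x \<bullet> e)"
    using params(9) by (simp add: mirror_def norm_eq_1 inner_diff_right)
  also have "?D * - (g x \<bullet> e) \<le> ?D * \<bar>g x \<bullet> e\<bar>"
    using denominator_pos by (intro mult_left_mono) auto
  finally have "dint e \<le> ?D * (\<bar>g x \<bullet> e\<bar> + eps)"
    using d(3) by (simp add: algebra_simps)
  then have "sharp_const \<le> \<bar>g x \<bullet> e\<bar> + eps"
    unfolding sharp_const_def using denominator_pos by (simp add: pos_divide_le_eq mult.commute)
  moreover have "\<bar>u y\<bar> \<le> 1 + eps" if "norm y = 1" for y using u1[OF that] d(2) by simp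
  ultimately show ?thesis using h by (intro exI[of _ u] exI[of _ g] exI[of _ H]) auto
qed

end

text \<open>No inversion is attached to the centre, so \<open>x = 0\<close> is treated by the mean
  value formula directly. The lemma turns bounds on the sphere into bounds on the supremum norm of
  the nearly extremal functions.\<close>

lemma harmonic_bound:
  fixes u :: "'a::euclidean_space \<Rightarrow> real"
  assumes dim: "DIM('a) \<ge> 3" and h: "harmonic_with u g H U" and U: "open U" "cball 0 1 \<subseteq> U"
    and M: "\<And>y. norm y = 1 \<Longrightarrow> u y \<le> M" and x: "norm x < 1"
  shows "u x \<le> M"
proof (cases "x = 0")
  case False
  then show ?thesis
    using harmonic_bound_at_point[OF dim False x refl refl refl refl refl refl refl h U M] by simp
next
  case True
  let ?C = "real DIM('a) * measure lborel (ball 0 1 :: 'a set)"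
  have const: "harmonic_with (\<lambda>_. M) (\<lambda>_. 0) (\<lambda>_ _. 0) (UNIV :: 'a set)"
    by (rule harmonic_with_const)
  have z0: "norm (0::'a) < 1" by simp
  have "sphere_integral 0 u \<le> sphere_integral (0::'a) (\<lambda>_. M)"
    using continuous_on_subset[OF harmonic_with_continuous(1)[OF h] U(2)] M
    by (intro sphere_integral_mono z0) auto
  then have "?C * u 0 \<le> ?C * M"
    unfolding sphere_mean_value[OF h U z0] sphere_mean_value[OF const open_UNIV subset_UNIV z0] .
  moreover have "0 < ?C" by (simp add: content_ball_pos)
  ultimately show ?thesis using True by (simp only: mult_le_cancel_left_pos)
qed

section \<open>Transfer to bounded harmonic functions and the extremal constants\<close>

lemma harmonic_on_iff: "harmonic_on u S \<longleftrightarrow> (\<exists>g H. harmonic_with u g H S)"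
  unfolding harmonic_on_def harmonic_with_def ..

lemma grad_eq:
  assumes "(u has_derivative (\<lambda>h. g \<bullet> h)) (at x)"
  shows "grad u x = g"
  unfolding grad_def frechet_derivative_at[OF assms, symmetric]
  by (simp add: euclidean_representation)

lemma abs_le_supnorm:
  assumes "u \<in> hinf" "y \<in> ball 0 1"
  shows "\<bar>u y\<bar> \<le> supnorm u"
proof -
  have "bounded (u ` ball 0 1)" using assms(1) by (simp add: hinf_def)
  then obtain B where "\<forall>t\<in>u ` ball 0 1. norm t \<le> B" unfolding bounded_iff by blast
  then have "\<bar>u y\<bar> \<le> B" if "y \<in> ball 0 1" for y using that by force
  then have "bdd_above ((\<lambda>y. \<bar>u y\<bar>) ` ball 0 1)" by (intro bdd_aboveI2)
  then show ?thesis unfolding supnorm_def using assms(2) by (intro cSUP_upper)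
qed

theorem theorem1p2:
  fixes x :: "'a::euclidean_space"
  assumes "DIM('a) \<ge> 3"
    and "x \<in> ball 0 1"
    and "x \<noteq> 0"
  shows "Cgrad x = Cdir x (x /\<^sub>R norm x)"
proof -
  define e where "e = x /\<^sub>R norm x"
  have x1: "norm x < 1" using assms(2) by simp
  have e1: "norm e = 1" using assms(3) by (simp add: e_def)
  have e: "e = (1 / norm x) *\<^sub>R x" by (simp add: e_def divide_inverse)
  note point = assms(1,3) x1 refl refl refl refl refl refl e
  note upper = gradient_bound[OF point] and lower = gradient_bound_sharp[OF point]
  define C where "C = sharp_const ((real DIM('a) - 2) / 2) (norm x) (1 / (norm x)\<^sup>2 - 1)
    (((real DIM('a) - 2) / 2 / ((real DIM('a) - 2) / 2 + 1)) *\<^sub>R x) ((1 / (norm x)\<^sup>2) *\<^sub>R x) e"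
  note upper = upper[folded C_def] and lower = lower[folded C_def]
  have bound: "norm (grad u x) \<le> C * supnorm u" if u: "u \<in> hinf" for u
  proof -
    obtain g H where h: "harmonic_with u g H (ball 0 1)"
      using u unfolding hinf_def harmonic_on_iff by blast
    have gx: "grad u x = g x" by (rule grad_eq[OF harmonic_withD(1)[OF h assms(2)]])
    \<comment> \<open>The dilated function is harmonic on a ball of radius 1 / s > 1, so the
      estimate for the closed ball applies to it; its boundary values are interior values of
      \<open>u\<close>. The limit s -> 1 uses only continuity of the gradient at
      \<open>x\<close>.\<close>
    have scaled: "s * norm (g (s *\<^sub>R x)) \<le> C * supnorm u" if s: "0 < s" "s < 1" for s
    proof -
      have "norm (s *\<^sub>R g (s *\<^sub>R x)) \<le> C * supnorm u"
      proof (rule upper[OF harmonic_with_scale[OF h]])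
        show "open {y::'a. s *\<^sub>R y \<in> ball 0 1}"
          by (intro open_vimage[OF open_ball, unfolded vimage_def]) (auto intro!: continuous_intros)
        show "cball 0 1 \<subseteq> {y::'a. s *\<^sub>R y \<in> ball 0 1}"
          using s by (auto intro: le_less_trans[OF mult_left_le])
        show "\<bar>u (s *\<^sub>R y)\<bar> \<le> supnorm u" if "norm y = 1" for y
          using that s by (intro abs_le_supnorm[OF u]) simp
      qed
      then show ?thesis using s by simp
    qed
    define s where "s i = 1 - inverse (real (Suc (Suc i)))" for i
    have s: "0 < s i" "s i < 1" for i by (auto simp: s_def inverse_eq_divide)
    have "s \<longlonglongrightarrow> 1 - 0" unfolding s_def[abs_def]
      by (intro tendsto_diff tendsto_const LIMSEQ_Suc[OF LIMSEQ_inverse_real_of_nat])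
    then have lim: "s \<longlonglongrightarrow> 1" by simp
    have "isCont g x" using harmonic_withD(2)[OF h assms(2)] by (rule has_derivative_continuous)
    moreover have "(\<lambda>i. s i *\<^sub>R x) \<longlonglongrightarrow> x"
      using tendsto_scaleR[OF lim tendsto_const[of x]] by simp
    ultimately have "(\<lambda>i. g (s i *\<^sub>R x)) \<longlonglongrightarrow> g x" by (rule isCont_tendsto_compose)
    then have "(\<lambda>i. s i * norm (g (s i *\<^sub>R x))) \<longlonglongrightarrow> 1 * norm (g x)"
      by (intro tendsto_mult tendsto_norm lim)
    then show ?thesis
      unfolding gx using scaled[OF s] by (simp add: LIMSEQ_le_const2)
  qed
  \<comment> \<open>The constant function tests an admissible \<open>k\<close> and forces
    \<open>0 \<le> k\<close>.\<close>
  have one: "(\<lambda>_. 1) \<in> (hinf :: ('a \<Rightarrow> real) set)" "grad (\<lambda>_. 1) x = 0" "supnorm (\<lambda>_::'a. 1) = 1"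
  proof -
    have "harmonic_on (\<lambda>_::'a. 1) (ball 0 1)"
      unfolding harmonic_on_iff by (intro exI) (rule harmonic_with_const)
    then show "(\<lambda>_. 1) \<in> (hinf :: ('a \<Rightarrow> real) set)"
      by (simp add: hinf_def image_constant_conv)
    show "grad (\<lambda>_. 1) x = 0"
      by (rule grad_eq[OF harmonic_withD(1)[OF harmonic_with_const UNIV_I]])
    show "supnorm (\<lambda>_::'a. 1) = 1" by (simp add: supnorm_def)
  qed
  have ge: "C \<le> k" if k: "\<And>u. u \<in> hinf \<Longrightarrow> \<bar>grad u x \<bullet> e\<bar> \<le> k * supnorm u" for k
  proof (rule field_le_epsilon)
    have k0: "0 \<le> k" using k[OF one(1)] one by simp
    fix eps :: real assume eps: "0 < eps"
    \<comment> \<open>The gradient loses \<open>d\<close> and the supremum norm costs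
      \<open>k * d\<close>; together these make \<open>eps\<close>.\<close>
    define d where "d = eps / (k + 1)"
    have d: "0 < d" using eps k0 by (simp add: d_def)
    obtain u g H where h: "harmonic_with u g H (UNIV :: 'a set)"
      and u: "\<And>y. norm y = 1 \<Longrightarrow> \<bar>u y\<bar> \<le> 1 + d" and lo: "C - d \<le> \<bar>g x \<bullet> e\<bar>"
      using lower[OF d] by blast
    have h': "harmonic_with (\<lambda>y. - 1 * u y) (\<lambda>y. - 1 *\<^sub>R g y) (\<lambda>y k. - 1 *\<^sub>R H y k) UNIV"
      by (rule harmonic_with_cmult[OF h])
    have ub: "\<bar>u y\<bar> \<le> 1 + d" if y: "y \<in> ball 0 1" for y
    proof -
      have M: "u y \<le> 1 + d" "- 1 * u y \<le> 1 + d" if "norm y = 1" for y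
        using u[OF that] by linarith+
      have y1: "norm y < 1" using y by simp
      have "u y \<le> 1 + d" by (rule harmonic_bound[OF assms(1) h open_UNIV subset_UNIV M(1) y1])
      moreover have "- 1 * u y \<le> 1 + d"
        by (rule harmonic_bound[OF assms(1) h' open_UNIV subset_UNIV M(2) y1])
      ultimately show ?thesis by simp
    qed
    have uh: "u \<in> hinf"
    proof -
      have "harmonic_with u g H (ball 0 1)" by (rule harmonic_with_subset[OF h subset_UNIV])
      then have "harmonic_on u (ball 0 1)" unfolding harmonic_on_iff by blast
      moreover have "bounded (u ` ball 0 1)"
        by (rule boundedI[of _ "1 + d"]) (use ub in force)
      ultimately show ?thesis by (simp add: hinf_def)
    qed
    have sup: "supnorm u \<le> 1 + d" unfolding supnorm_def using ub by (intro cSUP_least) auto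
    have "grad u x = g x" by (rule grad_eq[OF harmonic_withD(1)[OF h UNIV_I]])
    then have "C - d \<le> k * supnorm u" using lo k[OF uh] by simp
    also have "\<dots> \<le> k * (1 + d)" using sup k0 by (rule mult_left_mono)
    finally have "C \<le> k + d * (k + 1)" by (simp add: algebra_simps)
    then show "C \<le> k + eps" using k0 by (simp add: d_def)
  qed
  \<comment> \<open>The two sets of admissible constants coincide, so their infima do. The
    substantial inclusion holds because a constant admissible for the direction \<open>e\<close> is
    at least \<open>C\<close>, and \<open>C\<close> already bounds the whole gradient.\<close>
  have "{k. \<forall>u\<in>(hinf :: ('a \<Rightarrow> real) set). norm (grad u x) \<le> k * supnorm u}
      = {k. \<forall>u\<in>(hinf :: ('a \<Rightarrow> real) set). \<bar>grad u x \<bullet> e\<bar> \<le> k * supnorm u}"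
  proof (intro equalityI subsetI CollectI ballI; drule CollectD)
    fix k and u :: "'a \<Rightarrow> real"
    assume k: "\<forall>u\<in>hinf. norm (grad u x) \<le> k * supnorm u" and u: "u \<in> hinf"
    have "\<bar>grad u x \<bullet> e\<bar> \<le> norm (grad u x)"
      using Cauchy_Schwarz_ineq2[of "grad u x" e] e1 by simp
    then show "\<bar>grad u x \<bullet> e\<bar> \<le> k * supnorm u" using k u by fastforce
  next
    fix k and u :: "'a \<Rightarrow> real"
    assume k: "\<forall>u\<in>hinf. \<bar>grad u x \<bullet> e\<bar> \<le> k * supnorm u" and u: "u \<in> hinf"
    have "0 \<le> supnorm u" using abs_le_supnorm[OF u, of 0] by simp
    then have "C * supnorm u \<le> k * supnorm u" using ge k by (intro mult_right_mono) auto
    then show "norm (grad u x) \<le> k * supnorm u" using bound[OF u] by linarith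
  qed
  then show ?thesis by (simp add: Cgrad_def Cdir_def e_def)
qed

end
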